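(* For each $h\in B_0(\mathbb R_+)$, the operator $J\langle\omega,h\rangle J^{-1}$ on $\mathbb F$ equals $A^+(h)+B^0(h)+B^-(h)$, where: (i) $A^+(h)\Omega=h$ and for $f^{(n)}\in L^2(T_n,m_n)$, $A^+(h)f^{(n)}\in L^2(T_{n+1},m_{n+1})$, $(A^+(h)f^{(n)})(t_1,\dots,t_{n+1})=h(t_1)f^{(n)}(t_2,\dots,t_{n+1})$; (ii) $B^0(h)\Omega=0$, and for $f^{(n)}\in L^2(T_n,m_n)$, $B^0(h)f^{(n)}\in L^2(T_n,m_n)$ with $(B^0(h)f^{(n)})(t_1,\dots,t_n)=b_{l_1}h(t_1)f^{(n)}(t_1,\dots,t_n)$ whenever $(t_1,\dots,t_n)\in T^{(l_1,\dots,l_i)}$, $l_1+\dots+l_i+i=n$; (iii) $B^-(h)\Omega=0$; for $f^{(1)}\in L^2(T_1,m_1)=L^2(\mathbb R_+,dt)$, $B^-(h)f^{(1)}=\int_{\mathbb R_+}h(u)f^{(1)}(u)\,du\;\Omega$; and for $n\ge2$, $f^{(n)}\in L^2(T_n,m_n)$, $B^-(h)f^{(n)}\in L^2(T_{n-1},m_{n-1})$ with, for $(t_1,\dots,t_{n-1})\in T^{(l_1,\dots,l_i)}$, $l_1+\dots+l_i+i=n-1$, $$(B^-(h)f^{(n)})(t_1,\dots,t_{n-1})=\int_{t_1}^\infty h(u)f^{(n)}(u,t_1,\dots,t_{n-1})\,du+a_{l_1+1}h(t_1)f^{(n)}(t_1,t_1,t_2,\dots,t_{n-1}).$$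
   Context: Setup. Let $\nu$ be a probability measure on $\mathbb R$ with compact support, $\mathbb R_+=[0,\infty)$. For $n\in\mathbb N$ let $T_n=\{(t_1,\dots,t_n)\in\mathbb R_+^n: t_1\ge t_2\ge\dots\ge t_n\}$ and $S_n=\{(t_1,s_1,\dots,t_n,s_n)\in(\mathbb R_+\times\mathbb R)^n:(t_1,\dots,t_n)\in T_n\}$. The monotone Fock space is $\mathcal F=\bigoplus_{n\ge0}\mathcal F^{(n)}$, $\mathcal F^{(0)}=\mathbb R$, $\mathcal F^{(n)}=L^2(S_n,dt_1\,d\nu(s_1)\cdots dt_n\,d\nu(s_n))$; $\Omega=(1,0,0,\dots)$ is the vacuum and $f^{(n)}\in\mathcal F^{(n)}$ is identified with the corresponding element of $\mathcal F$. $B_0(\mathbb R_+^n)$ is the space of bounded measurable functions on $\mathbb R_+^n$ with compact support; a sequence converges in $B_0(\mathbb R_+^n)$ if all terms vanish outside a common compact set and it converges uniformly. For $h\in B_0(\mathbb R_+)$ define bounded operators on $\mathcal F$: the creation operator $a^+(h)$, $a^+(h)\Omega=h$ (the function $(t,s)\mapsto h(t)$), $(a^+(h)f^{(n)})(t_1,s_1,\dots,t_{n+1},s_{n+1})=h(t_1)f^{(n)}(t_2,s_2,\dots,t_{n+1},s_{n+1})$; the neutral operator $a^0(h)$, $a^0(h)\Omega=0$, $(a^0(h)f^{(n)})(t_1,s_1,\dots,t_n,s_n)=h(t_1)s_1f^{(n)}(t_1,s_1,\dots,t_n,s_n)$; the annihilation operator $a^-(h)$, $a^-(h)\Omega=0$,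 $(a^-(h)f^{(n)})(t_1,s_1,\dots,t_{n-1},s_{n-1})=\int_{t_1}^\infty\int_{\mathbb R}h(u)f^{(n)}(u,v,t_1,s_1,\dots,t_{n-1},s_{n-1})\,d\nu(v)\,du$ (for $n=1$: $\int_0^\infty\int_{\mathbb R}h(u)f^{(1)}(u,v)\,d\nu(v)\,du\;\Omega$). Put $\langle\omega,h\rangle=a^+(h)+a^0(h)+a^-(h)$, a bounded self-adjoint operator. For $h_1,\dots,h_n\in B_0(\mathbb R_+)$ put $\langle\omega^{\otimes n},h_1\otimes\cdots\otimes h_n\rangle=\langle\omega,h_1\rangle\cdots\langle\omega,h_n\rangle$, where $(h_1\otimes\cdots\otimes h_n)(t_1,\dots,t_n)=h_1(t_1)\cdots h_n(t_n)$; this extends by linearity and strong continuity to a map $f^{(n)}\mapsto\langle\omega^{\otimes n},f^{(n)}\rangle$ from $B_0(\mathbb R_+^n)$ to bounded operators on $\mathcal F$ (monomials of order $n$; monomials of order $0$ are real multiples of the identity). Let $\mathbf P$ be the linear span of all monomials (polynomials of $\omega$) and $\mathbf P^{(n)}$ the span of monomials of order $\le n$. $L^2(\tau)$ is the Hilbert space completion of $\mathbf P$ modulo null vectors with respect to $(P_1,P_2)_{L^2(\tau)}=(P_1\Omega,P_2\Omega)_{\mathcal F}$. Let $\mathbf S^{(0)}=\overline{\mathbf P^{(0)}}$ and $\mathbf S^{(n)}=\overline{\mathbf P^{(n)}}\ominus\overline{\mathbf P^{(n-1)}}$ (closures in $L^2(\tau)$). For $f^{(n)}\in B_0(\mathbb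 R_+^n)$ the orthogonal polynomial $\langle P^{(n)}(\omega),f^{(n)}\rangle$ is the orthogonal projection in $L^2(\tau)$ of $\langle\omega^{\otimes n},f^{(n)}\rangle$ onto $\mathbf S^{(n)}$. Orthogonal polynomials of $\nu$: $(p_k)_{k\ge0}$ are the monic orthogonal polynomials in $L^2(\mathbb R,\nu)$ (if $\operatorname{supp}\nu$ has $N$ points, $p_k:=0$ for $k\ge N$), satisfying $sp_k(s)=p_{k+1}(s)+b_kp_k(s)+a_kp_{k-1}(s)$, $k\ge0$, $p_{-1}=0$, $b_k\in\mathbb R$, $a_k\ge0$; set $a_0=1$ and $c_k=\int p_{k-1}^2\,d\nu=a_0a_1\cdots a_{k-1}$, $k\in\mathbb N$. Measures $m_n$: $M$ is the set of tuples $(l_1,\dots,l_i)\in\mathbb N_0^i$, $i\in\mathbb N$. For $(l_1,\dots,l_i)\in M$ with $l_1+\dots+l_i+i=n$, let $\phi_{(l_1,\dots,l_i)}$ map $(\tau_1,\dots,\tau_i)$ with $\tau_1>\dots>\tau_i\ge0$ to the point of $T_n$ whose coordinates are $\tau_1$ repeated $l_1+1$ times, then $\tau_2$ repeated $l_2+1$ times, …, then $\tau_i$ repeated $l_i+1$ times; its image is $T^{(l_1,\dots,l_i)}$ (these sets partition $T_n$). $m^{(l_1,\dots,l_i)}$ is the image under $\phi_{(l_1,\dots,l_i)}$ of the measure $c_{l_1+1}c_{l_2+1}\cdots c_{l_i+1}\,d\tau_1\cdots d\tau_i$, regarded as a measure on $T_n$, and $m_n=\sum_{(l_1,\dots,l_i)\in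 M,\ l_1+\dots+l_i+i=n}m^{(l_1,\dots,l_i)}$. Extended monotone Fock space: $\mathbb F=\mathbb R\oplus\bigoplus_{n\ge1}L^2(T_n,m_n)$, with vacuum $\Omega=(1,0,0,\dots)$. The map sending constants to themselves and $\langle P^{(n)}(\omega),f^{(n)}\rangle\mapsto f^{(n)}|_{T_n}\in L^2(T_n,m_n)$ ($n\ge1$, $f^{(n)}\in B_0(\mathbb R_+^n)$) extends to a unitary operator $J:L^2(\tau)\to\mathbb F$ (using $\|\langle P^{(n)}(\omega),f^{(n)}\rangle\|_{L^2(\tau)}=\|f^{(n)}\|_{L^2(T_n,m_n)}$ and $L^2(\tau)=\bigoplus_n\mathbf S^{(n)}$). For $h\in B_0(\mathbb R_+)$, $\langle\omega,h\rangle$ also denotes the bounded self-adjoint operator of left multiplication $P\mapsto\langle\omega,h\rangle P$ on $L^2(\tau)$ (extended from $\mathbf P$ by continuity). *)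

theory Defs
  imports "HOL-Probability.Probability" "HOL-Computational_Algebra.Polynomial"
begin

definition compact_support :: "real measure \<Rightarrow> bool" where
  "compact_support \<nu> \<longleftrightarrow> (\<exists>K. compact K \<and> emeasure \<nu> (UNIV - K) = 0)"

definition nu_ip :: "real measure \<Rightarrow> real poly \<Rightarrow> real poly \<Rightarrow> real" where
  "nu_ip \<nu> p q = (\<integral>s. poly p s * poly q s \<partial>\<nu>)"

definition is_monic_orth :: "real measure \<Rightarrow> nat \<Rightarrow> real poly \<Rightarrow> bool" where
  "is_monic_orth \<nu> k q \<longleftrightarrow> degree q = k \<and> lead_coeff q = 1 \<and>
     (\<forall>r. degree r < k \<longrightarrow> nu_ip \<nu> q r = 0)"

text \<open>monic orthogonal polynomials; p_k := 0 if there is no such polynomial of non-zero L2 norm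
  (i.e. k >= N when supp nu has N points)\<close>
definition opoly :: "real measure \<Rightarrow> nat \<Rightarrow> real poly" where
  "opoly \<nu> k = (if \<exists>q. is_monic_orth \<nu> k q \<and> nu_ip \<nu> q q > 0
                 then (THE q. is_monic_orth \<nu> k q) else 0)"

text \<open>Jacobi parameters: s p_k = p_{k+1} + b_k p_k + a_k p_{k-1}, a_0 = 1\<close>
definition bcoef :: "real measure \<Rightarrow> nat \<Rightarrow> real" where
  "bcoef \<nu> k = (\<integral>s. s * (poly (opoly \<nu> k) s)\<^sup>2 \<partial>\<nu>) / nu_ip \<nu> (opoly \<nu> k) (opoly \<nu> k)"

definition acoef :: "real measure \<Rightarrow> nat \<Rightarrow> real" where
  "acoef \<nu> k = (if k = 0 then 1 else
     nu_ip \<nu> (opoly \<nu> k) (opoly \<nu> k) / nu_ip \<nu> (opoly \<nu> (k - 1)) (opoly \<nu> (k - 1)))"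

definition ccoef :: "real measure \<Rightarrow> nat \<Rightarrow> real" where
  "ccoef \<nu> k = nu_ip \<nu> (opoly \<nu> (k - 1)) (opoly \<nu> (k - 1))"

definition B0 :: "(real \<Rightarrow> real) set" where
  "B0 = {h. h \<in> borel_measurable borel \<and> (\<exists>B. \<forall>t. \<bar>h t\<bar> \<le> B) \<and> (\<exists>C. \<forall>t. t > C \<longrightarrow> h t = 0)}"

text \<open>A point of S_n is represented as an (extensional) function on {..<n}, with values (t_j, s_j);
  an element of the Fock space as a sequence of functions, the n-th component living on S_n
  (component 0 lives on the one-point space of functions on the empty index set).\<close>

type_synonym fockvec = "nat \<Rightarrow> (nat \<Rightarrow> real \<times> real) \<Rightarrow> real"

definition M1 :: "real measure \<Rightarrow> (real \<times> real) measure" where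
  "M1 \<nu> = restrict_space lborel {0..} \<Otimes>\<^sub>M \<nu>"

definition Sn_meas :: "real measure \<Rightarrow> nat \<Rightarrow> (nat \<Rightarrow> real \<times> real) measure" where
  "Sn_meas \<nu> n = PiM {..<n} (\<lambda>_. M1 \<nu>)"

definition Sset :: "nat \<Rightarrow> (nat \<Rightarrow> real \<times> real) set" where
  "Sset n = {x. \<forall>i j. i \<le> j \<longrightarrow> j < n \<longrightarrow> fst (x j) \<le> fst (x i)}"

definition fock_norm2 :: "real measure \<Rightarrow> fockvec \<Rightarrow> ennreal" where
  "fock_norm2 \<nu> F = (\<Sum>n. \<integral>\<^sup>+ x. indicator (Sset n) x * ennreal ((F n x)\<^sup>2) \<partial>Sn_meas \<nu> n)"

definition fock_inner :: "real measure \<Rightarrow> fockvec \<Rightarrow> fockvec \<Rightarrow> real" where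
  "fock_inner \<nu> F G = (\<Sum>n. \<integral>x. indicator (Sset n) x * F n x * G n x \<partial>Sn_meas \<nu> n)"

definition fock_space :: "real measure \<Rightarrow> fockvec set" where
  "fock_space \<nu> = {F. (\<forall>n. F n \<in> borel_measurable (Sn_meas \<nu> n)) \<and> fock_norm2 \<nu> F < \<infinity>}"

definition vdiff :: "('a \<Rightarrow> 'b \<Rightarrow> real) \<Rightarrow> ('a \<Rightarrow> 'b \<Rightarrow> real) \<Rightarrow> 'a \<Rightarrow> 'b \<Rightarrow> real" where
  "vdiff F G = (\<lambda>n x. F n x - G n x)"

definition vlin :: "real \<Rightarrow> ('a \<Rightarrow> 'b \<Rightarrow> real) \<Rightarrow> real \<Rightarrow> ('a \<Rightarrow> 'b \<Rightarrow> real) \<Rightarrow> 'a \<Rightarrow> 'b \<Rightarrow> real" where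
  "vlin a F b G = (\<lambda>n x. a * F n x + b * G n x)"

definition Omega :: fockvec where
  "Omega = (\<lambda>n x. if n = 0 then 1 else 0)"

definition ptail :: "nat \<Rightarrow> (nat \<Rightarrow> 'a) \<Rightarrow> nat \<Rightarrow> 'a" where
  "ptail n x = (\<lambda>j. if j < n then x (Suc j) else undefined)"

definition pcons :: "nat \<Rightarrow> 'a \<Rightarrow> (nat \<Rightarrow> 'a) \<Rightarrow> nat \<Rightarrow> 'a" where
  "pcons n p x = (\<lambda>j. if j = 0 then p else if j < Suc n then x (j - 1) else undefined)"

definition acre :: "(real \<Rightarrow> real) \<Rightarrow> fockvec \<Rightarrow> fockvec" where
  "acre h F = (\<lambda>n x. case n of 0 \<Rightarrow> 0 | Suc m \<Rightarrow> h (fst (x 0)) * F m (ptail m x))"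

definition aneu :: "(real \<Rightarrow> real) \<Rightarrow> fockvec \<Rightarrow> fockvec" where
  "aneu h F = (\<lambda>n x. if n = 0 then 0 else h (fst (x 0)) * snd (x 0) * F n x)"

definition aann :: "real measure \<Rightarrow> (real \<Rightarrow> real) \<Rightarrow> fockvec \<Rightarrow> fockvec" where
  "aann \<nu> h F = (\<lambda>n x. \<integral>p. indicator {p. n = 0 \<or> fst (x 0) \<le> fst p} p * h (fst p)
                                * F (Suc n) (pcons n p x) \<partial>M1 \<nu>)"

definition omega :: "real measure \<Rightarrow> (real \<Rightarrow> real) \<Rightarrow> fockvec \<Rightarrow> fockvec" where
  "omega \<nu> h F = (\<lambda>n x. acre h F n x + aneu h F n x + aann \<nu> h F n x)"

definition mono_vec :: "real measure \<Rightarrow> (real \<Rightarrow> real) list \<Rightarrow> fockvec" where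
  "mono_vec \<nu> hs = foldr (omega \<nu>) hs Omega"

definition lin_span :: "fockvec set \<Rightarrow> fockvec set" where
  "lin_span A = {F. \<exists>(k::nat) c g. (\<forall>i<k. g i \<in> A) \<and> F = (\<lambda>n x. \<Sum>i<k. c i * g i n x)}"

definition fock_closure :: "real measure \<Rightarrow> fockvec set \<Rightarrow> fockvec set" where
  "fock_closure \<nu> A = {G \<in> fock_space \<nu>. \<forall>e>0. \<exists>P\<in>A. fock_norm2 \<nu> (vdiff G P) < ennreal e}"

definition Pn_vec :: "real measure \<Rightarrow> nat \<Rightarrow> fockvec set" where
  "Pn_vec \<nu> n = lin_span {mono_vec \<nu> hs | hs. length hs \<le> n \<and> set hs \<subseteq> B0}"

definition P_vec :: "real measure \<Rightarrow> fockvec set" where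
  "P_vec \<nu> = lin_span {mono_vec \<nu> hs | hs. set hs \<subseteq> B0}"

text \<open>L^2(tau), realised as the closure of P Omega in the monotone Fock space\<close>
definition L2tau :: "real measure \<Rightarrow> fockvec set" where
  "L2tau \<nu> = fock_closure \<nu> (P_vec \<nu>)"

text \<open>Q is the orthogonal projection of the monomial with symbol h_1 x ... x h_n onto
  S^{(n)} = closure P^{(n)} minus closure P^{(n-1)}  (n >= 1)\<close>
definition is_orth_poly :: "real measure \<Rightarrow> (real \<Rightarrow> real) list \<Rightarrow> fockvec \<Rightarrow> bool" where
  "is_orth_poly \<nu> hs Q \<longleftrightarrow>
     Q \<in> fock_closure \<nu> (Pn_vec \<nu> (length hs)) \<and>
     (\<forall>R \<in> fock_closure \<nu> (Pn_vec \<nu> (length hs - 1)). fock_inner \<nu> Q R = 0) \<and>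
     vdiff (mono_vec \<nu> hs) Q \<in> fock_closure \<nu> (Pn_vec \<nu> (length hs - 1))"

text \<open>A point of T_n is an extensional function on {..<n}; component 0 of an element
  is its value at the point (\<lambda>_. undefined).\<close>

type_synonym efockvec = "nat \<Rightarrow> (nat \<Rightarrow> real) \<Rightarrow> real"

definition pt0 :: "nat \<Rightarrow> real" where "pt0 = (\<lambda>_. undefined)"

definition comps :: "nat \<Rightarrow> nat list set" where
  "comps n = {ls. ls \<noteq> [] \<and> sum_list ls + length ls = n}"

definition decset :: "nat \<Rightarrow> (nat \<Rightarrow> real) set" where
  "decset i = {\<tau>. (\<forall>k. Suc k < i \<longrightarrow> \<tau> (Suc k) < \<tau> k) \<and> (0 < i \<longrightarrow> 0 \<le> \<tau> (i - 1))}"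

definition phi :: "nat list \<Rightarrow> (nat \<Rightarrow> real) \<Rightarrow> nat \<Rightarrow> real" where
  "phi ls \<tau> = (\<lambda>j. if j < sum_list ls + length ls
      then concat (map (\<lambda>k. replicate (ls ! k + 1) (\<tau> k)) [0..<length ls]) ! j else undefined)"

text \<open>integral of a nonnegative function w.r.t. m_n = sum of the image measures m^{(l_1,...,l_i)}\<close>
definition m_int :: "real measure \<Rightarrow> nat \<Rightarrow> ((nat \<Rightarrow> real) \<Rightarrow> real) \<Rightarrow> ennreal" where
  "m_int \<nu> n g = (\<Sum>ls\<in>comps n. ennreal (\<Prod>k<length ls. ccoef \<nu> (ls ! k + 1)) *
      (\<integral>\<^sup>+ \<tau>. indicator (decset (length ls)) \<tau> * ennreal (g (phi ls \<tau>))
          \<partial>PiM {..<length ls} (\<lambda>_. lborel)))"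

definition efock_norm2 :: "real measure \<Rightarrow> efockvec \<Rightarrow> ennreal" where
  "efock_norm2 \<nu> F = ennreal ((F 0 pt0)\<^sup>2) + (\<Sum>n. m_int \<nu> (Suc n) (\<lambda>t. (F (Suc n) t)\<^sup>2))"

definition efock_space :: "real measure \<Rightarrow> efockvec set" where
  "efock_space \<nu> = {F. (\<forall>n>0. F n \<in> borel_measurable (PiM {..<n} (\<lambda>_. lborel)))
                       \<and> efock_norm2 \<nu> F < \<infinity>}"

definition eOmega :: efockvec where
  "eOmega = (\<lambda>n t. if n = 0 then 1 else 0)"

definition tens :: "(real \<Rightarrow> real) list \<Rightarrow> efockvec" where
  "tens hs = (\<lambda>n t. if n = length hs then (\<Prod>j<length hs. (hs ! j) (t j)) else 0)"

text \<open>J: unitary L^2(tau) \<rightarrow> F fixing constants and sending the orthogonal polynomials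
  <P^{(n)}(omega), h_1 x ... x h_n> to h_1 x ... x h_n; equalities are in the Hilbert spaces
  (i.e. modulo null vectors)\<close>
definition is_J :: "real measure \<Rightarrow> (fockvec \<Rightarrow> efockvec) \<Rightarrow> bool" where
  "is_J \<nu> J \<longleftrightarrow>
     (\<forall>G\<in>L2tau \<nu>. J G \<in> efock_space \<nu>) \<and>
     (\<forall>G\<in>L2tau \<nu>. \<forall>H\<in>L2tau \<nu>. \<forall>a b.
        efock_norm2 \<nu> (vdiff (J (vlin a G b H)) (vlin a (J G) b (J H))) = 0) \<and>
     (\<forall>G\<in>L2tau \<nu>. efock_norm2 \<nu> (J G) = fock_norm2 \<nu> G) \<and>
     (\<forall>F\<in>efock_space \<nu>. \<exists>G\<in>L2tau \<nu>. efock_norm2 \<nu> (vdiff (J G) F) = 0) \<and>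
     efock_norm2 \<nu> (vdiff (J Omega) eOmega) = 0 \<and>
     (\<forall>hs Q. hs \<noteq> [] \<longrightarrow> set hs \<subseteq> B0 \<longrightarrow> is_orth_poly \<nu> hs Q \<longrightarrow>
        efock_norm2 \<nu> (vdiff (J Q) (tens hs)) = 0)"

text \<open>l_1 for a point of T^{(l_1,...,l_i)}: number of coordinates equal to t_1, minus one\<close>
definition lfirst :: "nat \<Rightarrow> (nat \<Rightarrow> real) \<Rightarrow> nat" where
  "lfirst n t = card {j. j < n \<and> t j = t 0} - 1"

definition ABop :: "real measure \<Rightarrow> (real \<Rightarrow> real) \<Rightarrow> efockvec \<Rightarrow> efockvec" where
  "ABop \<nu> h F = (\<lambda>n t. if n = 0 then
        (\<integral>u. indicator {0..} u * h u * F 1 (pcons 0 u t) \<partial>lborel)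
      else
        h (t 0) * F (n - 1) (ptail (n - 1) t)
        + bcoef \<nu> (lfirst n t) * h (t 0) * F n t
        + (\<integral>u. indicator {t 0..} u * h u * F (Suc n) (pcons n u t) \<partial>lborel)
        + acoef \<nu> (Suc (lfirst n t)) * h (t 0) * F (Suc n) (pcons n (t 0) t))"

end

theory Submission
  imports Defs
begin

text \<open>
  The inverse of \<open>J\<close> can be written down explicitly. For \<open>f\<close> on \<open>T_n\<close> let
  \<open>(U f)_i (t_1, s_1, \<dots>, t_i, s_i)\<close> be the sum, over all \<open>(l_1, \<dots>, l_i)\<close> with \<open>l_1 + \<dots> + l_i + i = n\<close>,
  of \<open>p_{l_1}(s_1) \<cdots> p_{l_i}(s_i)\<close> times the value of \<open>f\<close> at the point in which \<open>t_k\<close> is repeated \<open>l_k + 1\<close> times.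
  By orthogonality of the \<open>p_k\<close>, \<open>U\<close> is an isometry for exactly the measures \<open>m_n\<close>, and inserting
  \<open>s p_l = p_{l+1} + b_l p_l + a_l p_{l-1}\<close> at the first coordinate turns \<open>\<langle>\<omega>, h\<rangle> U\<close> into
  \<open>U (A\<^sup>+(h) + B\<^sup>0(h) + B\<^sup>-(h))\<close>.
  Consequently \<open>\<langle>\<omega>, h_1\<rangle> \<cdots> \<langle>\<omega>, h_n\<rangle> \<Omega>\<close> is \<open>U\<close> of a vector whose component of degree \<open>n\<close> is
  \<open>h_1 \<otimes> \<cdots> \<otimes> h_n\<close>; since components of different degree have orthogonal images, and those of degree below \<open>n\<close>
  are limits of polynomials of degree below \<open>n\<close> (induction, using that tensor products are dense in
  \<open>L\<^sup>2(T_n, m_n)\<close>), \<open>U (h_1 \<otimes> \<cdots> \<otimes> h_n)\<close> is the orthogonal polynomial and \<open>J U\<close> is the identity.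
  General vectors are reached by truncating the degree: \<open>\<langle>\<omega>, h\<rangle>\<close> is bounded, and a component of
  \<open>A\<^sup>+(h) + B\<^sup>0(h) + B\<^sup>-(h)\<close> only sees the neighbouring degrees.
\<close>

subsection \<open>Orthogonal polynomials of a compactly supported measure\<close>

text \<open>The measures \<open>m_n\<close> charge the diagonals of \<open>T_n\<close>, while the
  times of a point of \<open>S_n\<close> are almost surely distinct. The dictionary is that the
  multiplicity of a time becomes the degree of the polynomial in the mark at that time;
  \<open>c_{l+1}\<close> is the squared norm of \<open>p_l\<close>. Annihilation integrates out the
  first mark and so sees only \<open>p_0\<close>, which is why it yields just the integral part of
  \<open>B^-\<close>; the diagonal part comes from the neutral operator. Three obstacles shape the
  details. For a fixed number of marks infinitely many lists would enter \<open>U\<close>, so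
  \<open>U\<close> is applied to vectors of bounded degree only. Vectors are functions, not classes,
  and sections need not be integrable, so identities on the Fock side hold almost everywhere and are
  passed on through boundedness of \<open>omega\<close>. Finally \<open>J\<close> is linear only up
  to null vectors and is pinned down on the vacuum and on pure tensors, so the rest is a limiting
  argument with squared norms in \<open>ennreal\<close>; there
  \<open>(x + y)^2 \<le> 2 x^2 + 2 y^2\<close> replaces the triangle inequality, which suffices
  because only finiteness and smallness matter.\<close>

locale compact_prob = prob_space \<nu> for \<nu> :: "real measure" +
  assumes sets_nu [measurable_cong]: "sets \<nu> = sets borel"
    and compact_supp: "compact_support \<nu>"
begin

abbreviation "opl \<equiv> opoly \<nu>"

lemma space_nu [simp]: "space \<nu> = UNIV"
  using sets_eq_imp_space_eq[OF sets_nu] by simp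

lemma prob_UNIV [simp]: "prob UNIV = 1"
  using prob_space by simp

text \<open>\<open>R\<close> serves twice: polynomials are bounded on \<open>{-R..R}\<close>, hence
  \<nu>-integrable, and multiplication by a mark becomes a bounded operator.\<close>

lemma bounded_supp: obtains R where "R \<ge> 0" "AE s in \<nu>. \<bar>s\<bar> \<le> R"
proof -
  obtain K where K: "compact K" "emeasure \<nu> (UNIV - K) = 0"
    using compact_supp unfolding compact_support_def by blast
  obtain R where R: "R > 0" "\<And>s. s \<in> K \<Longrightarrow> norm s \<le> R"
    using compact_imp_bounded[OF K(1)] bounded_pos by metis
  have "K \<in> sets \<nu>" using K(1) by (simp add: sets_nu borel_compact)
  then have "AE s in \<nu>. s \<in> K"
    using K(2) by (intro AE_I[of _ _ "UNIV - K"]) (auto simp: sets_nu)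
  then show ?thesis using R by (intro that[of R]) auto
qed

lemma borel_measurable_poly [measurable]: "poly p \<in> borel_measurable borel" for p :: "real poly"
  by (intro borel_measurable_continuous_onI continuous_intros)

lemma integrable_poly [simp]: "integrable \<nu> (poly p)"
proof -
  obtain R where R: "R \<ge> 0" "AE s in \<nu>. \<bar>s\<bar> \<le> R" by (rule bounded_supp)
  have "compact (poly p ` {-R..R})" by (intro compact_continuous_image continuous_intros) auto
  then obtain B where B: "\<And>s. s \<in> {-R..R} \<Longrightarrow> norm (poly p s) \<le> B"
    using compact_imp_bounded bounded_pos by (metis (no_types, lifting) imageI)
  show ?thesis
    by (rule integrable_const_bound[where B = B]) (use R(2) B in \<open>auto simp: abs_le_iff\<close>)
qed

lemma integrable_poly_mult [simp]: "integrable \<nu> (\<lambda>s. poly p s * poly q s)"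
  using integrable_poly[of "p * q"] by (simp add: poly_mult[abs_def])

lemma nu_ip_eq: "nu_ip \<nu> p q = (\<integral>s. poly (p * q) s \<partial>\<nu>)"
  by (simp add: nu_ip_def)

lemma nu_ip_commute: "nu_ip \<nu> p q = nu_ip \<nu> q p"
  by (simp add: nu_ip_def mult.commute)

lemma nu_ip_add_left: "nu_ip \<nu> (p + q) r = nu_ip \<nu> p r + nu_ip \<nu> q r"
  by (simp add: nu_ip_def distrib_right)

lemma nu_ip_diff_left: "nu_ip \<nu> (p - q) r = nu_ip \<nu> p r - nu_ip \<nu> q r"
  by (simp add: nu_ip_def left_diff_distrib)

lemma nu_ip_smult_left: "nu_ip \<nu> (smult c p) r = c * nu_ip \<nu> p r"
  by (simp add: nu_ip_def mult.assoc)

lemma nu_ip_add_right: "nu_ip \<nu> r (p + q) = nu_ip \<nu> r p + nu_ip \<nu> r q"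
  by (simp add: nu_ip_commute[of r] nu_ip_add_left)

lemma nu_ip_diff_right: "nu_ip \<nu> r (p - q) = nu_ip \<nu> r p - nu_ip \<nu> r q"
  by (simp add: nu_ip_commute[of r] nu_ip_diff_left)

lemma nu_ip_smult_right: "nu_ip \<nu> r (smult c p) = c * nu_ip \<nu> r p"
  by (simp add: nu_ip_commute[of r] nu_ip_smult_left)

lemma nu_ip_0 [simp]: "nu_ip \<nu> 0 r = 0" "nu_ip \<nu> r 0 = 0"
  by (simp_all add: nu_ip_def)

lemmas nu_ip_simps = nu_ip_add_left nu_ip_diff_left nu_ip_smult_left
  nu_ip_add_right nu_ip_diff_right nu_ip_smult_right

lemma nu_ip_mult_shift: "nu_ip \<nu> (r * p) q = nu_ip \<nu> p (r * q)"
  by (simp add: nu_ip_eq ac_simps)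

lemma nu_ip_nonneg: "nu_ip \<nu> p p \<ge> 0"
  by (simp add: nu_ip_def)

lemma nu_ip_zero_AE: "nu_ip \<nu> p p = 0 \<Longrightarrow> AE s in \<nu>. poly p s = 0"
  using integral_nonneg_eq_0_iff_AE[of \<nu> "\<lambda>s. poly p s * poly p s"] by (simp add: nu_ip_def)

lemma nu_ip_eq_0: 
  assumes "nu_ip \<nu> r r = 0" shows "nu_ip \<nu> q (r * d) = 0" unfolding nu_ip_def
  by (rule integral_eq_zero_AE) (use nu_ip_zero_AE[OF assms] in auto)

text \<open>Division with remainder by \<open>r\<close>: the multiple of \<open>r\<close> vanishes
  \<nu>-almost everywhere, and the remainder has degree below \<open>k\<close>, where
  \<open>q\<close> is orthogonal to everything.\<close>

lemma monic_orth_norm_zero: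
  assumes r: "r \<noteq> 0" "nu_ip \<nu> r r = 0" and q: "is_monic_orth \<nu> k q" "degree r \<le> k"
  shows "nu_ip \<nu> q q = 0"
proof -
  have "nu_ip \<nu> q (q mod r) = 0"
  \<comment> \<open>A zero remainder has degree 0, which is below \<open>k\<close> except when
    \<open>k = 0\<close>.\<close>
  proof (cases "q mod r = 0 \<and> k = 0")
    case False
    have "q mod r = 0 \<or> degree (q mod r) < k" using degree_mod_less[OF r(1), of q] q(2) by auto
    with False have "degree (q mod r) < k" by auto
    then show ?thesis using q(1) by (simp add: is_monic_orth_def)
  qed (simp add: nu_ip_def)
  moreover have "nu_ip \<nu> q q = nu_ip \<nu> q (r * (q div r)) + nu_ip \<nu> q (q mod r)"
    using nu_ip_add_right[of q "r * (q div r)" "q mod r"] by simp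
  ultimately show ?thesis using nu_ip_eq_0[OF r(2)] by simp
qed

text \<open>\<open>q - p\<close> is orthogonal to itself, so a nonzero difference would be a null
  polynomial of degree below \<open>k\<close> and would make \<open>p\<close> null too. In degrees
  above the number of support points monic null candidates are no longer unique, hence the
  positivity guard in \<open>opoly\<close>.\<close>

lemma monic_orth_unique:
  assumes "is_monic_orth \<nu> k p" "nu_ip \<nu> p p > 0" "is_monic_orth \<nu> k q"
  shows "q = p"
proof (rule ccontr)
  assume ne: "q \<noteq> p"
  have "coeff (q - p) k = 0" "degree (q - p) \<le> k"
    using assms by (auto simp: is_monic_orth_def intro!: degree_diff_le)
  with ne have lt: "degree (q - p) < k" by (metis eq_iff_diff_eq_0 leading_coeff_0_iff nat_less_le)
  then have "nu_ip \<nu> (q - p) (q - p) = 0"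
    using assms by (simp add: is_monic_orth_def nu_ip_diff_left)
  then show False using monic_orth_norm_zero[of "q - p" k p] ne lt assms by auto
qed

lemma opoly_eqI:
  assumes "is_monic_orth \<nu> k p" "nu_ip \<nu> p p > 0"
  shows "opl k = p"
proof -
  have "(THE q. is_monic_orth \<nu> k q) = p"
    using assms monic_orth_unique[OF assms] by (intro the_equality)
  then show ?thesis using assms by (auto simp: opoly_def)
qed

lemma opoly_cases:
  obtains "opl k = 0" | "is_monic_orth \<nu> k (opl k)" "nu_ip \<nu> (opl k) (opl k) > 0"
proof (cases "\<exists>q. is_monic_orth \<nu> k q \<and> nu_ip \<nu> q q > 0")
  case True
  then show ?thesis using that opoly_eqI by metis
next
  case False
  then have "opl k = 0" unfolding opoly_def by (simp only: if_False)
  then show ?thesis by (rule that(1))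
qed

lemma opoly_orth: 
  assumes "degree r < k" shows "nu_ip \<nu> (opl k) r = 0"
  using assms by (cases rule: opoly_cases[of k]) (auto simp: is_monic_orth_def nu_ip_def)

lemma degree_opoly_le: "degree (opl k) \<le> k"
  by (cases rule: opoly_cases[of k]) (auto simp: is_monic_orth_def)

lemma opoly_orthogonal: "k \<noteq> l \<Longrightarrow> nu_ip \<nu> (opl k) (opl l) = 0"
  using opoly_orth[of "opl l" k] opoly_orth[of "opl k" l] degree_opoly_le[of k] degree_opoly_le[of l]
  by (metis le_less_trans linorder_neqE_nat nu_ip_commute)

lemma opoly_0 [simp]: "opl 0 = 1"
  by (rule opoly_eqI) (auto simp: is_monic_orth_def nu_ip_def)

lemma opoly_integral: "(\<integral>s. poly (opl k) s \<partial>\<nu>) = (if k = 0 then 1 else 0)"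
  using opoly_orthogonal[of k 0] by (auto simp: nu_ip_def)

lemma ccoef_Suc: "ccoef \<nu> (Suc k) = nu_ip \<nu> (opl k) (opl k)"
  by (simp add: ccoef_def)

lemma ccoef_1 [simp]: "ccoef \<nu> (Suc 0) = 1"
  by (simp add: ccoef_Suc nu_ip_def)

lemma ccoef_nonneg: "ccoef \<nu> k \<ge> 0"
  by (simp add: ccoef_def nu_ip_nonneg)

text \<open>The candidate for \<open>p_{k+1}\<close> dictated by the three-term recurrence. The case
  \<open>k = 0\<close> is separate because \<open>acoef\<close> is 1 there and \<open>k - 1\<close>
  truncates to 0, whereas \<open>p_{-1}\<close> must be 0.\<close>

definition rec_poly :: "nat \<Rightarrow> real poly" where
  "rec_poly k = [:0, 1:] * opl k - smult (bcoef \<nu> k) (opl k)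
     - (if k = 0 then 0 else smult (acoef \<nu> k) (opl (k - 1)))"

text \<open>The value of \<open>bcoef\<close> gives orthogonality to \<open>p_k\<close>, that of
  \<open>acoef\<close> orthogonality to \<open>p_{k-1}\<close>, and symmetry of multiplication by
  \<open>X\<close> orthogonality to all degrees below \<open>k - 1\<close>. Any \<open>r\<close> of
  degree at most \<open>k\<close> reduces to these cases by subtracting its leading multiples of
  \<open>p_k\<close> and \<open>p_{k-1}\<close>.\<close>

lemma rec_poly_monic_orth:
  assumes pos: "\<And>j. j \<le> k \<Longrightarrow> nu_ip \<nu> (opl j) (opl j) > 0"
  shows "is_monic_orth \<nu> (Suc k) (rec_poly k)"
proof -
  let ?X = "[:0, 1:] :: real poly"
  let ?p = "opl"
  have mono: "is_monic_orth \<nu> j (?p j)" if "j \<le> k" for j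
    using pos[OF that] by (cases rule: opoly_cases[of j]) (auto simp: nu_ip_def)
  have deg: "degree (?p j) = j" and lead: "coeff (?p j) j = 1" if "j \<le> k" for j
    using mono[OF that] by (auto simp: is_monic_orth_def)
  have degX: "degree (?X * ?p j) = Suc j" if "j \<le> k" for j
    using deg[OF that] lead[OF that] by (subst degree_mult_eq) auto
  have coX: "coeff (?X * r) (Suc j) = coeff r j" for r j by simp
  define low where "low = smult (bcoef \<nu> k) (?p k) + (if k = 0 then 0 else smult (acoef \<nu> k) (?p (k - 1)))"
  have low: "degree low < Suc k" unfolding low_def
    by (intro le_imp_less_Suc degree_add_le order.trans[OF degree_smult_le])
       (auto intro!: order.trans[OF degree_smult_le] simp: deg)
  have rec: "rec_poly k = ?X * ?p k - low" by (simp add: rec_poly_def low_def)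
  have co: "coeff (rec_poly k) (Suc k) = 1" using coeff_eq_0[OF low] by (simp add: rec lead)
  have "degree (rec_poly k) \<le> Suc k"
    unfolding rec using low degX[of k] by (intro degree_diff_le) auto
  with co have dg: "degree (rec_poly k) = Suc k" by (simp add: le_antisym le_degree)
  have orth_k: "nu_ip \<nu> (rec_poly k) (?p k) = 0"
  proof -
    have "nu_ip \<nu> (?X * ?p k) (?p k) = bcoef \<nu> k * nu_ip \<nu> (?p k) (?p k)"
      using pos[of k] by (simp add: bcoef_def nu_ip_def power2_eq_square ac_simps)
    moreover have "nu_ip \<nu> low (?p k) = bcoef \<nu> k * nu_ip \<nu> (?p k) (?p k)"
      using opoly_orthogonal[of "k - 1" k] by (auto simp: low_def nu_ip_simps)
    ultimately show ?thesis by (simp add: rec nu_ip_simps)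
  qed
  \<comment> \<open>\<open>X p_{k-1} - p_k\<close> has degree below \<open>k\<close>, so moving
    \<open>X\<close> across the inner product turns the pairing of \<open>X p_k\<close> with
    \<open>p_{k-1}\<close> into the squared norm of \<open>p_k\<close>, the numerator of
    \<open>acoef\<close>.\<close>
  have orth_k1: "nu_ip \<nu> (rec_poly k) (?p (k - 1)) = 0" if "k > 0"
  proof -
    have "degree (?X * ?p (k - 1) - ?p k) \<le> k"
      using degX[of "k - 1"] deg[of k] that by (intro degree_diff_le) auto
    moreover have "coeff (?X * ?p (k - 1) - ?p k) k = 0"
      using coX[of "?p (k - 1)" "k - 1"] lead[of k] lead[of "k - 1"] that by simp
    ultimately have "degree (?X * ?p (k - 1) - ?p k) < k"
      using that by (metis degree_0 leading_coeff_0_iff nat_less_le)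
    then have "nu_ip \<nu> (?p k) (?X * ?p (k - 1) - ?p k) = 0" by (rule opoly_orth)
    then have "nu_ip \<nu> (?X * ?p k) (?p (k - 1)) = nu_ip \<nu> (?p k) (?p k)"
      using nu_ip_mult_shift[of ?X "?p k" "?p (k - 1)"] by (simp add: nu_ip_simps)
    moreover have "nu_ip \<nu> low (?p (k - 1)) = nu_ip \<nu> (?p k) (?p k)"
      using pos[of "k - 1"] opoly_orthogonal[of k "k - 1"] that
      by (simp add: low_def nu_ip_simps acoef_def)
    ultimately show ?thesis by (simp add: rec nu_ip_simps)
  qed
  have orth_low: "nu_ip \<nu> (rec_poly k) r = 0" if "degree r < k - 1" for r
  proof -
    have "degree (?X * r) < k"
      using that by (cases "r = 0") (auto simp: degree_mult_eq simp del: mult_pCons_left)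
    then have "nu_ip \<nu> (?X * ?p k) r = 0"
      by (simp add: nu_ip_mult_shift opoly_orth del: mult_pCons_left)
    moreover have "nu_ip \<nu> low r = 0" using that by (simp add: low_def nu_ip_simps opoly_orth)
    ultimately show ?thesis by (simp add: rec nu_ip_simps)
  qed
  \<comment> \<open>The alternative \<open>= 0\<close> is there for \<open>j = 0\<close>, where no
    polynomial has degree below \<open>j\<close>.\<close>
  have split: "degree (r - smult (coeff r j) (?p j)) < j \<or> r - smult (coeff r j) (?p j) = 0"
    if "degree r \<le> j" "j \<le> k" for r j
  proof -
    have "degree (r - smult (coeff r j) (?p j)) \<le> j"
      using that deg[of j] by (intro degree_diff_le order.trans[OF degree_smult_le]) auto
    moreover have "coeff (r - smult (coeff r j) (?p j)) j = 0" using lead[OF that(2)] by simp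
    ultimately show ?thesis by (metis leading_coeff_0_iff nat_less_le)
  qed
  have zero: "nu_ip \<nu> (rec_poly k) 0 = 0" by (simp add: nu_ip_def)
  have step1: "nu_ip \<nu> (rec_poly k) r = 0" if "degree r < k" for r
  proof -
    from that have k: "k > 0" and d: "degree r \<le> k - 1" by auto
    define r' where "r' = r - smult (coeff r (k - 1)) (?p (k - 1))"
    have "nu_ip \<nu> (rec_poly k) r' = 0"
      using split[OF d] orth_low zero unfolding r'_def by fastforce
    then show ?thesis using orth_k1[OF k] by (simp add: r'_def nu_ip_simps)
  qed
  have "nu_ip \<nu> (rec_poly k) r = 0" if d: "degree r < Suc k" for r
  proof -
    define r' where "r' = r - smult (coeff r k) (?p k)"
    have "nu_ip \<nu> (rec_poly k) r' = 0"
      using split[of r k] d step1 zero unfolding r'_def by fastforce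
    then show ?thesis using orth_k by (simp add: r'_def nu_ip_simps)
  qed
  with dg co show ?thesis by (simp add: is_monic_orth_def)
qed

lemma opoly_stop:
  assumes "r \<noteq> 0" "nu_ip \<nu> r r = 0" "degree r \<le> k"
  shows "opl k = 0" using monic_orth_norm_zero[OF assms(1,2) _ assms(3)]
  by (cases rule: opoly_cases[of k]) auto

text \<open>In the second case \<open>\<nu>\<close> is carried by the zeros of \<open>r\<close>, that is, by at most \<open>k\<close> points.\<close>

lemma opoly_pos_or_stop:
  "(\<forall>j\<le>k. nu_ip \<nu> (opl j) (opl j) > 0) \<or> (\<exists>r. r \<noteq> 0 \<and> nu_ip \<nu> r r =
      0 \<and> degree r \<le> k)"
proof (induction k)
  case 0
  then show ?case by (simp add: nu_ip_def)
next
  case (Suc k)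
  then show ?case
  proof
    assume pos: "\<forall>j\<le>k. nu_ip \<nu> (opl j) (opl j) > 0"
    then have m: "is_monic_orth \<nu> (Suc k) (rec_poly k)" by (intro rec_poly_monic_orth) auto
    show ?case
    proof (cases "nu_ip \<nu> (rec_poly k) (rec_poly k) = 0")
      case True
      then show ?thesis using m by (intro disjI2 exI[of _ "rec_poly k"]) (auto simp: is_monic_orth_def)
    next
      case False
      then have "nu_ip \<nu> (rec_poly k) (rec_poly k) > 0" using nu_ip_nonneg[of "rec_poly k"] by simp
      with opoly_eqI[OF m this] show ?thesis using pos by (auto simp: le_Suc_eq)
    qed
  qed (meson le_SucI)
qed

text \<open>Only almost everywhere: if \<nu> sits on \<open>k + 1\<close> points,
  \<open>rec_poly k\<close> is a nonzero polynomial vanishing on them, while \<open>p_{k+1}\<close>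
  is set to 0. Beyond that \<open>p_k\<close> and \<open>p_{k+1}\<close> are both 0, and
  \<open>acoef \<nu> k\<close> is 0 as well, which removes the term with
  \<open>p_{k-1}\<close>.\<close>

lemma opoly_recurrence:
  "AE s in \<nu>. s * poly (opl k) s = poly (opl (Suc k)) s + bcoef \<nu> k * poly (opl k) s
     + (if k = 0 then 0 else acoef \<nu> k * poly (opl (k - 1)) s)"
proof -
  have rec: "poly (rec_poly k) s = s * poly (opl k) s - bcoef \<nu> k * poly (opl k) s
     - (if k = 0 then 0 else acoef \<nu> k * poly (opl (k - 1)) s)" for s
    by (simp add: rec_poly_def)
  from opoly_pos_or_stop[of k] show ?thesis
  proof
    assume pos: "\<forall>j\<le>k. nu_ip \<nu> (opl j) (opl j) > 0"
    then have m: "is_monic_orth \<nu> (Suc k) (rec_poly k)" by (intro rec_poly_monic_orth) auto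
    have "AE s in \<nu>. poly (rec_poly k) s = poly (opl (Suc k)) s"
    proof (cases "nu_ip \<nu> (rec_poly k) (rec_poly k) = 0")
      case True
      have "opl (Suc k) = 0"
        using m True by (intro opoly_stop[of "rec_poly k"]) (auto simp: is_monic_orth_def)
      then show ?thesis using nu_ip_zero_AE[OF True] by simp
    next
      case False
      then have "nu_ip \<nu> (rec_poly k) (rec_poly k) > 0" using nu_ip_nonneg[of "rec_poly k"] by simp
      from opoly_eqI[OF m this] show ?thesis by simp
    qed
    then show ?thesis by eventually_elim (auto simp: rec)
  next
    assume "\<exists>r. r \<noteq> 0 \<and> nu_ip \<nu> r r = 0 \<and> degree r \<le> k"
    then have "opl k = 0" "opl (Suc k) = 0" using opoly_stop le_SucI by metis+
    then show ?thesis by (cases k) (auto simp: acoef_def nu_ip_def)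
  qed
qed

end

subsection \<open>Finite product measures\<close>

text \<open>Only the sigma-algebra of \<open>bprod\<close> is used; being polymorphic it serves for
  times and for time-mark pairs. Integration over times takes place in \<open>lprod\<close>.\<close>

abbreviation "bprod n \<equiv> PiM {..<n::nat} (\<lambda>_. borel)"
abbreviation "lprod n \<equiv> PiM {..<n::nat} (\<lambda>_. lborel :: real measure)"

lemma measurable_pcons [measurable (raw)]:
  assumes [measurable]: "f \<in> measurable N M" "g \<in> measurable N (PiM {..<n} (\<lambda>_. M))"
  shows "(\<lambda>x. pcons n (f x) (g x)) \<in> measurable N (PiM {..<Suc n} (\<lambda>_. M))"
  unfolding pcons_def
proof (rule measurable_PiM_single')
  fix i assume i: "i \<in> {..<Suc n}"
  show "(\<lambda>x. if i = 0 then f x else if i < Suc n then g x (i - 1) else undefined) \<in> measurable N M"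
  proof (cases i)
    case (Suc j)
    then have "(\<lambda>x. g x j) \<in> measurable N M" using i
      by (intro measurable_compose[OF assms(2)] measurable_component_singleton) auto
    then show ?thesis using Suc i by simp
  qed simp
next
  show "(\<lambda>x j. if j = 0 then f x else if j < Suc n then g x (j - 1) else undefined)
      \<in> space N \<rightarrow> {..<Suc n} \<rightarrow>\<^sub>E space M"
  proof (intro Pi_I PiE_I)
    fix x j assume x: "x \<in> space N" and j: "j \<in> {..<Suc n}"
    have "g x \<in> {..<n} \<rightarrow>\<^sub>E space M"
      using measurable_space[OF assms(2) x] by (simp add: space_PiM)
    then show "(if j = 0 then f x else if j < Suc n then g x (j - 1) else undefined) \<in> space M"
      using measurable_space[OF assms(1) x] j by (cases j) auto
  qed auto
qed

lemma measurable_ptail [measurable (raw)]: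
  assumes [measurable]: "g \<in> measurable N (PiM {..<Suc n} (\<lambda>_. M))"
  shows "(\<lambda>x. ptail n (g x)) \<in> measurable N (PiM {..<n} (\<lambda>_. M))"
  unfolding ptail_def
proof (rule measurable_PiM_single')
  fix i assume i: "i \<in> {..<n}"
  have "(\<lambda>x. g x (Suc i)) \<in> measurable N M" using i
    by (intro measurable_compose[OF assms] measurable_component_singleton) auto
  then show "(\<lambda>x. if i < n then g x (Suc i) else undefined) \<in> measurable N M" using i by simp
next
  show "(\<lambda>x j. if j < n then g x (Suc j) else undefined) \<in> space N \<rightarrow> {..<n} \<rightarrow>\<^sub>E space M"
  proof (intro Pi_I PiE_I)
    fix x j assume x: "x \<in> space N" and j: "j \<in> {..<n}"
    have "g x \<in> {..<Suc n} \<rightarrow>\<^sub>E space M"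
      using measurable_space[OF assms x] by (simp add: space_PiM)
    then show "(if j < n then g x (Suc j) else undefined) \<in> space M" using j by auto
  qed auto
qed

lemma pcons_0 [simp]: "pcons n p x 0 = p"
  by (simp add: pcons_def)

lemma pcons_Suc [simp]: "k < n \<Longrightarrow> pcons n p x (Suc k) = x k"
  by (simp add: pcons_def)

lemma ptail_pcons: "x \<in> extensional {..<n} \<Longrightarrow> ptail n (pcons n p x) = x"
  by (auto simp: ptail_def pcons_def extensional_def)

text \<open>The new coordinate goes to position 0 because every operator acts on the first
  coordinate of a point. It is enough to compare both sides on boxes.\<close>

lemma (in sigma_finite_measure) PiM_Suc_eq_distr:
  "PiM {..<Suc n} (\<lambda>_. M) =
    distr (M \<Otimes>\<^sub>M PiM {..<n} (\<lambda>_. M)) (PiM {..<Suc n} (\<lambda>_. M)) (\<lambda>z. pcons n (fst z) (snd z))"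
proof -
  interpret P: product_sigma_finite "\<lambda>_::nat. M" by standard
  interpret F: finite_product_sigma_finite "\<lambda>_::nat. M" "{..<n}" by standard simp
  show ?thesis
  proof (rule P.PiM_eqI[symmetric])
    fix A :: "nat \<Rightarrow> 'a set" assume A: "\<And>i. i \<in> {..<Suc n} \<Longrightarrow> A i \<in> sets M"
    have A': "A i \<subseteq> space M" if "i < Suc n" for i
      using A[of i] that sets.sets_into_space by blast
    have eq: "(\<lambda>z. pcons n (fst z) (snd z)) -` Pi\<^sub>E {..<Suc n} A \<inter> space (M \<Otimes>\<^sub>M PiM {..<n} (\<lambda>_. M))
        = A 0 \<times> Pi\<^sub>E {..<n} (\<lambda>i. A (Suc i))" (is "?L = ?R")
    proof (intro set_eqI iffI)
      fix z assume z: "z \<in> ?L"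
      obtain p x where zz: "z = (p, x)" by force
      have 1: "pcons n p x i \<in> A i" if "i < Suc n" for i using z that by (auto simp: zz PiE_iff)
      have "x i \<in> A (Suc i)" if "i < n" for i using 1[of "Suc i"] that by simp
      then show "z \<in> ?R"  using z 1[of 0] by (simp add: zz space_pair_measure space_PiM PiE_iff)
    next
      fix z assume z: "z \<in> ?R"
      obtain p x where zz: "z = (p, x)" by force
      have p: "p \<in> A 0" and x: "x \<in> extensional {..<n}" "\<And>i. i < n \<Longrightarrow> x i \<in> A (Suc i)"
        using z by (auto simp: zz PiE_def)
      have 1: "pcons n p x i \<in> A i" if "i < Suc n" for i using p x that by (cases i) auto
      have 2: "pcons n p x \<in> extensional {..<Suc n}" by (auto simp: pcons_def extensional_def)
      have 3: "x i \<in> space M" if "i < n" for i using x(2)[OF that] A'[of "Suc i"] that by auto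
      have 4: "p \<in> space M" using p A'[of 0] by auto
      show "z \<in> ?L" using 1 2 3 4 x by (simp add: zz space_pair_measure space_PiM PiE_iff)
    qed
    have "emeasure (PiM {..<n} (\<lambda>_. M)) (Pi\<^sub>E {..<n} (\<lambda>i. A (Suc i))) =
        (\<Prod>i<n. emeasure M (A (Suc i)))"
      by (rule F.measure_times) (use A in auto)
    then show "emeasure (distr (M \<Otimes>\<^sub>M PiM {..<n} (\<lambda>_. M)) (PiM {..<Suc n} (\<lambda>_. M)) (\<lambda>z. pcons n (fst z) (snd z)))
         (Pi\<^sub>E {..<Suc n} A) = (\<Prod>i<Suc n. emeasure M (A i))"
      using A by (subst emeasure_distr)
        (auto simp: eq F.emeasure_pair_measure_Times prod.lessThan_Suc_shift
          simp del: prod.lessThan_Suc intro!: sets_PiM_I_finite)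
  qed auto
qed

lemma (in sigma_finite_measure) nn_integral_PiM_Suc:
  assumes [measurable]: "f \<in> borel_measurable (PiM {..<Suc n} (\<lambda>_. M))"
  shows "(\<integral>\<^sup>+x. f x \<partial>PiM {..<Suc n} (\<lambda>_. M)) =
    (\<integral>\<^sup>+x. (\<integral>\<^sup>+p. f (pcons n p x) \<partial>M) \<partial>PiM {..<n} (\<lambda>_. M))"
proof -
  note distr_eq = PiM_Suc_eq_distr[of n]
  interpret P: product_sigma_finite "\<lambda>_::nat. M" by standard
  interpret F: finite_product_sigma_finite "\<lambda>_::nat. M" "{..<n}" by standard simp
  interpret pair_sigma_finite M "PiM {..<n} (\<lambda>_. M)" by standard
  have "(\<integral>\<^sup>+x. f x \<partial>PiM {..<Suc n} (\<lambda>_. M)) =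
      (\<integral>\<^sup>+z. f (pcons n (fst z) (snd z)) \<partial>(M \<Otimes>\<^sub>M PiM {..<n} (\<lambda>_. M)))"
  proof -
    have "(\<integral>\<^sup>+x. f x \<partial>PiM {..<Suc n} (\<lambda>_. M)) =
        (\<integral>\<^sup>+x. f x \<partial>distr (M \<Otimes>\<^sub>M PiM {..<n} (\<lambda>_. M))
        (PiM {..<Suc n} (\<lambda>_. M)) (\<lambda>z. pcons n (fst z) (snd z)))"
      by (rule arg_cong[where f = "\<lambda>N. integral\<^sup>N N f", OF distr_eq])
    then show ?thesis by (subst (asm) nn_integral_distr) auto
  qed
  also have "\<dots> = (\<integral>\<^sup>+x. (\<integral>\<^sup>+p. f (pcons n p x) \<partial>M) \<partial>PiM {..<n} (\<lambda>_. M))"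
    by (subst nn_integral_snd[symmetric]) auto
  finally show ?thesis .
qed

text \<open>Tonelli read backwards: a measurable set whose sections are almost all null is itself
  null.\<close>

lemma (in sigma_finite_measure) AE_PiM_Suc:
  assumes [measurable]: "Measurable.pred (PiM {..<Suc n} (\<lambda>_. M)) P"
  assumes "AE x in PiM {..<n} (\<lambda>_. M). AE p in M. P (pcons n p x)"
  shows "AE x in PiM {..<Suc n} (\<lambda>_. M). P x"
proof -
  let ?N = "PiM {..<Suc n} (\<lambda>_. M)"
  define Z where "Z = {x \<in> space ?N. \<not> P x}"
  have [measurable]: "Z \<in> sets ?N" unfolding Z_def by measurable
  have "emeasure ?N Z = (\<integral>\<^sup>+x. (\<integral>\<^sup>+p. indicator Z (pcons n p x) \<partial>M) \<partial>PiM {..<n} (\<lambda>_. M))"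
    by (subst nn_integral_PiM_Suc[symmetric]) (auto simp: nn_integral_indicator)
  also have "\<dots> = (\<integral>\<^sup>+x. 0 \<partial>PiM {..<n} (\<lambda>_. M))"
  proof (rule nn_integral_cong_AE)
    show "AE x in PiM {..<n} (\<lambda>_. M). (\<integral>\<^sup>+p. indicator Z (pcons n p x) \<partial>M) = 0"
      using assms(2)
    proof eventually_elim
      fix x assume "AE p in M. P (pcons n p x)"
      then have "AE p in M. indicator Z (pcons n p x) = (0 :: ennreal)"
        by eventually_elim (auto simp: Z_def)
      then have "(\<integral>\<^sup>+p. indicator Z (pcons n p x) \<partial>M) = (\<integral>\<^sup>+p. 0 \<partial>M)"
        by (rule nn_integral_cong_AE)
      then show "(\<integral>\<^sup>+p. indicator Z (pcons n p x) \<partial>M) = 0" by simp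
    qed
  qed
  finally have "Z \<in> null_sets ?N" by (auto simp: null_sets_def)
  then show ?thesis by (rule AE_I') (auto simp: Z_def)
qed

lemma (in sigma_finite_measure) AE_PiM_all:
  fixes n :: nat
  assumes "AE p in M. P p"
  shows "AE x in PiM {..<n} (\<lambda>_. M). \<forall>k<n. P (x k)"
proof -
  \<comment> \<open>\<open>P\<close> may be non-measurable, so a measurable null set containing its
    exceptions takes its place in the induction.\<close>
  from AE_E[OF assms] obtain N where N: "{p \<in> space M. \<not> P p} \<subseteq> N" "emeasure M N = 0" "N \<in> sets M" .
  note N(3) [measurable]
  have ae: "AE p in M. p \<notin> N" using N by (intro AE_I[of _ _ N]) auto
  have "AE x in PiM {..<n} (\<lambda>_. M). \<forall>k<n. x k \<notin> N"
  proof (induction n)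
    case (Suc n)
    have "AE x in PiM {..<n} (\<lambda>_. M). AE p in M. \<forall>k<Suc n. pcons n p x k \<notin> N"
      using Suc
    proof eventually_elim
      case (elim x)
      show ?case using ae by eventually_elim (use elim in \<open>auto simp: pcons_def\<close>)
    qed
    moreover have "Measurable.pred (PiM {..<Suc n} (\<lambda>_. M)) (\<lambda>x. \<forall>k\<in>{..<Suc n}. x k \<notin> N)"
      by measurable
    then have "Measurable.pred (PiM {..<Suc n} (\<lambda>_. M)) (\<lambda>x. \<forall>k<Suc n. x k \<notin> N)"
      by (simp only: Ball_def lessThan_iff)
    ultimately show ?case by (rule AE_PiM_Suc[rotated])
  qed simp
  moreover have "AE x in PiM {..<n} (\<lambda>_. M). x \<in> space (PiM {..<n} (\<lambda>_. M))" by (rule AE_space)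
  ultimately show ?thesis
    by eventually_elim (use N(1) in \<open>auto simp: space_PiM PiE_def Pi_def\<close>)
qed

text \<open>A new coordinate almost surely avoids the finitely many earlier ones. Consequently weak
  and strict ordering of times agree up to null sets.\<close>

lemma AE_lborel_distinct:
  fixes n :: nat
  shows "AE t in lprod n. \<forall>i<n. \<forall>j<n. t i = t j \<longrightarrow> i = j"
proof (induction n)
  case (Suc n)
  have "AE x in lprod n. AE p in lborel.
      \<forall>i<Suc n. \<forall>j<Suc n. pcons n p x i = pcons n p x j \<longrightarrow> i = j"
    using Suc
  proof eventually_elim
    case (elim x)
    have "finite (x ` {..<n})" by simp
    then have "AE p in lborel. p \<notin> x ` {..<n}"
      by (intro AE_not_in finite_imp_null_set_lborel)
    then show ?case
    proof eventually_elim
      fix p assume p: "p \<notin> x ` {..<n}"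
      show "\<forall>i<Suc n. \<forall>j<Suc n. pcons n p x i = pcons n p x j \<longrightarrow> i = j"
        using p elim by (auto simp: less_Suc_eq_0_disj)
    qed
  qed
  moreover have "Measurable.pred (lprod (Suc n))
     (\<lambda>t. \<forall>i\<in>{..<Suc n}. \<forall>j\<in>{..<Suc n}. t i = t j \<longrightarrow> i = j)"
  proof (intro pred_intros_finite finite_lessThan)
    fix i j assume "i \<in> {..<Suc n}" "j \<in> {..<Suc n}"
    then have [measurable]: "(\<lambda>t. t i) \<in> borel_measurable (lprod (Suc n))"
      "(\<lambda>t. t j) \<in> borel_measurable (lprod (Suc n))"
      by (auto intro!: measurable_component_singleton simp flip: measurable_lborel1)
    show "Measurable.pred (lprod (Suc n)) (\<lambda>t. t i = t j \<longrightarrow> i = j)"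
      by (cases "i = j") (auto simp: pred_def intro!: borel_measurable_neq)
  qed
  then have "Measurable.pred (lprod (Suc n))
     (\<lambda>t. \<forall>i<Suc n. \<forall>j<Suc n. t i = t j \<longrightarrow> i = j)"
    by (simp only: Ball_def lessThan_iff)
  ultimately show ?case by (rule lborel.AE_PiM_Suc[rotated])
qed simp

section \<open>Separating times and marks in the measure on \<open>S_n\<close>\<close>

definition time_coords :: "nat \<Rightarrow> (nat \<Rightarrow> real \<times> real) \<Rightarrow> nat \<Rightarrow> real" where
  "time_coords n x = (\<lambda>k\<in>{..<n}. fst (x k))"

definition zip_coords :: "nat \<Rightarrow> (nat \<Rightarrow> real) \<Rightarrow> (nat \<Rightarrow> real) \<Rightarrow> nat \<Rightarrow> real \<times> real" where
  "zip_coords n t s = (\<lambda>k\<in>{..<n}. (t k, s k))"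

lemma zip_coords_pcons: "zip_coords (Suc n) (pcons n u t) (pcons n v s) = pcons n (u, v) (zip_coords n t s)"
  by (auto simp: zip_coords_def pcons_def fun_eq_iff)

lemma time_coords_zip_coords: "t \<in> extensional {..<n} \<Longrightarrow> time_coords n (zip_coords n t s) = t"
  by (auto simp: zip_coords_def time_coords_def fun_eq_iff extensional_def)

lemma measurable_zip_coords [measurable (raw)]:
  assumes [measurable]: "f \<in> measurable N (bprod n)" "g \<in> measurable N (bprod n)"
  shows "(\<lambda>x. zip_coords n (f x) (g x)) \<in> measurable N (bprod n)"
  unfolding zip_coords_def borel_prod[symmetric]
  by (intro measurable_restrict measurable_Pair measurable_compose[OF assms(1)] measurable_compose[OF assms(2)]
    measurable_component_singleton) auto

lemma measurable_time_coords [measurable]: "time_coords n \<in> measurable (bprod n) (bprod n)"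
proof -
  have fst: "fst \<in> measurable (borel :: (real \<times> real) measure) borel"
    by (simp add: borel_prod[symmetric])
  show ?thesis
    unfolding time_coords_def by (intro measurable_restrict measurable_compose[OF _ fst]) auto
qed

context compact_prob
begin

abbreviation "Fock \<equiv> fock_space \<nu>"
abbreviation "EFock \<equiv> efock_space \<nu>"
abbreviation "norm2 \<equiv> fock_norm2 \<nu>"
abbreviation "enorm2 \<equiv> efock_norm2 \<nu>"
abbreviation "Pcl n \<equiv> fock_closure \<nu> (Pn_vec \<nu> n)"
abbreviation "Sm \<equiv> Sn_meas \<nu>"
abbreviation "nuprod n \<equiv> PiM {..<n::nat} (\<lambda>_. \<nu>)"

text \<open>\<open>M1\<close> lives on the half-plane of nonnegative times. Integrands are kept
  Borel on the whole plane and pulled back along this identity map.\<close>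

lemma measurable_M1_id: "(\<lambda>p. p) \<in> measurable (M1 \<nu>) borel"
proof -
  have "(\<lambda>p. (fst p, snd p)) \<in> measurable (M1 \<nu>) (borel \<Otimes>\<^sub>M borel)"
    unfolding M1_def
    by (intro measurable_Pair measurable_compose[OF measurable_fst] measurable_compose[OF measurable_snd])
       (auto intro!: measurable_restrict_space1 simp: measurable_cong_sets[OF sets_nu refl])
  then show ?thesis by (simp add: borel_prod)
qed

lemma measurable_fst_M1 [measurable]: "fst \<in> measurable (M1 \<nu>) borel"
  and measurable_snd_M1 [measurable]: "snd \<in> measurable (M1 \<nu>) borel"
  using measurable_compose[OF measurable_M1_id, of fst borel] measurable_compose[OF measurable_M1_id, of snd borel]
  by (simp_all add: borel_prod[symmetric])

lemma measurable_Sn_id: "(\<lambda>x. x) \<in> measurable (Sm n) (bprod n)"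
  unfolding Sn_meas_def
proof (rule measurable_PiM_single')
  fix i assume "i \<in> {..<n}"
  then have "(\<lambda>x. x i) \<in> measurable (PiM {..<n} (\<lambda>_. M1 \<nu>)) (M1 \<nu>)" by simp
  from measurable_compose[OF this measurable_M1_id]
  show "(\<lambda>x. x i) \<in> measurable (PiM {..<n} (\<lambda>_. M1 \<nu>)) borel" .
qed (auto simp: space_PiM PiE_def)

lemma measurable_Sn_borel: 
  assumes "f \<in> measurable (bprod n) N"
  shows "f \<in> measurable (Sm n) N" using measurable_compose[OF measurable_Sn_id assms] by simp

lemma sigma_finite_M1: "sigma_finite_measure (M1 \<nu>)"
proof -
  interpret A: sigma_finite_measure "restrict_space lborel {0::real..}"
    by (rule sigma_finite_measure_restrict_space[OF lborel.sigma_finite_measure_axioms]) auto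
  interpret pair_sigma_finite "restrict_space lborel {0::real..}" \<nu> ..
  show ?thesis unfolding M1_def by (rule sigma_finite_measure_axioms)
qed

sublocale M1: sigma_finite_measure "M1 \<nu>" by (rule sigma_finite_M1)

sublocale Sn: sigma_finite_measure "Sm n" for n
proof -
  interpret P: product_sigma_finite "\<lambda>_::nat. M1 \<nu>" by standard
  show "sigma_finite_measure (Sm n)" unfolding Sn_meas_def by (rule P.sigma_finite) simp
qed

sublocale PN: finite_product_prob_space "\<lambda>_. \<nu>" "{..<n}" for n :: nat by standard simp

lemma space_M1: "space (M1 \<nu>) = {0..} \<times> UNIV"
  by (simp add: M1_def space_pair_measure space_restrict_space)

lemma space_Sn: "space (Sm n) = {..<n} \<rightarrow>\<^sub>E ({0..} \<times> UNIV)"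
  by (simp add: Sn_meas_def space_PiM space_M1)

lemma nn_integral_M1:
  assumes [measurable]: "f \<in> borel_measurable borel"
  shows "(\<integral>\<^sup>+p. f p \<partial>M1 \<nu>) =
      (\<integral>\<^sup>+u. (\<integral>\<^sup>+v. indicator {0..} u * f (u, v) \<partial>\<nu>) \<partial>lborel)"
proof -
  have [measurable]: "f \<in> borel_measurable (M1 \<nu>)"
    using measurable_compose[OF measurable_M1_id assms] .
  have [measurable]: "f \<in> borel_measurable (borel \<Otimes>\<^sub>M borel)" by (simp add: borel_prod)
  have "(\<integral>\<^sup>+p. f p \<partial>M1 \<nu>) =
      (\<integral>\<^sup>+u. (\<integral>\<^sup>+v. f (u, v) \<partial>\<nu>) \<partial>restrict_space lborel {0..})"
    using \<open>f \<in> borel_measurable (M1 \<nu>)\<close> unfolding M1_def by (subst nn_integral_fst) auto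
  also have "\<dots> = (\<integral>\<^sup>+u. (\<integral>\<^sup>+v. f (u, v) \<partial>\<nu>) *
      indicator {0..} u \<partial>lborel)"
    by (subst nn_integral_restrict_space) auto
  also have "\<dots> = (\<integral>\<^sup>+u. (\<integral>\<^sup>+v. indicator {0..} u *
      f (u, v) \<partial>\<nu>) \<partial>lborel)"
    by (intro nn_integral_cong) (auto simp: indicator_def)
  finally show ?thesis .
qed

text \<open>\<open>lprod\<close> covers negative times too; this set restores the half-line that is
  built into \<open>M1\<close>.\<close>

definition nonneg_upto :: "nat \<Rightarrow> (nat \<Rightarrow> real) set" where
  "nonneg_upto n = {t. \<forall>k<n. 0 \<le> t k}"

lemma nonneg_upto_measurable [measurable]: "Measurable.pred (bprod n) (\<lambda>t. t \<in> nonneg_upto n)"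
proof -
  have "Measurable.pred (bprod n) (\<lambda>t. \<forall>k\<in>{..<n}. 0 \<le> (t k :: real))"
    by measurable
  then show ?thesis by (simp add: nonneg_upto_def Ball_def)
qed

lemma nonneg_upto_indicator: "(\<lambda>t. indicator (nonneg_upto n) t :: ennreal) \<in> borel_measurable (bprod n)"
  unfolding indicator_def by measurable

text \<open>Integrating the marks for fixed times is what lets orthogonality in
  \<open>L^2(\<nu>)\<close> act, with all time-dependent factors as constants.\<close>

lemma nn_integral_Sn:
  assumes "f \<in> borel_measurable (bprod n)"
  shows "(\<integral>\<^sup>+x. f x \<partial>Sm n) =
    (\<integral>\<^sup>+t. (\<integral>\<^sup>+s. indicator (nonneg_upto n) t *
        f (zip_coords n t s) \<partial>nuprod n) \<partial>lprod n)"
  using assms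
proof (induction n arbitrary: f)
  case 0
  have "zip_coords 0 (\<lambda>_. undefined) (\<lambda>_. undefined) = (\<lambda>_. undefined)" by (auto simp: zip_coords_def)
  then show ?case
    by (simp add: Sn_meas_def PiM_empty nn_integral_count_space_finite nonneg_upto_def)
next
  case (Suc n)
  interpret Q: pair_sigma_finite "lborel :: real measure" "nuprod n" ..
  have fm: "(\<lambda>x. f (pcons n (a x, b x) (w x))) \<in> borel_measurable N"
    if "a \<in> borel_measurable N" "b \<in> borel_measurable N" "w \<in> measurable N (bprod n)"
    for N :: "'z measure" and a b w
    by (rule measurable_compose[OF measurable_pcons[OF _ that(3)] Suc.prems])
       (use that in \<open>simp add: borel_prod[symmetric]\<close>)
  have fm1: "(\<lambda>p. f (pcons n p x)) \<in> borel_measurable borel"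
    if "x \<in> space (bprod n)" for x
    by (rule measurable_compose[OF measurable_pcons Suc.prems]) (use that in auto)
  define g where "g x = (\<integral>\<^sup>+u. (\<integral>\<^sup>+v. indicator {0..} u *
      f (pcons n (u, v) x) \<partial>\<nu>) \<partial>lborel)" for x
  have g_meas: "g \<in> borel_measurable (bprod n)" unfolding g_def
  proof (rule lborel.borel_measurable_nn_integral)
    have [measurable]: "(\<lambda>z. f (pcons n (snd (fst z), snd z) (fst (fst z)))) \<in> borel_measurable
       ((bprod n \<Otimes>\<^sub>M lborel) \<Otimes>\<^sub>M \<nu>)" by (rule fm) measurable
    have "(\<lambda>(x, y). indicator {0..} (snd x) * f (pcons n (snd x, y) (fst x))) \<in>
        borel_measurable ((bprod n \<Otimes>\<^sub>M lborel) \<Otimes>\<^sub>M \<nu>)"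
      unfolding split_beta' by measurable
    from borel_measurable_nn_integral[OF this]
    show "(\<lambda>(x, u). \<integral>\<^sup>+v. indicator {0..} u * f (pcons n (u, v) x) \<partial>\<nu>) \<in>
        borel_measurable (bprod n \<Otimes>\<^sub>M lborel)" by (simp add: split_beta')
  qed
  define k where "k t s = indicator (nonneg_upto (Suc n)) t * f (zip_coords (Suc n) t s)" for t s
  have k_meas: "(\<lambda>x. k (a x) (b x)) \<in> borel_measurable N"
    if "a \<in> measurable N (bprod (Suc n))" "b \<in> measurable N (bprod (Suc n))"
    for N :: "'z measure" and a b unfolding k_def
    by (rule borel_measurable_times_ennreal[OF measurable_compose[OF that(1) nonneg_upto_indicator]
        measurable_compose[OF measurable_zip_coords[OF that] Suc.prems]])
  have kp: "k (pcons n u t) (pcons n v s) =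
      indicator (nonneg_upto n) t * (indicator {0..} u * f (pcons n (u, v) (zip_coords n t s)))" for u t v s
    unfolding k_def zip_coords_pcons
    by (auto simp: nonneg_upto_def indicator_def less_Suc_eq_0_disj split: if_splits)
  have pc: "(\<lambda>x. pcons n (a x) (b x)) \<in> measurable N (bprod (Suc n))"
    if "a \<in> borel_measurable N" "b \<in> measurable N (bprod n)"
    for N :: "'z measure" and a :: "'z \<Rightarrow> real" and b by (rule measurable_pcons[OF that])
  have "(\<integral>\<^sup>+x. f x \<partial>Sm (Suc n)) =
      (\<integral>\<^sup>+x. (\<integral>\<^sup>+p. f (pcons n p x) \<partial>M1 \<nu>) \<partial>Sm n)"
    using measurable_Sn_borel[OF Suc.prems] unfolding Sn_meas_def by (rule M1.nn_integral_PiM_Suc)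
  also have "\<dots> = (\<integral>\<^sup>+x. g x \<partial>Sm n)"
  proof (rule nn_integral_cong)
    fix x assume "x \<in> space (Sm n)"
    then have x: "x \<in> space (bprod n)" using measurable_space[OF measurable_Sn_id] by blast
    show "(\<integral>\<^sup>+p. f (pcons n p x) \<partial>M1 \<nu>) = g x"
      unfolding g_def by (rule nn_integral_M1[OF fm1[OF x]])
  qed
  also have "\<dots> = (\<integral>\<^sup>+t. (\<integral>\<^sup>+s. indicator (nonneg_upto n) t *
      g (zip_coords n t s) \<partial>nuprod n) \<partial>lprod n)"
    by (rule Suc.IH[OF g_meas])
  also have "\<dots> = (\<integral>\<^sup>+t. (\<integral>\<^sup>+s. (\<integral>\<^sup>+u. (\<integral>\<^sup>+v. k (pcons n u t) (pcons n v s) \<partial>\<nu>) \<partial>lborel) \<partial>nuprod n) \<partial>lprod n)"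
    unfolding g_def kp by (intro nn_integral_cong) (simp add: indicator_def)
  \<comment> \<open>The new time has to move outside the old marks, so that times regroup as a point
    of \<open>lprod (Suc n)\<close> and marks as a point of \<open>nuprod (Suc n)\<close>.\<close>
  also have "\<dots> = (\<integral>\<^sup>+t. (\<integral>\<^sup>+u. (\<integral>\<^sup>+s. (\<integral>\<^sup>+v. k (pcons n u t) (pcons n v s) \<partial>\<nu>) \<partial>nuprod n) \<partial>lborel) \<partial>lprod n)"
  proof (intro nn_integral_cong)
    fix t :: "nat \<Rightarrow> real" assume "t \<in> space (lprod n)"
    then have t: "t \<in> space (bprod n)" by (simp add: space_PiM)
    have s: "(\<lambda>z. snd (fst z)) \<in> measurable ((lborel \<Otimes>\<^sub>M nuprod n) \<Otimes>\<^sub>M \<nu>) (bprod n)"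
      by measurable
    have "(\<lambda>z. k (pcons n (fst (fst z)) t) (pcons n (snd z) (snd (fst z)))) \<in>
        borel_measurable ((lborel \<Otimes>\<^sub>M nuprod n) \<Otimes>\<^sub>M \<nu>)"
      by (intro k_meas pc s) (use t in measurable)
    then have "(\<lambda>(x, v). k (pcons n (fst x) t) (pcons n v (snd x))) \<in>
        borel_measurable ((lborel \<Otimes>\<^sub>M nuprod n) \<Otimes>\<^sub>M \<nu>)"
      by (simp add: split_beta')
    then have "(\<lambda>x. \<integral>\<^sup>+v. k (pcons n (fst x) t) (pcons n v (snd x)) \<partial>\<nu>) \<in>
        borel_measurable (lborel \<Otimes>\<^sub>M nuprod n)" by (rule borel_measurable_nn_integral)
    then show "(\<integral>\<^sup>+s. (\<integral>\<^sup>+u. (\<integral>\<^sup>+v. k (pcons n u t) (pcons n v s) \<partial>\<nu>) \<partial>lborel) \<partial>nuprod n) =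
      (\<integral>\<^sup>+u. (\<integral>\<^sup>+s. (\<integral>\<^sup>+v. k (pcons n u t) (pcons n v s) \<partial>\<nu>) \<partial>nuprod n) \<partial>lborel)"
      by (intro Q.Fubini') (simp add: split_beta')
  qed
  also have "\<dots> = (\<integral>\<^sup>+t. (\<integral>\<^sup>+u. (\<integral>\<^sup>+s. k (pcons n u t) s \<partial>nuprod (Suc n)) \<partial>lborel) \<partial>lprod n)"
  proof (intro nn_integral_cong nn_integral_PiM_Suc[symmetric])
    fix t :: "nat \<Rightarrow> real" and u :: real assume "t \<in> space (lprod n)"
    then have t: "t \<in> space (bprod n)" by (simp add: space_PiM)
    have "(\<lambda>s. s) \<in> measurable (nuprod (Suc n)) (bprod (Suc n))" by measurable
    then show "k (pcons n u t) \<in> borel_measurable (nuprod (Suc n))"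
      by (intro k_meas pc) (use t in auto)
  qed
  also have "\<dots> = (\<integral>\<^sup>+t. (\<integral>\<^sup>+s. k t s \<partial>nuprod (Suc n)) \<partial>lprod (Suc n))"
  proof (rule lborel.nn_integral_PiM_Suc[symmetric])
    have "(\<lambda>z. k (fst z) (snd z)) \<in> borel_measurable (lprod (Suc n) \<Otimes>\<^sub>M nuprod (Suc n))"
      by (intro k_meas) measurable
    then show "(\<lambda>t. \<integral>\<^sup>+s. k t s \<partial>nuprod (Suc n)) \<in> borel_measurable (lprod (Suc n))"
      by (intro PN.borel_measurable_nn_integral) (simp add: split_beta')
  qed
  finally show ?case unfolding k_def .
qed

text \<open>Marks having total mass one, the times under \<open>Sm n\<close> are governed by
  Lebesgue measure on the positive orthant, so Lebesgue-null sets of times stay null.\<close>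

lemma AE_Sn_time_coords:
  assumes "AE t in lprod n. P t"
  shows "AE x in Sm n. P (time_coords n x)"
proof -
  let ?L = "lprod n"
  from AE_E[OF assms] obtain N where N: "{t \<in> space ?L. \<not> P t} \<subseteq> N" "emeasure ?L N = 0" "N \<in> sets ?L" .
  have seq: "sets ?L = sets (bprod n)" by (rule sets_PiM_cong) simp_all
  have Nm: "N \<in> sets (bprod n)" using N(3) seq by simp
  have ae: "AE t in ?L. t \<notin> N" by (rule AE_not_in) (use N in \<open>simp add: null_sets_def\<close>)
  have meas [measurable]: "(\<lambda>x. indicator N (time_coords n x)) \<in> borel_measurable (bprod n)"
    by (rule measurable_compose[OF measurable_time_coords borel_measurable_indicator[OF Nm]])
  have "(\<integral>\<^sup>+x. indicator N (time_coords n x) \<partial>Sm n) =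
    (\<integral>\<^sup>+t. (\<integral>\<^sup>+s. indicator (nonneg_upto n) t *
        indicator N (time_coords n (zip_coords n t s)) \<partial>nuprod n) \<partial>?L)"
    by (rule nn_integral_Sn[OF meas])
  also have "\<dots> = (\<integral>\<^sup>+t. 0 \<partial>?L)"
  proof (rule nn_integral_cong_AE)
    show "AE t in ?L. (\<integral>\<^sup>+s. indicator (nonneg_upto n) t *
        indicator N (time_coords n (zip_coords n t s)) \<partial>nuprod n) = 0"
      using ae AE_space[of ?L]
    proof eventually_elim
      case (elim t)
      then have "t \<in> extensional {..<n}" by (simp add: space_PiM PiE_def)
      with elim show ?case by (simp add: time_coords_zip_coords)
    qed
  qed
  finally have "AE x in Sm n. indicator N (time_coords n x) = (0::ennreal)"
    using nn_integral_0_iff_AE[OF measurable_Sn_borel[OF meas]] by simp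
  then show ?thesis
  proof eventually_elim
    case (elim x)
    show ?case
    proof (rule ccontr)
      assume "\<not> P (time_coords n x)"
      then have "time_coords n x \<in> {t \<in> space ?L. \<not> P t}" by (simp add: time_coords_def space_PiM)
      from subsetD[OF N(1) this] elim show False by simp
    qed
  qed
qed

lemma AE_M1_snd:
  assumes "AE s in \<nu>. P s" shows "AE p in M1 \<nu>. P (snd p)"
proof -
  from AE_E[OF assms] obtain N where N: "{s \<in> space \<nu>. \<not> P s} \<subseteq> N" "emeasure \<nu> N =
      0" "N \<in> sets \<nu>" .
  have [measurable]: "N \<in> sets borel" using N(3) by (simp add: sets_nu)
  have [measurable]: "snd \<in> measurable (borel :: (real \<times> real) measure) borel" by (simp add: borel_prod[symmetric])
  have "(\<integral>\<^sup>+p. indicator N (snd p) \<partial>M1 \<nu>) =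
      (\<integral>\<^sup>+u. (\<integral>\<^sup>+v. indicator {0..} (u :: real) *
          indicator N v \<partial>\<nu>) \<partial>lborel)"
    by (subst nn_integral_M1) (auto intro: borel_measurable_indicator)
  also have "\<dots> = 0" using N by (simp add: nn_integral_cmult nn_integral_indicator)
  finally have "AE p in M1 \<nu>. indicator N (snd p) = (0::ennreal)"
    by (subst (asm) nn_integral_0_iff_AE) auto
  then show ?thesis by eventually_elim (use N(1) in \<open>auto simp: indicator_def split: if_splits\<close>)
qed

lemma AE_Sn_snd: "AE s in \<nu>. P s \<Longrightarrow> AE x in Sm n. \<forall>k<n. P (snd (x k))"
  unfolding Sn_meas_def by (rule M1.AE_PiM_all[OF AE_M1_snd])

end

subsection \<open>Boundedness of the noise operators\<close>

text \<open>The source of all factors 2 and of the coefficients \<open>2 * a\<^sup>2\<close>,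
  \<open>2 * b\<^sup>2\<close> in the norm estimates.\<close>

lemma sq_lin_bound: "(a * x + b * y)\<^sup>2 \<le> 2 * a\<^sup>2 * x\<^sup>2 + 2 * b\<^sup>2 * (y::real)\<^sup>2"
proof -
  have "0 \<le> (a * x - b * y)\<^sup>2" by simp
  then show ?thesis by (simp add: power2_sum power2_diff power_mult_distrib)
qed

lemma nn_integral_sq_lin:
  fixes f g :: "'a \<Rightarrow> real"
  assumes [measurable]: "w \<in> borel_measurable M" "f \<in> borel_measurable M" "g \<in> borel_measurable M"
  shows "(\<integral>\<^sup>+x. w x * ennreal ((a * f x + b * g x)\<^sup>2) \<partial>M) \<le>
    ennreal (2 * a\<^sup>2) * (\<integral>\<^sup>+x. w x * ennreal ((f x)\<^sup>2) \<partial>M) +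
        ennreal (2 * b\<^sup>2) * (\<integral>\<^sup>+x. w x * ennreal ((g x)\<^sup>2) \<partial>M)"
proof -
  have "(\<integral>\<^sup>+x. w x * ennreal ((a * f x + b * g x)\<^sup>2) \<partial>M) \<le>
     (\<integral>\<^sup>+x. ennreal (2 * a\<^sup>2) * (w x * ennreal ((f x)\<^sup>2)) +
         ennreal (2 * b\<^sup>2) * (w x * ennreal ((g x)\<^sup>2)) \<partial>M)"
  proof (rule nn_integral_mono)
    fix x
    have "ennreal ((a * f x + b * g x)\<^sup>2) \<le>
        ennreal (2 * a\<^sup>2) * ennreal ((f x)\<^sup>2) + ennreal (2 * b\<^sup>2) * ennreal ((g x)\<^sup>2)"
      by (simp add: ennreal_mult[symmetric] ennreal_plus[symmetric] sq_lin_bound del: ennreal_plus)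
    from mult_left_mono[OF this, of "w x"]
    show "w x * ennreal ((a * f x + b * g x)\<^sup>2) \<le>
      ennreal (2 * a\<^sup>2) * (w x * ennreal ((f x)\<^sup>2)) + ennreal (2 * b\<^sup>2) * (w x * ennreal ((g x)\<^sup>2))"
      by (simp add: distrib_left mult.left_commute)
  qed
  also have "\<dots> = ennreal (2 * a\<^sup>2) * (\<integral>\<^sup>+x. w x * ennreal ((f x)\<^sup>2) \<partial>M) +
      ennreal (2 * b\<^sup>2) * (\<integral>\<^sup>+x. w x * ennreal ((g x)\<^sup>2) \<partial>M)"
    by (simp add: nn_integral_add nn_integral_cmult)
  finally show ?thesis .
qed

text \<open>The first claim also covers non-integrable products, whose Bochner integral is 0 by
  convention; the second then supplies integrability from finite norms.\<close>

lemma integral_Cauchy_Schwarz: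
  fixes f g :: "'a \<Rightarrow> real"
  assumes [measurable]: "f \<in> borel_measurable M" "g \<in> borel_measurable M"
  shows "ennreal ((\<integral>x. f x * g x \<partial>M)\<^sup>2) \<le>
      (\<integral>\<^sup>+x. ennreal ((f x)\<^sup>2) \<partial>M) * (\<integral>\<^sup>+x. ennreal ((g x)\<^sup>2) \<partial>M)"
    and "(\<integral>\<^sup>+x. ennreal ((f x)\<^sup>2) \<partial>M) < \<infinity> \<Longrightarrow>
        (\<integral>\<^sup>+x. ennreal ((g x)\<^sup>2) \<partial>M) < \<infinity> \<Longrightarrow>
            integrable M (\<lambda>x. f x * g x)"
proof -
  let ?I = "\<integral>\<^sup>+x. ennreal \<bar>f x\<bar> * ennreal \<bar>g x\<bar> \<partial>M"
  have cs: "?I\<^sup>2 \<le> (\<integral>\<^sup>+x. ennreal ((f x)\<^sup>2) \<partial>M) *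
      (\<integral>\<^sup>+x. ennreal ((g x)\<^sup>2) \<partial>M)"
    using Cauchy_Schwarz_nn_integral[of "\<lambda>x. ennreal \<bar>f x\<bar>" M "\<lambda>x. ennreal \<bar>g x\<bar>"]
    by (simp add: ennreal_power)
  have I: "(\<integral>\<^sup>+x. ennreal (norm (f x * g x)) \<partial>M) = ?I"
    by (simp add: abs_mult ennreal_mult)
  show "ennreal ((\<integral>x. f x * g x \<partial>M)\<^sup>2) \<le>
      (\<integral>\<^sup>+x. ennreal ((f x)\<^sup>2) \<partial>M) * (\<integral>\<^sup>+x. ennreal ((g x)\<^sup>2) \<partial>M)"
  proof (cases "integrable M (\<lambda>x. f x * g x)")
    case True
    have "ennreal (norm (\<integral>x. f x * g x \<partial>M)) \<le> ?I"
      using integral_norm_bound_ennreal[OF True] I by simp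
    then have "(ennreal (norm (\<integral>x. f x * g x \<partial>M)))\<^sup>2 \<le> ?I\<^sup>2"
      by (intro power_mono) auto
    then show ?thesis using cs by (simp add: ennreal_power)
  qed (simp add: not_integrable_integral_eq)
  assume "(\<integral>\<^sup>+x. ennreal ((f x)\<^sup>2) \<partial>M) < \<infinity>" "(\<integral>\<^sup>+x. ennreal ((g x)\<^sup>2) \<partial>M) < \<infinity>"
  then have "?I\<^sup>2 < \<infinity>" using cs by (auto simp: ennreal_mult_less_top intro: le_less_trans)
  then have "?I < \<infinity>" by (auto simp: power2_eq_square ennreal_mult_less_top less_top)
  then show "integrable M (\<lambda>x. f x * g x)" using I by (intro integrableI_bounded) auto
qed

lemma vdiff_eq_vlin: "vdiff F G = vlin 1 F (-1) G"
  by (simp add: vdiff_def vlin_def)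

context compact_prob
begin

definition lev :: "nat \<Rightarrow> ((nat \<Rightarrow> real \<times> real) \<Rightarrow> real) \<Rightarrow> ennreal" where
  "lev n f = (\<integral>\<^sup>+x. indicator (Sset n) x * ennreal ((f x)\<^sup>2) \<partial>Sm n)"

lemma fock_norm2_lev: "norm2 F = (\<Sum>n. lev n (F n))"
  by (simp add: fock_norm2_def lev_def)

lemma SsetD: "x \<in> Sset n \<Longrightarrow> i \<le> j \<Longrightarrow> j < n \<Longrightarrow> fst (x j) \<le> fst (x i)"
  by (simp add: Sset_def)

lemma SsetI: "(\<And>i j. i \<le> j \<Longrightarrow> j < n \<Longrightarrow> fst (x j) \<le>
    fst (x i)) \<Longrightarrow> x \<in> Sset n"
  by (simp add: Sset_def)

lemma measurable_Sset: "Measurable.pred (bprod n) (\<lambda>x. x \<in> Sset n)"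
proof -
  have fst: "(\<lambda>x. fst (x i)) \<in> borel_measurable (PiM {..<n} (\<lambda>_. borel :: (real \<times> real) measure))"
    if "i < n" for i by (rule measurable_compose[where N = borel])
       (use that in \<open>simp_all add: borel_prod[symmetric]\<close>)
  have "Measurable.pred (bprod n)
      (\<lambda>x :: nat \<Rightarrow> real \<times> real. \<forall>i\<in>{..<n}. \<forall>j\<in>{..<n}. i \<le>
          j \<longrightarrow> fst (x j) \<le> fst (x i))"
  proof (intro pred_intros_finite finite_lessThan)
    fix i j assume "i \<in> {..<n}" "j \<in> {..<n}"
    then have [measurable]: "(\<lambda>x. fst (x i)) \<in>
        borel_measurable (PiM {..<n} (\<lambda>_. borel :: (real \<times> real) measure))"
      "(\<lambda>x. fst (x j)) \<in> borel_measurable (PiM {..<n} (\<lambda>_. borel :: (real \<times> real) measure))"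
      using fst by auto
    show "Measurable.pred (bprod n) (\<lambda>x :: nat \<Rightarrow> real \<times> real. i \<le>
        j \<longrightarrow> fst (x j) \<le> fst (x i))"
      by (cases "i \<le> j") (auto simp: pred_def intro!: borel_measurable_le)
  qed
  moreover have "(\<lambda>x. x \<in> Sset n) = (\<lambda>x. \<forall>i\<in>{..<n}. \<forall>j\<in>{..<n}. i \<le>
      j \<longrightarrow> fst (x j) \<le> fst (x i))"
  proof (rule ext, rule iffI)
    fix x :: "nat \<Rightarrow> real \<times> real" assume "x \<in> Sset n"
    then show "\<forall>i\<in>{..<n}. \<forall>j\<in>{..<n}. i \<le> j \<longrightarrow> fst (x j) \<le> fst (x i)"
      using SsetD[of x n] by blast
  next
    fix x :: "nat \<Rightarrow> real \<times> real" assume a: "\<forall>i\<in>{..<n}. \<forall>j\<in>{..<n}. i \<le>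
        j \<longrightarrow> fst (x j) \<le> fst (x i)"
    show "x \<in> Sset n"
    proof (rule SsetI)
      fix i j assume "i \<le> j" "j < n"
      then show "fst (x j) \<le> fst (x i)" using a le_less_trans[of i j n] by blast
    qed
  qed
  ultimately show ?thesis by (simp only:)
qed

lemma measurable_Sset_Sn: "Measurable.pred (Sm n) (\<lambda>x. x \<in> Sset n)"
  by (rule measurable_Sn_borel[OF measurable_Sset])

lemma indicator_Sset [measurable]: "(\<lambda>x. indicator (Sset n) x :: 'b :: {zero_neq_one, topological_space}) \<in> borel_measurable (Sm n)"
  unfolding indicator_def using measurable_Sset_Sn[of n] by measurable

lemma indicator_Sset_borel: "(\<lambda>x. indicator (Sset n) x :: 'b :: {zero_neq_one, topological_space}) \<in>
    borel_measurable (bprod n)"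
  unfolding indicator_def using measurable_Sset[of n] by measurable

lemma Sset_pcons: "pcons n p x \<in> Sset (Suc n) \<longleftrightarrow> x \<in> Sset n \<and> (n = 0 \<or> fst (x 0) \<le> fst p)"
proof
  assume a: "pcons n p x \<in> Sset (Suc n)"
  have "fst (x j) \<le> fst (x i)" if "i \<le> j" "j < n" for i j
    using SsetD[OF a, of "Suc i" "Suc j"] that by simp
  then have "x \<in> Sset n" by (rule SsetI)
  moreover have "n = 0 \<or> fst (x 0) \<le> fst p" using SsetD[OF a, of 0 1] by (cases n) simp_all
  ultimately show "x \<in> Sset n \<and> (n = 0 \<or> fst (x 0) \<le> fst p)" by simp
next
  assume a: "x \<in> Sset n \<and> (n = 0 \<or> fst (x 0) \<le> fst p)"
  show "pcons n p x \<in> Sset (Suc n)"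
  proof (rule SsetI)
    fix i j assume ij: "i \<le> j" "j < Suc n"
    show "fst (pcons n p x j) \<le> fst (pcons n p x i)"
    proof (cases j)
      case (Suc j')
      show ?thesis
      proof (cases i)
        case 0
        have "fst (x j') \<le> fst (x 0)" using a SsetD[of x n 0 j'] ij Suc by simp
        then show ?thesis using a ij 0 Suc by simp
      next
        case (Suc i')
        then show ?thesis using a SsetD[of x n i' j'] ij \<open>j = Suc j'\<close> by simp
      qed
    qed (use ij in simp)
  qed
qed

lemma lev_vlin:
  assumes "f \<in> borel_measurable (Sm n)" "g \<in> borel_measurable (Sm n)"
  shows "lev n (\<lambda>x. a * f x + b * g x) \<le> ennreal (2 * a\<^sup>2) * lev n f + ennreal (2 * b\<^sup>2) * lev n g"
  unfolding lev_def by (rule nn_integral_sq_lin[OF indicator_Sset assms])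

lemma fock_measurable: "F \<in> Fock \<Longrightarrow> F n \<in> borel_measurable (Sm n)"
  by (simp add: fock_space_def)

lemma fock_norm2_vlin:
  assumes "\<And>n. F n \<in> borel_measurable (Sm n)" "\<And>n. G n \<in> borel_measurable (Sm n)"
  shows "norm2 (vlin a F b G) \<le> ennreal (2 * a\<^sup>2) * norm2 F + ennreal (2 * b\<^sup>2) * norm2 G"
proof -
  have "norm2 (vlin a F b G) \<le> (\<Sum>n. ennreal (2 * a\<^sup>2) * lev n (F n) + ennreal (2 * b\<^sup>2) * lev n (G n))"
    unfolding fock_norm2_lev vlin_def by (intro suminf_le lev_vlin assms) auto
  also have "\<dots> = ennreal (2 * a\<^sup>2) * norm2 F + ennreal (2 * b\<^sup>2) * norm2 G"
    unfolding fock_norm2_lev by (subst suminf_add[symmetric]) auto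
  finally show ?thesis .
qed

lemma fock_space_vlin:
  assumes "F \<in> Fock" "G \<in> Fock" shows "vlin a F b G \<in> Fock"
proof -
  have "norm2 (vlin a F b G) < \<infinity>" by (rule le_less_trans[OF fock_norm2_vlin])
       (use assms in \<open>auto simp: fock_space_def ennreal_mult_less_top\<close>)
  moreover have "vlin a F b G n \<in> borel_measurable (Sm n)" for n
    using fock_measurable[OF assms(1), of n] fock_measurable[OF assms(2), of n]
    unfolding vlin_def by measurable
  ultimately show ?thesis by (simp add: fock_space_def)
qed

text \<open>Equality in the Fock space: elements are represented by functions, and values off
  \<open>Sset n\<close> carry no information.\<close>

definition feq :: "fockvec \<Rightarrow> fockvec \<Rightarrow> bool" where
  "feq F G \<longleftrightarrow> (\<forall>n. AE x in Sm n. x \<in> Sset n \<longrightarrow> F n x = G n x)"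

lemma lev_cong_AE:
  assumes "AE x in Sm n. x \<in> Sset n \<longrightarrow> f x = g x" shows "lev n f = lev n g"
  unfolding lev_def
  by (rule nn_integral_cong_AE) (use assms in eventually_elim, auto simp: indicator_def)

lemma feq_norm2: "feq F G \<Longrightarrow> norm2 F = norm2 G"
  unfolding fock_norm2_lev feq_def by (intro suminf_cong lev_cong_AE) auto

lemma fock_norm2_0 [simp]: "norm2 (\<lambda>n x. 0) = 0"
  by (simp add: fock_norm2_def)

lemma feq_vdiff_0: "feq F G \<Longrightarrow> norm2 (vdiff F G) = 0"
  by (subst feq_norm2[of _ "\<lambda>n x. 0"]) (auto simp: feq_def vdiff_def)

lemma feq_vdiff: "feq F F' \<Longrightarrow> feq G G' \<Longrightarrow> feq (vdiff F G) (vdiff F' G')"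
  unfolding feq_def vdiff_def
proof
  fix n
  assume "\<forall>n. AE x in Sm n. x \<in> Sset n \<longrightarrow> F n x = F' n x"
    "\<forall>n. AE x in Sm n. x \<in> Sset n \<longrightarrow> G n x = G' n x"
  from spec[OF this(1), of n] spec[OF this(2), of n]
  show "AE x in Sm n. x \<in> Sset n \<longrightarrow> F n x - G n x = F' n x - G' n x"
    by eventually_elim auto
qed

lemma feq_refl [simp]: "feq F F"
  by (simp add: feq_def)

lemma feq_trans [trans]: "feq F G \<Longrightarrow> feq G H \<Longrightarrow> feq F H"
  unfolding feq_def
proof
  fix n
  assume "\<forall>n. AE x in Sm n. x \<in> Sset n \<longrightarrow> F n x = G n x"
    "\<forall>n. AE x in Sm n. x \<in> Sset n \<longrightarrow> G n x = H n x"
  from spec[OF this(1), of n] spec[OF this(2), of n]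
  show "AE x in Sm n. x \<in> Sset n \<longrightarrow> F n x = H n x" by eventually_elim auto
qed

lemma feq_sym: "feq F G \<Longrightarrow> feq G F"
  unfolding feq_def by (simp add: eq_commute)

lemma nn_integral_Sn_Suc:
  assumes "f \<in> borel_measurable (Sm (Suc n))"
  shows "(\<integral>\<^sup>+x. f x \<partial>Sm (Suc n)) =
      (\<integral>\<^sup>+x. (\<integral>\<^sup>+p. f (pcons n p x) \<partial>M1 \<nu>) \<partial>Sm n)"
  using assms unfolding Sn_meas_def by (rule M1.nn_integral_PiM_Suc)

lemma measurable_pcons_Sn:
  assumes "f \<in> measurable N (M1 \<nu>)" "g \<in> measurable N (Sm n)"
  shows "(\<lambda>x. pcons n (f x) (g x)) \<in> measurable N (Sm (Suc n))"
  using assms unfolding Sn_meas_def by (rule measurable_pcons)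

lemma measurable_fst_Sn: "i < n \<Longrightarrow> (\<lambda>x. fst (x i)) \<in> borel_measurable (Sm n)"
  and measurable_snd_Sn: "i < n \<Longrightarrow> (\<lambda>x. snd (x i)) \<in> borel_measurable (Sm n)"
  unfolding Sn_meas_def
  by (rule measurable_compose[where f = "\<lambda>x. x i", OF _ measurable_fst_M1], simp)
     (rule measurable_compose[where f = "\<lambda>x. x i", OF _ measurable_snd_M1], simp)

lemma measurable_Sn_section:
  assumes "f \<in> borel_measurable (Sm (Suc n))" "x \<in> space (Sm n)"
  shows "(\<lambda>p. f (pcons n p x)) \<in> borel_measurable (M1 \<nu>)"
  by (rule measurable_compose[OF measurable_pcons_Sn assms(1)]) (use assms(2) in auto)

lemma Sn_extensional: "x \<in> space (Sm n) \<Longrightarrow> x \<in> extensional {..<n}"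
  by (simp add: space_Sn PiE_def)

text \<open>As \<nu> has mass one, this is the squared norm of \<open>h\<close> in
  \<open>L^2\<close> of the half-line. It bounds the squared operator norms of creation and
  annihilation alike.\<close>

definition hnorm :: "(real \<Rightarrow> real) \<Rightarrow> ennreal" where
  "hnorm h = (\<integral>\<^sup>+p. ennreal ((h (fst p))\<^sup>2) \<partial>M1 \<nu>)"

lemma B0_measurable: "h \<in> B0 \<Longrightarrow> h \<in> borel_measurable borel"
  by (simp add: B0_def)

lemma hnorm_finite:
  assumes "h \<in> B0" shows "hnorm h < \<infinity>"
proof -
  obtain B C where B: "\<And>t. \<bar>h t\<bar> \<le> B" and C: "\<And>t. t > C \<Longrightarrow> h t = 0"
    using assms by (auto simp: B0_def)
  note [measurable] = B0_measurable[OF assms]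
  have [measurable]: "fst \<in> borel_measurable (borel :: (real \<times> real) measure)"
    by (simp add: borel_prod[symmetric])
  have "hnorm h = (\<integral>\<^sup>+u. (\<integral>\<^sup>+v. indicator {0..} u *
      ennreal ((h u)\<^sup>2) \<partial>\<nu>) \<partial>lborel)"
    unfolding hnorm_def by (subst nn_integral_M1) auto
  also have "\<dots> \<le> (\<integral>\<^sup>+u. ennreal (B\<^sup>2) * indicator {0..C} u \<partial>lborel)"
  proof (rule nn_integral_mono)
    fix u :: real
    have "(h u)\<^sup>2 \<le> B\<^sup>2" using B[of u] by (metis abs_ge_zero power2_abs power_mono)
    then show "(\<integral>\<^sup>+v. indicator {0..} u * ennreal ((h u)\<^sup>2) \<partial>\<nu>) \<le>
        ennreal (B\<^sup>2) * indicator {0..C} u"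
      using C[of u] emeasure_space_1 by (auto simp: indicator_def)
  qed
  also have "\<dots> = ennreal (B\<^sup>2) * emeasure lborel {0..C}"
    by (simp add: nn_integral_cmult)
  also have "\<dots> < \<infinity>" by (simp add: ennreal_mult_less_top emeasure_lborel_Icc_eq)
  finally show ?thesis .
qed

lemma measurable_h_fst: "h \<in> B0 \<Longrightarrow> (\<lambda>p. h (fst p)) \<in> borel_measurable (M1 \<nu>)"
  using measurable_compose[OF measurable_fst_M1 B0_measurable] by simp

section \<open>Bounds for creation, neutral and annihilation operators\<close>

lemma acre_measurable:
  assumes "h \<in> B0" "\<And>n. F n \<in> borel_measurable (Sm n)"
  shows "acre h F n \<in> borel_measurable (Sm n)"
proof (cases n)
  case (Suc m)
  have 1: "(\<lambda>x :: nat \<Rightarrow> real \<times> real. h (fst (x 0))) \<in> borel_measurable (Sm n)"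
    by (rule measurable_compose[OF measurable_fst_Sn B0_measurable]) (use Suc assms in auto)
  have "ptail m \<in> measurable (Sm (Suc m)) (Sm m)"
    unfolding Sn_meas_def by (rule measurable_ptail) simp
  from measurable_compose[OF this assms(2)[of m]] 1 show ?thesis unfolding acre_def Suc by simp
qed (simp add: acre_def)

text \<open>Dropping the constraint that the new time is at least the old first one only enlarges
  the integral, and then the variables separate.\<close>

lemma lev_acre:
  assumes h: "h \<in> B0" and F: "\<And>n. F n \<in> borel_measurable (Sm n)"
  shows "lev 0 (acre h F 0) = 0" "lev (Suc m) (acre h F (Suc m)) \<le> hnorm h * lev m (F m)"
proof -
  show "lev 0 (acre h F 0) = 0" by (simp add: lev_def acre_def)
  have meas: "(\<lambda>x. indicator (Sset (Suc m)) x * ennreal ((acre h F (Suc m) x)\<^sup>2)) \<in>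
      borel_measurable (Sm (Suc m))"
    using acre_measurable[OF assms, of "Suc m"] by measurable
  have "lev (Suc m) (acre h F (Suc m)) =
      (\<integral>\<^sup>+x. (\<integral>\<^sup>+p. indicator (Sset (Suc m)) (pcons m p x) *
          ennreal ((acre h F (Suc m) (pcons m p x))\<^sup>2) \<partial>M1 \<nu>) \<partial>Sm m)"
    unfolding lev_def by (rule nn_integral_Sn_Suc[OF meas])
  also have "\<dots> \<le> (\<integral>\<^sup>+x. (\<integral>\<^sup>+p. ennreal ((h (fst p))\<^sup>2) *
      (indicator (Sset m) x * ennreal ((F m x)\<^sup>2)) \<partial>M1 \<nu>) \<partial>Sm m)"
  proof (intro nn_integral_mono)
    fix x p assume x: "x \<in> space (Sm m)"
    show "indicator (Sset (Suc m)) (pcons m p x) * ennreal ((acre h F (Suc m) (pcons m p x))\<^sup>2)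
      \<le> ennreal ((h (fst p))\<^sup>2) * (indicator (Sset m) x * ennreal ((F m x)\<^sup>2))"
      using ptail_pcons[OF Sn_extensional[OF x], of p]
      by (auto simp: acre_def indicator_def Sset_pcons power_mult_distrib ennreal_mult)
  qed
  also have "\<dots> = (\<integral>\<^sup>+x. hnorm h * (indicator (Sset m) x * ennreal ((F m x)\<^sup>2)) \<partial>Sm m)"
    unfolding hnorm_def using measurable_h_fst[OF h]
    by (intro nn_integral_cong nn_integral_multc) measurable
  also have "\<dots> = hnorm h * lev m (F m)"
    unfolding lev_def using F[of m] by (intro nn_integral_cmult) measurable
  finally show "lev (Suc m) (acre h F (Suc m)) \<le> hnorm h * lev m (F m)" .
qed

lemma aneu_measurable:
  assumes "h \<in> B0" "\<And>n. F n \<in> borel_measurable (Sm n)"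
  shows "aneu h F n \<in> borel_measurable (Sm n)"
proof (cases "n = 0")
  case False
  have [measurable]: "(\<lambda>x :: nat \<Rightarrow> real \<times> real. h (fst (x 0))) \<in> borel_measurable (Sm n)"
    by (rule measurable_compose[OF measurable_fst_Sn B0_measurable]) (use False assms in auto)
  have [measurable]: "(\<lambda>x :: nat \<Rightarrow> real \<times> real. snd (x 0)) \<in> borel_measurable (Sm n)"
    by (rule measurable_snd_Sn) (use False in auto)
  note [measurable] = assms(2)[of n]
  show ?thesis using False unfolding aneu_def by simp
qed (simp add: aneu_def)

text \<open>The multiplier \<open>h(t_1) s_1\<close> is almost surely bounded by
  \<open>B * R\<close>, uniformly in the vector and in the degree.\<close>

lemma lev_aneu:
  assumes h: "h \<in> B0"
  obtains K :: real where "K \<ge> 0"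
    "\<And>F n. (\<And>n. F n \<in> borel_measurable (Sm n)) \<Longrightarrow> lev n (aneu h F n) \<le> ennreal K * lev n (F n)"
proof -
  obtain B where B: "\<And>t. \<bar>h t\<bar> \<le> B" using h by (auto simp: B0_def)
  obtain R where R: "R \<ge> 0" "AE s in \<nu>. \<bar>s\<bar> \<le> R" by (rule bounded_supp)
  have "lev n (aneu h F n) \<le> ennreal ((B * R)\<^sup>2) * lev n (F n)"
    if F: "\<And>n. F n \<in> borel_measurable (Sm n)" for F n
  proof (cases "n = 0")
    case False
    have ae: "AE x in Sm n. \<forall>k<n. \<bar>snd (x k)\<bar> \<le> R"
      by (rule AE_Sn_snd[OF R(2)])
    have "lev n (aneu h F n) \<le> (\<integral>\<^sup>+x. ennreal ((B * R)\<^sup>2) * (indicator (Sset n) x *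
        ennreal ((F n x)\<^sup>2)) \<partial>Sm n)"
      unfolding lev_def
    proof (rule nn_integral_mono_AE, use ae in eventually_elim)
      fix x :: "nat \<Rightarrow> real \<times> real" assume x: "\<forall>k<n. \<bar>snd (x k)\<bar> \<le> R"
      have "\<bar>h (fst (x 0)) * snd (x 0)\<bar> \<le> B * R"
        unfolding abs_mult using x False B by (intro mult_mono) (auto intro: order.trans[OF abs_ge_zero])
      then have "(h (fst (x 0)) * snd (x 0))\<^sup>2 \<le> (B * R)\<^sup>2"
        by (metis abs_ge_zero power2_abs power_mono)
      then have "(aneu h F n x)\<^sup>2 \<le> (B * R)\<^sup>2 * (F n x)\<^sup>2"
        using False unfolding aneu_def by (simp add: power_mult_distrib mult_right_mono)
      then have "ennreal ((aneu h F n x)\<^sup>2) \<le> ennreal ((B * R)\<^sup>2) * ennreal ((F n x)\<^sup>2)"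
        by (simp add: ennreal_mult[symmetric] ennreal_leI)
      from mult_left_mono[OF this, of "indicator (Sset n) x"]
      show "indicator (Sset n) x * ennreal ((aneu h F n x)\<^sup>2) \<le>
          ennreal ((B * R)\<^sup>2) * (indicator (Sset n) x * ennreal ((F n x)\<^sup>2))"
        by (simp add: mult.left_commute)
    qed
    also have "\<dots> = ennreal ((B * R)\<^sup>2) * lev n (F n)"
      unfolding lev_def using F[of n] by (intro nn_integral_cmult) measurable
    finally show ?thesis .
  qed (simp add: aneu_def lev_def)
  then show ?thesis by (intro that[of "(B * R)\<^sup>2"]) auto
qed

text \<open>The first factor of the integrand of \<open>aann\<close>, named so that it can be
  treated as a jointly measurable kernel. For \<open>n = 0\<close> there is no first time to compare
  with.\<close>

definition ann_ind :: "nat \<Rightarrow> (nat \<Rightarrow> real \<times> real) \<Rightarrow> real \<times> real \<Rightarrow> real" where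
  "ann_ind n x p = indicator {p. n = 0 \<or> fst (x 0) \<le> fst p} p"

lemma ann_ind_meas2: "(\<lambda>z. ann_ind n (fst z) (snd z)) \<in> borel_measurable (Sm n \<Otimes>\<^sub>M M1 \<nu>)"
proof (cases "n = 0")
  case False
  have [measurable]: "(\<lambda>z :: (nat \<Rightarrow> real \<times> real) \<times> real \<times> real. fst (fst z 0)) \<in> borel_measurable (Sm n \<Otimes>\<^sub>M M1 \<nu>)"
    by (rule measurable_compose[OF measurable_fst measurable_fst_Sn]) (use False in simp)
  show ?thesis using False unfolding ann_ind_def indicator_def by simp
qed (simp add: ann_ind_def)

lemma ann_ind_meas: "x \<in> space (Sm n) \<Longrightarrow> ann_ind n x \<in> borel_measurable (M1 \<nu>)"
  using measurable_compose[OF measurable_Pair1' ann_ind_meas2, of x n] by simp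

lemma aann_measurable:
  assumes "h \<in> B0" "\<And>n. F n \<in> borel_measurable (Sm n)"
  shows "aann \<nu> h F n \<in> borel_measurable (Sm n)"
proof -
  have [measurable]: "(\<lambda>z. F (Suc n) (pcons n (snd z) (fst z))) \<in> borel_measurable (Sm n \<Otimes>\<^sub>M M1 \<nu>)"
    by (rule measurable_compose[OF measurable_pcons_Sn assms(2)]) auto
  have [measurable]: "(\<lambda>z. h (fst (snd z))) \<in> borel_measurable (Sm n \<Otimes>\<^sub>M M1 \<nu>)"
    by (rule measurable_compose[OF measurable_snd measurable_h_fst[OF assms(1)]])
  note [measurable] = ann_ind_meas2[of n]
  have "(\<lambda>(x, p). ann_ind n x p * h (fst p) * F (Suc n) (pcons n p x)) \<in>
      borel_measurable (Sm n \<Otimes>\<^sub>M M1 \<nu>)"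
    unfolding split_beta' by measurable
  from M1.borel_measurable_lebesgue_integral[OF this] show ?thesis unfolding aann_def ann_ind_def .
qed

lemma ann_section:
  assumes x: "x \<in> space (Sm n)" and F: "\<And>n. F n \<in> borel_measurable (Sm n)"
  shows "(\<lambda>p. ann_ind n x p * F (Suc n) (pcons n p x)) \<in> borel_measurable (M1 \<nu>)"
    and "x \<in> Sset n \<Longrightarrow> (\<integral>\<^sup>+p. ennreal ((ann_ind n x p *
        F (Suc n) (pcons n p x))\<^sup>2) \<partial>M1 \<nu>) =
      (\<integral>\<^sup>+p. indicator (Sset (Suc n)) (pcons n p x) *
          ennreal ((F (Suc n) (pcons n p x))\<^sup>2) \<partial>M1 \<nu>)"
proof -
  note [measurable] = measurable_Sn_section[OF F[of "Suc n"] x] ann_ind_meas[OF x]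
  show "(\<lambda>p. ann_ind n x p * F (Suc n) (pcons n p x)) \<in> borel_measurable (M1 \<nu>)" by measurable
  assume "x \<in> Sset n"
  then show "(\<integral>\<^sup>+p. ennreal ((ann_ind n x p * F (Suc n) (pcons n p x))\<^sup>2) \<partial>M1 \<nu>) =
      (\<integral>\<^sup>+p. indicator (Sset (Suc n)) (pcons n p x) *
          ennreal ((F (Suc n) (pcons n p x))\<^sup>2) \<partial>M1 \<nu>)"
    by (intro nn_integral_cong) (auto simp: ann_ind_def indicator_def Sset_pcons)
qed

lemma lev_Suc:
  assumes "f \<in> borel_measurable (Sm (Suc n))"
  shows "lev (Suc n) f = (\<integral>\<^sup>+x. (\<integral>\<^sup>+p. indicator (Sset (Suc n)) (pcons n p x) *
      ennreal ((f (pcons n p x))\<^sup>2) \<partial>M1 \<nu>) \<partial>Sm n)"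
  unfolding lev_def by (rule nn_integral_Sn_Suc) (use assms in measurable)

lemma section_measurable:
  assumes "f \<in> borel_measurable (Sm (Suc n))"
  shows "(\<lambda>x. \<integral>\<^sup>+p. indicator (Sset (Suc n)) (pcons n p x) *
      ennreal ((f (pcons n p x))\<^sup>2) \<partial>M1 \<nu>) \<in> borel_measurable (Sm n)"
proof -
  have [measurable]: "(\<lambda>x. indicator (Sset (Suc n)) x * ennreal ((f x)\<^sup>2)) \<in> borel_measurable (Sm (Suc n))"
    using assms by measurable
  have "(\<lambda>z. indicator (Sset (Suc n)) (pcons n (snd z) (fst z)) * ennreal ((f (pcons n (snd z) (fst z)))\<^sup>2))
      \<in> borel_measurable (Sm n \<Otimes>\<^sub>M M1 \<nu>)"
    by (rule measurable_compose[OF measurable_pcons_Sn, of snd _ fst n "\<lambda>x. indicator (Sset (Suc n)) x *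
        ennreal ((f x)\<^sup>2)"]) auto
  then have "(\<lambda>(x, p). indicator (Sset (Suc n)) (pcons n p x) * ennreal ((f (pcons n p x))\<^sup>2))
      \<in> borel_measurable (Sm n \<Otimes>\<^sub>M M1 \<nu>)" by (simp add: split_beta')
  from M1.borel_measurable_nn_integral[OF this] show ?thesis .
qed

text \<open>Cauchy-Schwarz in the annihilated variable; the remaining integral over
  \<open>S_n\<close> reassembles the squared norm on \<open>S_{n+1}\<close>.\<close>

lemma lev_aann:
  assumes h: "h \<in> B0" and F: "\<And>n. F n \<in> borel_measurable (Sm n)"
  shows "lev n (aann \<nu> h F n) \<le> hnorm h * lev (Suc n) (F (Suc n))"
proof -
  have "lev n (aann \<nu> h F n) \<le>
      (\<integral>\<^sup>+x. hnorm h * (\<integral>\<^sup>+p. indicator (Sset (Suc n)) (pcons n p x)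
       * ennreal ((F (Suc n) (pcons n p x))\<^sup>2) \<partial>M1 \<nu>) \<partial>Sm n)"
    unfolding lev_def
  proof (rule nn_integral_mono)
    fix x assume x: "x \<in> space (Sm n)"
    show "indicator (Sset n) x * ennreal ((aann \<nu> h F n x)\<^sup>2) \<le> hnorm h *
      (\<integral>\<^sup>+p. indicator (Sset (Suc n)) (pcons n p x) *
          ennreal ((F (Suc n) (pcons n p x))\<^sup>2) \<partial>M1 \<nu>)"
    proof (cases "x \<in> Sset n")
      case True
      have "aann \<nu> h F n x = (\<integral>p. h (fst p) * (ann_ind n x p * F (Suc n) (pcons n p x)) \<partial>M1 \<nu>)"
        by (simp add: aann_def ann_ind_def mult_ac)
      then show ?thesis
        using integral_Cauchy_Schwarz(1)[OF measurable_h_fst[OF h] ann_section(1)[OF x F]]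
        by (simp add: hnorm_def ann_section(2)[OF x F True, symmetric] True)
    qed simp
  qed
  also have "\<dots> = hnorm h * lev (Suc n) (F (Suc n))"
    by (subst lev_Suc[OF F]) (intro nn_integral_cmult section_measurable F)
  finally show ?thesis .
qed

text \<open>A finite norm makes almost every section square-integrable, and its product with
  \<open>h\<close> is then integrable by Cauchy-Schwarz.\<close>

lemma aann_integrable:
  assumes h: "h \<in> B0" and F: "F \<in> Fock"
  shows "AE x in Sm n. x \<in> Sset n \<longrightarrow>
    integrable (M1 \<nu>) (\<lambda>p. ann_ind n x p * h (fst p) * F (Suc n) (pcons n p x))"
proof -
  note Fm = fock_measurable[OF F]
  have "lev (Suc n) (F (Suc n)) \<le> norm2 F"
    unfolding fock_norm2_lev using sum_le_suminf[of "\<lambda>n. lev n (F n)" "{Suc n}"] by simp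
  also have "\<dots> < \<infinity>" using F by (simp add: fock_space_def)
  finally have "(\<integral>\<^sup>+x. (\<integral>\<^sup>+p. indicator (Sset (Suc n)) (pcons n p x)
       * ennreal ((F (Suc n) (pcons n p x))\<^sup>2) \<partial>M1 \<nu>) \<partial>Sm n) \<noteq> \<infinity>"
    unfolding lev_Suc[OF Fm] by simp
  from nn_integral_PInf_AE[OF section_measurable[OF Fm] this]
  show ?thesis using AE_space[of "Sm n"]
  proof eventually_elim
    case (elim x)
    show ?case
    proof
      assume xS: "x \<in> Sset n"
      have "integrable (M1 \<nu>) (\<lambda>p. h (fst p) * (ann_ind n x p * F (Suc n) (pcons n p x)))"
        using hnorm_finite[OF h] elim
        by (intro integral_Cauchy_Schwarz(2) measurable_h_fst[OF h] ann_section(1)[OF elim(2) Fm])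
           (simp_all add: ann_section(2)[OF elim(2) Fm xS] hnorm_def less_top)
      then show "integrable (M1 \<nu>) (\<lambda>p. ann_ind n x p * h (fst p) * F (Suc n) (pcons n p x))"
        by (simp add: mult_ac)
    qed
  qed
qed

lemma omega_measurable:
  assumes "h \<in> B0" "\<And>n. F n \<in> borel_measurable (Sm n)"
  shows "omega \<nu> h F n \<in> borel_measurable (Sm n)"
  using acre_measurable[OF assms, of n] aneu_measurable[OF assms, of n] aann_measurable[OF assms, of n]
  unfolding omega_def by measurable

lemma omega_bounded:
  assumes h: "h \<in> B0"
  obtains C where "C < \<infinity>"
    "\<And>F. (\<And>n. F n \<in> borel_measurable (Sm n)) \<Longrightarrow> norm2 (omega \<nu> h F) \<le> C * norm2 F"
proof -
  obtain K :: real where K: "K \<ge> 0"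
    "\<And>F n. (\<And>n. F n \<in> borel_measurable (Sm n)) \<Longrightarrow> lev n (aneu h F n) \<le> ennreal K * lev n (F n)"
    by (rule lev_aneu[OF h]) blast
  \<comment> \<open>Splitting off \<open>aann\<close> and then \<open>aneu\<close> costs a factor 2
    each time: creation and neutral part carry 4, annihilation carries 2.\<close>
  define C where "C = 4 * hnorm h + 4 * ennreal K + 2 * hnorm h"
  have "norm2 (omega \<nu> h F) \<le> C * norm2 F"
    if F: "\<And>n. F n \<in> borel_measurable (Sm n)" for F
  proof -
    note meas = acre_measurable[OF h F] aneu_measurable[OF h F] aann_measurable[OF h F]
    have one: "lev n (omega \<nu> h F n) \<le>
        4 * lev n (acre h F n) + 4 * lev n (aneu h F n) + 2 * lev n (aann \<nu> h F n)" for n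
    proof -
      have "lev n (omega \<nu> h F n) \<le> 2 * lev n (\<lambda>x. acre h F n x + aneu h F n x) + 2 * lev n (aann \<nu> h F n)"
        using lev_vlin[of "\<lambda>x. acre h F n x + aneu h F n x" n "aann \<nu> h F n" 1 1] meas
        by (simp add: omega_def)
      also have "lev n (\<lambda>x. acre h F n x + aneu h F n x) \<le> 2 * lev n (acre h F n) + 2 * lev n (aneu h F n)"
        using lev_vlin[of "acre h F n" n "aneu h F n" 1 1] meas by simp
      finally show ?thesis
        by (simp add: distrib_left mult.assoc[symmetric] add_right_mono mult_left_mono)
    qed
    have cr: "(\<Sum>n. lev n (acre h F n)) \<le> hnorm h * norm2 F"
    proof -
      have "(\<Sum>n. lev n (acre h F n)) = (\<Sum>n. lev (Suc n) (acre h F (Suc n)))"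
        using suminf_offset[of "\<lambda>n. lev n (acre h F n)" 1] lev_acre(1)[OF h F] by simp
      also have "\<dots> \<le> (\<Sum>n. hnorm h * lev n (F n))"
        by (intro suminf_le lev_acre[OF h F]) auto
      finally show ?thesis by (simp add: fock_norm2_lev)
    qed
    have ne: "(\<Sum>n. lev n (aneu h F n)) \<le> ennreal K * norm2 F"
    proof -
      have "(\<Sum>n. lev n (aneu h F n)) \<le> (\<Sum>n. ennreal K * lev n (F n))"
        by (intro suminf_le K(2) F) auto
      then show ?thesis by (simp add: fock_norm2_lev)
    qed
    have an: "(\<Sum>n. lev n (aann \<nu> h F n)) \<le> hnorm h * norm2 F"
    proof -
      have "(\<Sum>n. lev n (aann \<nu> h F n)) \<le> (\<Sum>n. hnorm h * lev (Suc n) (F (Suc n)))"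
        by (intro suminf_le lev_aann[OF h F]) auto
      also have "\<dots> = hnorm h * (\<Sum>n. lev (Suc n) (F (Suc n)))" by simp
      also have "(\<Sum>n. lev (Suc n) (F (Suc n))) \<le> norm2 F"
        using suminf_offset[of "\<lambda>n. lev n (F n)" 1] by (simp add: fock_norm2_lev)
      finally show ?thesis by (simp add: mult_left_mono)
    qed
    have "norm2 (omega \<nu> h F) \<le> (\<Sum>n. 4 * lev n (acre h F n) + 4 * lev n (aneu h F n) + 2 * lev n (aann \<nu> h F n))"
      unfolding fock_norm2_lev by (intro suminf_le one) auto
    also have "\<dots> = 4 * (\<Sum>n. lev n (acre h F n)) + 4 * (\<Sum>n. lev n (aneu h F n)) +
        2 * (\<Sum>n. lev n (aann \<nu> h F n))"
      by (simp add: suminf_add[symmetric])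
    also have "\<dots> \<le> 4 * (hnorm h * norm2 F) + 4 * (ennreal K * norm2 F) + 2 * (hnorm h * norm2 F)"
      by (intro add_mono mult_left_mono cr ne an) auto
    also have "\<dots> = C * norm2 F" by (simp add: C_def distrib_right mult.assoc)
    finally show ?thesis .
  qed
  moreover have "C < \<infinity>" using hnorm_finite[OF h] by (simp add: C_def ennreal_mult_less_top)
  ultimately show ?thesis by (rule that[rotated])
qed

lemma omega_space:
  assumes h: "h \<in> B0" and F: "F \<in> Fock" shows "omega \<nu> h F \<in> Fock"
proof -
  obtain C where "C < \<infinity>"
    "\<And>F. (\<And>n. F n \<in> borel_measurable (Sm n)) \<Longrightarrow> norm2 (omega \<nu> h F) \<le> C * norm2 F"
    by (rule omega_bounded[OF h]) blast
  then have "norm2 (omega \<nu> h F) \<le> C * norm2 F"  "C * norm2 F < \<infinity>"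
    using fock_measurable[OF F] F by (auto simp: fock_space_def ennreal_mult_less_top)
  then show ?thesis using omega_measurable[OF h fock_measurable[OF F]] by (auto simp: fock_space_def)
qed

text \<open>Linearity holds only up to \<open>feq\<close>: where a section is not integrable, the
  Bochner integral is 0 and additivity can fail.\<close>

lemma omega_vlin:
  assumes h: "h \<in> B0" and F: "F \<in> Fock" and G: "G \<in> Fock"
  shows "feq (omega \<nu> h (vlin a F b G)) (vlin a (omega \<nu> h F) b (omega \<nu> h G))"
  unfolding feq_def
proof
  fix n
  show "AE x in Sm n. x \<in> Sset n \<longrightarrow>
      omega \<nu> h (vlin a F b G) n x = vlin a (omega \<nu> h F) b (omega \<nu> h G) n x"
    using aann_integrable[OF h F, of n] aann_integrable[OF h G, of n]
  proof eventually_elim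
    case (elim x)
    show ?case
    proof
      assume "x \<in> Sset n"
      with elim have i: "integrable (M1 \<nu>) (\<lambda>p. ann_ind n x p * h (fst p) * F (Suc n) (pcons n p x))"
        "integrable (M1 \<nu>) (\<lambda>p. ann_ind n x p * h (fst p) * G (Suc n) (pcons n p x))" by auto
      have "aann \<nu> h (vlin a F b G) n x = (\<integral>p. a * (ann_ind n x p * h (fst p) * F (Suc n) (pcons n p x))
          + b * (ann_ind n x p * h (fst p) * G (Suc n) (pcons n p x)) \<partial>M1 \<nu>)"
        by (simp add: aann_def ann_ind_def vlin_def algebra_simps)
      also have "\<dots> = a * aann \<nu> h F n x + b * aann \<nu> h G n x"
        using i by (simp add: aann_def ann_ind_def)
      finally have ann: "aann \<nu> h (vlin a F b G) n x = a * aann \<nu> h F n x + b * aann \<nu> h G n x" .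
      have "acre h (vlin a F b G) n x = a * acre h F n x + b * acre h G n x"
        by (simp add: acre_def vlin_def algebra_simps split: nat.split)
      moreover have "aneu h (vlin a F b G) n x = a * aneu h F n x + b * aneu h G n x"
        by (simp add: aneu_def vlin_def algebra_simps)
      ultimately show "omega \<nu> h (vlin a F b G) n x = vlin a (omega \<nu> h F) b (omega \<nu> h G) n x"
        using ann by (simp add: omega_def vlin_def algebra_simps)
    qed
  qed
qed

end

subsection \<open>The isometry onto the Fock space\<close>

abbreviation tot :: "nat list \<Rightarrow> nat" where
  "tot ls \<equiv> sum_list ls + length ls"

lemma phi_Nil [simp]: "phi [] t = pt0"
  by (simp add: phi_def pt0_def)

lemma phi_Cons: "phi (l # ls) t j = (if j \<le> l then t 0 else phi ls (\<lambda>k. t (Suc k)) (j - Suc l))"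
proof -
  have "map (\<lambda>k. replicate ((l # ls) ! k + 1) (t k)) [0..<length (l # ls)]
      = replicate (l + 1) (t 0) # map (\<lambda>k. replicate (ls ! k + 1) (t (Suc k))) [0..<length ls]"
    by (simp add: upt_conv_Cons map_Suc_upt[symmetric] del: upt_Suc)
  then show ?thesis by (auto simp: phi_def nth_append nth_Cons' simp del: upt_Suc)
qed

lemma phi_undefined: "tot ls \<le> j \<Longrightarrow> phi ls t j = undefined"
  by (simp add: phi_def)

text \<open>Which coordinate of \<open>t\<close> appears at position \<open>j\<close> depends on
  \<open>ls\<close> alone. Measurability of \<open>phi\<close> and its independence of later
  coordinates rest on this.\<close>

lemma phi_index: "j < tot ls \<Longrightarrow> \<exists>k<length ls. \<forall>t. phi ls t j = t k"
proof (induction ls arbitrary: j)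
  case (Cons l ls)
  show ?case
  proof (cases "j \<le> l")
    case True
    then show ?thesis by (intro exI[of _ 0]) (simp add: phi_Cons)
  next
    case False
    then have "j - Suc l < tot ls" using Cons.prems by simp
    from Cons.IH[OF this] obtain k where k: "k < length ls" "\<forall>t. phi ls t (j - Suc l) = t k" by blast
    show ?thesis by (rule exI[of _ "Suc k"]) (use k False in \<open>simp add: phi_Cons\<close>)
  qed
qed simp

lemma phi_cong:
  assumes "\<And>k. k < length ls \<Longrightarrow> s k = t k" shows "phi ls s = phi ls t"
proof
  fix j show "phi ls s j = phi ls t j"
    using phi_index[of j ls] phi_undefined[of ls j] assms by (cases "j < tot ls") (metis, simp)
qed

lemma phi_Cons_0 [simp]: "phi (l # ls) t 0 = t 0"
  by (simp add: phi_Cons)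

text \<open>This and the next three identities translate the shifts in \<open>ABop\<close> into list
  operations: dropping the first time removes a block of length one or lowers the first
  multiplicity, prepending a new time opens a block with \<open>l = 0\<close>, and repeating the
  first time raises \<open>l\<close>.\<close>

lemma ptail_phi_0: "ptail (tot ls) (phi (0 # ls) t) = phi ls (\<lambda>k. t (Suc k))"
  by (auto simp: ptail_def phi_Cons fun_eq_iff phi_undefined)

lemma ptail_phi_Suc: "ptail (tot (l # ls)) (phi (Suc l # ls) t) = phi (l # ls) t"
  by (rule ext) (auto simp: ptail_def phi_Cons phi_undefined)

lemma pcons_phi: "pcons (tot ls) u (phi ls t) = phi (0 # ls) (pcons (length ls) u t)"
proof -
  have "phi ls (\<lambda>k. pcons (length ls) u t (Suc k)) = phi ls t" by (rule phi_cong) simp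
  then show ?thesis by (auto simp: fun_eq_iff pcons_def[of "tot ls"] phi_Cons phi_undefined)
qed

lemma pcons_phi_Suc: "pcons (tot (l # ls)) (t 0) (phi (l # ls) t) = phi (Suc l # ls) t"
  by (rule ext) (auto simp: pcons_def phi_Cons phi_undefined)

text \<open>The first block is recovered by counting; a later time equal to \<open>t 0\<close> would
  be counted along with it.\<close>

lemma lfirst_phi:
  assumes "\<And>k. 0 < k \<Longrightarrow> k < Suc (length ls) \<Longrightarrow> t k \<noteq> t 0"
  shows "lfirst (tot (l # ls)) (phi (l # ls) t) = l"
proof -
  have "phi ls (\<lambda>k. t (Suc k)) j \<noteq> t 0" if "j < tot ls" for j
    using phi_index[OF that] assms by force
  then have "phi (l # ls) t j = t 0 \<longleftrightarrow> j \<le> l" if "j < tot (l # ls)" for j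
    using that by (simp add: phi_Cons)
  then have "{j. j < tot (l # ls) \<and> phi (l # ls) t j = phi (l # ls) t 0} = {..l}" by auto
  then show ?thesis by (simp add: lfirst_def)
qed

lemma measurable_phi:
  "phi ls \<in> measurable (bprod (length ls)) (bprod (tot ls))"
proof (rule measurable_PiM_single')
  fix j assume "j \<in> {..<tot ls}"
  then obtain k where k: "k < length ls" "\<And>t :: nat \<Rightarrow> real. phi ls t j = t k"
    using phi_index[of j ls] by auto
  show "(\<lambda>t. phi ls t j) \<in> borel_measurable (bprod (length ls))"
    unfolding k(2) by (rule measurable_component_singleton) (use k(1) in simp)
next
  show "phi ls \<in> space (bprod (length ls)) \<rightarrow> {..<tot ls} \<rightarrow>\<^sub>E space borel"
    by (auto simp: PiE_def extensional_def phi_undefined)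
qed

lemma sets_PiM_lborel: "sets (PiM I (\<lambda>_. lborel :: real measure)) = sets (PiM I (\<lambda>_. borel))"
  by (rule sets_PiM_cong) simp_all

lemma measurable_PiM_lborel:
  "measurable (PiM I (\<lambda>_. lborel :: real measure)) N = measurable (PiM I (\<lambda>_. borel)) N"
  by (rule measurable_cong_sets[OF sets_PiM_lborel refl])

text \<open>The empty product is a single point. This reconciles \<open>efock_space\<close>, which
  asks for measurability in positive degrees, with \<open>emeas\<close>, which asks for it in all
  degrees.\<close>

lemma measurable_PiM_empty: "f \<in> borel_measurable (PiM {..<0::nat} (\<lambda>_. borel :: real measure))"
proof -
  have "f \<in> borel_measurable (PiM {..<0::nat} (\<lambda>_. borel :: real measure)) \<longleftrightarrow>
     (\<lambda>_. f (\<lambda>_. undefined)) \<in> borel_measurable (PiM {..<0::nat} (\<lambda>_. borel :: real measure))"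
    by (rule measurable_cong) (simp add: space_PiM)
  then show ?thesis by simp
qed

text \<open>Unlike \<open>comps\<close>, this admits the empty list, whose stratum is the vacuum
  component; degree 0 then obeys the same formulas as the others.\<close>

definition ecomps :: "nat \<Rightarrow> nat list set" where
  "ecomps n = {ls. tot ls = n}"

lemma finite_tot_le: "finite {ls. tot ls \<le> N}"
proof (rule finite_subset)
  show "{ls. tot ls \<le> N} \<subseteq> {ls. set ls \<subseteq> {..N} \<and> length ls \<le> N}"
  proof safe
    fix ls x assume "tot ls \<le> N" "x \<in> set ls"
    then show "x \<le> N" using member_le_sum_list[of x ls] by simp
  qed simp
qed (simp add: finite_lists_length_le)

lemma finite_ecomps: "finite (ecomps n)"
  by (rule finite_subset[OF _ finite_tot_le[of n]]) (auto simp: ecomps_def)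

lemma ecomps_0: "ecomps 0 = {[]}"
  by (auto simp: ecomps_def)

lemma ecomps_Suc: "ecomps (Suc n) = comps (Suc n)"
  by (auto simp: ecomps_def comps_def)

definition ulists :: "nat \<Rightarrow> nat \<Rightarrow> nat list set" where
  "ulists N i = {ls. set ls \<subseteq> {..N} \<and> length ls = i}"

lemma finite_ulists: "finite (ulists N i)"
  by (simp add: ulists_def finite_lists_length_eq)

lemma measurable_decset: "Measurable.pred (bprod i) (\<lambda>t. t \<in> decset i)"
proof -
  have A: "Measurable.pred (bprod i) (\<lambda>t :: nat \<Rightarrow> real. \<forall>k\<in>{..<i-1}. t (Suc k) < t k)"
  proof (intro pred_intros_finite)
    fix k assume "k \<in> {..<i - 1}"
    then have "(\<lambda>t. t k) \<in> borel_measurable (PiM {..<i} (\<lambda>_. borel :: real measure))"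
      "(\<lambda>t. t (Suc k)) \<in> borel_measurable (PiM {..<i} (\<lambda>_. borel :: real measure))"
      by (auto intro!: measurable_component_singleton)
    then show "Measurable.pred (bprod i) (\<lambda>t :: nat \<Rightarrow> real. t (Suc k) < t k)"
      unfolding pred_def by (rule borel_measurable_less[rotated])
  qed simp
  have B: "Measurable.pred (bprod i) (\<lambda>t :: nat \<Rightarrow> real. 0 < i \<longrightarrow> 0 \<le> t (i - 1))"
  proof (cases "0 < i")
    case True
    then have "(\<lambda>t. t (i - 1)) \<in> borel_measurable (PiM {..<i} (\<lambda>_. borel :: real measure))"
      by (intro measurable_component_singleton) simp
    then show ?thesis using True by (simp add: pred_def borel_measurable_le)
  qed simp
  have "Measurable.pred (bprod i)
    (\<lambda>t :: nat \<Rightarrow> real. (\<forall>k\<in>{..<i-1}. t (Suc k) < t k) \<and> (0 < i \<longrightarrow> 0 \<le> t (i - 1)))"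
    using A B unfolding pred_def by (rule sets.sets_Collect_conj[rotated])
  moreover have "(\<lambda>t. t \<in> decset i) =
      (\<lambda>t :: nat \<Rightarrow> real. (\<forall>k\<in>{..<i-1}. t (Suc k) < t k) \<and> (0 < i \<longrightarrow> 0 \<le> t (i - 1)))"
  proof
    fix t :: "nat \<Rightarrow> real"
    have "Suc k < i \<longleftrightarrow> k \<in> {..<i - 1}" for k by auto
    then show "(t \<in> decset i) = ((\<forall>k\<in>{..<i-1}. t (Suc k) < t k) \<and> (0 < i \<longrightarrow> 0 \<le> t (i - 1)))"
      unfolding decset_def Ball_def by simp
  qed
  ultimately show ?thesis by (simp only:)
qed

lemma indicator_decset: "(\<lambda>t. indicator (decset i) t :: ennreal) \<in> borel_measurable (bprod i)"
  unfolding indicator_def using measurable_decset[of i] by measurable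

definition esupp :: "nat \<Rightarrow> efockvec \<Rightarrow> bool" where
  "esupp N F \<longleftrightarrow> (\<forall>n>N. F n = (\<lambda>_. 0))"

definition emeas :: "efockvec \<Rightarrow> bool" where
  "emeas F \<longleftrightarrow> (\<forall>n. F n \<in> borel_measurable (bprod n))"

lemma emeas_iff: "emeas F \<longleftrightarrow> (\<forall>n>0. F n \<in> borel_measurable (lprod n))"
  using measurable_PiM_empty[of "F 0"] unfolding emeas_def measurable_PiM_lborel by (metis gr0I)

lemma decset_D:
  assumes "t \<in> decset i" "j < k" "k < i" shows "t k < t j" using assms(2,3)
proof (induction k)
  case (Suc k)
  have "t (Suc k) < t k" using assms(1) Suc.prems by (simp add: decset_def)
  with Suc show ?case by (cases "j = k") auto
qed simp

context compact_prob
begin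

text \<open>The density of \<open>m^{(l_1,...,l_i)}\<close>, and at the same time the squared norm
  of the product of the \<open>p_{l_k}\<close> under the product of copies of \<nu>.\<close>

definition cprod :: "nat list \<Rightarrow> real" where
  "cprod ls = (\<Prod>k<length ls. ccoef \<nu> (ls ! k + 1))"

lemma cprod_nonneg: "cprod ls \<ge> 0"
  unfolding cprod_def by (intro prod_nonneg ballI ccoef_nonneg)

text \<open>The squared norm of the restriction of \<open>f\<close> to the stratum
  \<open>T^{(l_1,...,l_i)}\<close>.\<close>

definition wt :: "nat list \<Rightarrow> ((nat \<Rightarrow> real) \<Rightarrow> real) \<Rightarrow> ennreal" where
  "wt ls f = ennreal (cprod ls) *
    (\<integral>\<^sup>+t. indicator (decset (length ls)) t * ennreal ((f (phi ls t))\<^sup>2) \<partial>lprod (length ls))"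

definition elev :: "nat \<Rightarrow> ((nat \<Rightarrow> real) \<Rightarrow> real) \<Rightarrow> ennreal" where
  "elev n f = (\<Sum>ls\<in>ecomps n. wt ls f)"

lemma wt_Nil: "wt [] f = ennreal ((f pt0)\<^sup>2)"
  by (simp add: wt_def cprod_def PiM_empty nn_integral_count_space_finite decset_def)

lemma m_int_elev: "m_int \<nu> (Suc n) (\<lambda>t. (f t)\<^sup>2) = elev (Suc n) f"
  by (simp add: m_int_def elev_def ecomps_Suc wt_def cprod_def)

lemma efock_norm2_elev: "enorm2 F = (\<Sum>n. elev n (F n))"
proof -
  have "(\<Sum>n. elev n (F n)) = (\<Sum>n. elev (Suc n) (F (Suc n))) + elev 0 (F 0)"
    using suminf_offset[of "\<lambda>n. elev n (F n)" 1] by simp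
  then show ?thesis by (simp add: efock_norm2_def m_int_elev elev_def ecomps_0 wt_Nil add.commute)
qed

lemma efock_emeas: "F \<in> EFock \<longleftrightarrow> emeas F \<and> enorm2 F < \<infinity>"
  by (simp add: efock_space_def emeas_iff)

lemma phi_compose:
  assumes "f \<in> borel_measurable (bprod (tot ls))"
  shows "(\<lambda>t. f (phi ls t)) \<in> borel_measurable (bprod (length ls))"
  using measurable_compose[OF measurable_phi assms] .

lemma elev_vlin:
  assumes "f \<in> borel_measurable (bprod n)" "g \<in> borel_measurable (bprod n)"
  shows "elev n (\<lambda>x. a * f x + b * g x) \<le> ennreal (2 * a\<^sup>2) * elev n f + ennreal (2 * b\<^sup>2) * elev n g"
proof -
  have "wt ls (\<lambda>x. a * f x + b * g x) \<le> ennreal (2 * a\<^sup>2) * wt ls f + ennreal (2 * b\<^sup>2) * wt ls g"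
    if "ls \<in> ecomps n" for ls
  proof -
    have n: "n = tot ls" using that by (simp add: ecomps_def)
    have "(\<integral>\<^sup>+t. indicator (decset (length ls)) t * ennreal ((a * f (phi ls t) +
        b * g (phi ls t))\<^sup>2) \<partial>lprod (length ls))
      \<le> ennreal (2 * a\<^sup>2) * (\<integral>\<^sup>+t. indicator (decset (length ls)) t *
          ennreal ((f (phi ls t))\<^sup>2) \<partial>lprod (length ls))
        + ennreal (2 * b\<^sup>2) * (\<integral>\<^sup>+t. indicator (decset (length ls)) t *
            ennreal ((g (phi ls t))\<^sup>2) \<partial>lprod (length ls))"
      using assms[unfolded n] 
      by (intro nn_integral_sq_lin; simp only: measurable_PiM_lborel indicator_decset phi_compose)
    from mult_left_mono[OF this, of "ennreal (cprod ls)"] show ?thesis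
      unfolding wt_def by (simp add: distrib_left mult.left_commute)
  qed
  then have "elev n (\<lambda>x. a * f x + b * g x) \<le>
      (\<Sum>ls\<in>ecomps n. ennreal (2 * a\<^sup>2) * wt ls f + ennreal (2 * b\<^sup>2) * wt ls g)"
    unfolding elev_def by (rule sum_mono)
  then show ?thesis by (simp add: elev_def sum.distrib sum_distrib_left)
qed

lemma efock_norm2_vlin:
  assumes "emeas F" "emeas G"
  shows "enorm2 (vlin a F b G) \<le> ennreal (2 * a\<^sup>2) * enorm2 F + ennreal (2 * b\<^sup>2) * enorm2 G"
proof -
  have "enorm2 (vlin a F b G) \<le> (\<Sum>n. ennreal (2 * a\<^sup>2) * elev n (F n) + ennreal (2 * b\<^sup>2) * elev n (G n))"
    unfolding efock_norm2_elev vlin_def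
    by (intro suminf_le elev_vlin) (use assms in \<open>auto simp: emeas_def\<close>)
  also have "\<dots> = ennreal (2 * a\<^sup>2) * enorm2 F + ennreal (2 * b\<^sup>2) * enorm2 G"
    unfolding efock_norm2_elev by (subst suminf_add[symmetric]) auto
  finally show ?thesis .
qed

lemma emeas_vlin: "emeas F \<Longrightarrow> emeas G \<Longrightarrow> emeas (vlin a F b G)"
  unfolding emeas_def vlin_def by (intro allI borel_measurable_add borel_measurable_times borel_measurable_const) auto

lemma efock_space_vlin:
  assumes "F \<in> EFock" "G \<in> EFock" shows "vlin a F b G \<in> EFock"
proof -
  have "enorm2 (vlin a F b G) < \<infinity>" by (rule le_less_trans[OF efock_norm2_vlin])
       (use assms in \<open>auto simp: efock_emeas ennreal_mult_less_top\<close>)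
  then show ?thesis using assms emeas_vlin by (auto simp: efock_emeas)
qed

text \<open>\<open>Uop N\<close> is the inverse of \<open>J\<close> on vectors of degree at most \<open>N\<close>. The summand of \<open>ls\<close> vanishes
  on such vectors as soon as \<open>tot ls > N\<close>, so bounding the entries of \<open>ls\<close> by \<open>N\<close> drops nothing.\<close>

definition Usum :: "nat list set \<Rightarrow> efockvec \<Rightarrow> nat \<Rightarrow> (nat \<Rightarrow> real \<times> real) \<Rightarrow> real" where
  "Usum A F i x = (\<Sum>ls\<in>A. F (tot ls) (phi ls (\<lambda>k. fst (x k))) * (\<Prod>k<i. poly (opl (ls ! k)) (snd (x k))))"

definition Uop :: "nat \<Rightarrow> efockvec \<Rightarrow> fockvec" where
  "Uop N F = (\<lambda>i. Usum (ulists N i) F i)"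

section \<open>Orthogonality of products of the \<open>p_l\<close>, and the isometry\<close>

definition ppr :: "nat list \<Rightarrow> (nat \<Rightarrow> real) \<Rightarrow> real" where
  "ppr ls s = (\<Prod>k<length ls. poly (opl (ls ! k)) (s k))"

text \<open>The integral factors into inner products of single polynomials, and one differing entry
  makes the whole product vanish.\<close>

lemma ppr_prod:
  assumes "length ls = i" "length ls' = i"
  shows "integrable (nuprod i) (\<lambda>s. ppr ls s * ppr ls' s)"
    and "(\<integral>s. ppr ls s * ppr ls' s \<partial>nuprod i) = (if ls = ls' then cprod ls else 0)"
proof -
  have ps: "product_sigma_finite (\<lambda>_::nat. \<nu>)"
    by (intro product_sigma_finite.intro sigma_finite_measure_axioms)
  have eq: "ppr ls s * ppr ls' s = (\<Prod>k<i. poly (opl (ls ! k) * opl (ls' ! k)) (s k))" for s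
    using assms by (simp add: ppr_def prod.distrib)
  show "integrable (nuprod i) (\<lambda>s. ppr ls s * ppr ls' s)"
    unfolding eq by (intro product_sigma_finite.product_integrable_prod[OF ps] finite_lessThan integrable_poly)
  have "(\<integral>s. ppr ls s * ppr ls' s \<partial>nuprod i) = (\<Prod>k<i. nu_ip \<nu> (opl (ls ! k)) (opl (ls' ! k)))"
    unfolding eq by (subst product_sigma_finite.product_integral_prod[OF ps]) (simp_all only: nu_ip_eq finite_lessThan integrable_poly)
  also have "\<dots> = (if ls = ls' then cprod ls else 0)"
  proof (cases "ls = ls'")
    case True
    then show ?thesis using assms by (simp add: cprod_def ccoef_Suc)
  next
    case False
    then obtain k where "k < i" "ls ! k \<noteq> ls' ! k" using assms by (metis nth_equalityI)
    then have "\<exists>k\<in>{..<i}. nu_ip \<nu> (opl (ls ! k)) (opl (ls' ! k)) = 0"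
      using opoly_orthogonal by auto
    then show ?thesis using False by (subst prod_zero) auto
  qed
  finally show "(\<integral>s. ppr ls s * ppr ls' s \<partial>nuprod i) = (if ls = ls' then cprod ls else 0)" .
qed

text \<open>Pythagoras for an orthogonal family. The coefficients \<open>a ls\<close> will be the
  values of the vector at fixed times.\<close>

lemma ppr_sum_sq:
  assumes A: "finite A" "\<And>ls. ls \<in> A \<Longrightarrow> length ls = i"
  shows "(\<integral>\<^sup>+s. ennreal ((\<Sum>ls\<in>A. a ls * ppr ls s)\<^sup>2) \<partial>nuprod i) =
      (\<Sum>ls\<in>A. ennreal (cprod ls) * ennreal ((a ls)\<^sup>2))"
proof -
  let ?M = "nuprod i"
  have eq: "(\<Sum>ls\<in>A. a ls * ppr ls s)\<^sup>2 =
      (\<Sum>ls\<in>A. \<Sum>ls'\<in>A. a ls * a ls' * (ppr ls s * ppr ls' s))" for s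
    by (simp add: power2_eq_square sum_product mult_ac)
  have int: "integrable ?M (\<lambda>s. \<Sum>ls\<in>A. \<Sum>ls'\<in>A. a ls * a ls' * (ppr ls s * ppr ls' s))"
    by (intro Bochner_Integration.integrable_sum integrable_mult_right ppr_prod(1) A)
  have "(\<integral>s. (\<Sum>ls\<in>A. \<Sum>ls'\<in>A. a ls * a ls' * (ppr ls s * ppr ls' s)) \<partial>?M)
      = (\<Sum>ls\<in>A. \<Sum>ls'\<in>A. a ls * a ls' * (\<integral>s. ppr ls s * ppr ls' s \<partial>?M))"
    using ppr_prod(1)[OF A(2) A(2)] by (simp add: Bochner_Integration.integral_sum)
  also have "\<dots> = (\<Sum>ls\<in>A. \<Sum>ls'\<in>A. (if ls = ls' then cprod ls * (a ls)\<^sup>2 else 0))"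
    using ppr_prod(2)[OF A(2) A(2)] by (intro sum.cong refl) (auto simp: power2_eq_square)
  also have "\<dots> = (\<Sum>ls\<in>A. cprod ls * (a ls)\<^sup>2)" using A(1) by simp
  finally have "(\<integral>s. (\<Sum>ls\<in>A. a ls * ppr ls s)\<^sup>2 \<partial>?M) =
      (\<Sum>ls\<in>A. cprod ls * (a ls)\<^sup>2)"
    unfolding eq .
  moreover have "(\<integral>\<^sup>+s. ennreal ((\<Sum>ls\<in>A. a ls * ppr ls s)\<^sup>2) \<partial>?M) =
      ennreal (\<integral>s. (\<Sum>ls\<in>A. a ls * ppr ls s)\<^sup>2 \<partial>?M)"
    by (rule nn_integral_eq_integral) (simp_all add: int[folded eq])
  ultimately show ?thesis by (simp add: cprod_nonneg ennreal_mult[symmetric] sum_ennreal)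
qed

lemma Usum_borel:
  assumes "emeas F" and A: "\<And>ls. ls \<in> A \<Longrightarrow> length ls = i"
  shows "Usum A F i \<in> borel_measurable (bprod i)"
proof -
  have fst: "(\<lambda>x. fst (x k)) \<in> borel_measurable (PiM {..<i} (\<lambda>_. borel :: (real \<times> real) measure))"
    and snd: "(\<lambda>x. snd (x k)) \<in> borel_measurable (PiM {..<i} (\<lambda>_. borel :: (real \<times> real) measure))"
    if "k < i" for k by (rule measurable_compose[where N = borel and f = "\<lambda>x. x k"];
        use that in \<open>simp add: borel_prod[symmetric]\<close>)+
  have "(\<lambda>x :: nat \<Rightarrow> real \<times> real. F (tot ls) (phi ls (\<lambda>k. fst (x k))) *
      (\<Prod>k<i. poly (opl (ls ! k)) (snd (x k))))
      \<in> borel_measurable (bprod i)" if "ls \<in> A" for ls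
  proof (intro borel_measurable_times borel_measurable_prod)
    have len: "length ls = i" using that by (rule A)
    have "(\<lambda>t. F (tot ls) (phi ls t)) \<in> borel_measurable (bprod i)"
      using phi_compose[of "F (tot ls)" ls] assms(1) by (simp add: emeas_def len)
    from measurable_compose[OF measurable_time_coords this]
    have "(\<lambda>x. F (tot ls) (phi ls (time_coords i x))) \<in> borel_measurable (bprod i)" .
    moreover have "phi ls (time_coords i x) = phi ls (\<lambda>k. fst (x k))" for x :: "nat \<Rightarrow> real \<times> real"
      by (rule phi_cong) (simp add: time_coords_def len)
    ultimately show "(\<lambda>x :: nat \<Rightarrow> real \<times> real. F (tot ls) (phi ls (\<lambda>k. fst (x k)))) \<in> borel_measurable (bprod i)"
      by simp
  next
    fix k assume "k \<in> {..<i}"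
    then show "(\<lambda>x :: nat \<Rightarrow> real \<times> real. poly (opl (ls ! k)) (snd (x k))) \<in>
        borel_measurable (bprod i)"
      by (intro measurable_compose[OF snd borel_measurable_poly]) simp
  qed
  then show ?thesis unfolding Usum_def by (intro borel_measurable_sum) auto
qed

lemma Uop_measurable: "emeas F \<Longrightarrow> Uop N F i \<in> borel_measurable (Sm i)"
  unfolding Uop_def by (rule measurable_Sn_borel[OF Usum_borel]) (simp_all add: ulists_def)

text \<open>The bridge between the weak ordering that defines \<open>S_n\<close> and the strictly
  decreasing block times over which \<open>m_int\<close> integrates.\<close>

lemma zip_coords_Sset:
  assumes "\<forall>j<n. \<forall>k<n. t j = t k \<longrightarrow> j = k"
  shows "t \<in> nonneg_upto n \<and> zip_coords n t s \<in> Sset n \<longleftrightarrow> t \<in> decset n"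
proof
  assume a: "t \<in> nonneg_upto n \<and> zip_coords n t s \<in> Sset n"
  have le: "t k \<le> t j" if "j \<le> k" "k < n" for j k
    using SsetD[of "zip_coords n t s" n j k] a that by (simp add: zip_coords_def)
  show "t \<in> decset n" unfolding decset_def
  proof (intro CollectI conjI allI impI)
    fix k assume "Suc k < n"
    then show "t (Suc k) < t k" using le[of k "Suc k"] assms[rule_format, of k "Suc k"] by force
  qed (use a in \<open>simp add: nonneg_upto_def\<close>)
next
  assume a: "t \<in> decset n"
  have le: "t k \<le> t j" if "j \<le> k" "k < n" for j k
    using decset_D[OF a, of j k] that by (cases "j = k") auto
  have "zip_coords n t s \<in> Sset n"
    by (rule SsetI) (use le in \<open>simp add: zip_coords_def\<close>)
  moreover have "0 \<le> t k" if "k < n" for k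
  proof -
    have "0 \<le> t (n - 1)" using a that by (auto simp: decset_def)
    also have "\<dots> \<le> t k" using le[of k "n - 1"] that by simp
    finally show ?thesis .
  qed
  ultimately show "t \<in> nonneg_upto n \<and> zip_coords n t s \<in> Sset n" by (simp add: nonneg_upto_def)
qed

text \<open>Times and marks are separated, then Pythagoras is applied in the marks for almost every
  time vector. A general finite \<open>A\<close> is allowed so that a single summand can be measured
  as well.\<close>

lemma lev_Usum:
  assumes F: "emeas F" and A: "finite A" "\<And>ls. ls \<in> A \<Longrightarrow> length ls = i"
  shows "lev i (Usum A F i) = (\<Sum>ls\<in>A. wt ls (F (tot ls)))"
proof -
  let ?L = "lprod i"
  let ?V = "nuprod i"
  have Fm: "(\<lambda>t. F (tot ls) (phi ls t)) \<in> borel_measurable (bprod i)" if "ls \<in> A" for ls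
    using phi_compose[of "F (tot ls)" ls] F A(2)[OF that] by (simp add: emeas_def)
  have Uz: "Usum A F i (zip_coords i t s) = (\<Sum>ls\<in>A. F (tot ls) (phi ls t) * ppr ls s)" for t s
    unfolding Usum_def
  proof (rule sum.cong[OF refl])
    fix ls assume "ls \<in> A"
    then have len: "length ls = i" by (rule A(2))
    have "phi ls (\<lambda>k. fst (zip_coords i t s k)) = phi ls t"
      by (rule phi_cong) (simp add: zip_coords_def len)
    then show "F (tot ls) (phi ls (\<lambda>k. fst (zip_coords i t s k))) *
        (\<Prod>k<i. poly (opl (ls ! k)) (snd (zip_coords i t s k)))
      = F (tot ls) (phi ls t) * ppr ls s" by (simp add: ppr_def len zip_coords_def)
  qed
  have meas: "(\<lambda>x. indicator (Sset i) x * ennreal ((Usum A F i x)\<^sup>2)) \<in> borel_measurable (bprod i)"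
    using Usum_borel[OF F A(2)] indicator_Sset_borel[of i] by measurable
  have "lev i (Usum A F i) = (\<integral>\<^sup>+t. (\<integral>\<^sup>+s. indicator (nonneg_upto i) t *
       (indicator (Sset i) (zip_coords i t s) * ennreal ((Usum A F i (zip_coords i t s))\<^sup>2)) \<partial>?V) \<partial>?L)"
    unfolding lev_def by (rule nn_integral_Sn[OF meas])
  also have "\<dots> = (\<integral>\<^sup>+t. indicator (decset i) t * (\<Sum>ls\<in>A. ennreal (cprod ls) *
      ennreal ((F (tot ls) (phi ls t))\<^sup>2)) \<partial>?L)"
  proof (rule nn_integral_cong_AE, use AE_lborel_distinct[of i] in eventually_elim)
    fix t :: "nat \<Rightarrow> real" assume d: "\<forall>j<i. \<forall>k<i. t j = t k \<longrightarrow> j = k"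
    have "indicator (nonneg_upto i) t * (indicator (Sset i) (zip_coords i t s) * z) =
        indicator (decset i) t * (z :: ennreal)" for s z
      using zip_coords_Sset[OF d, of s] by (auto simp: indicator_def)
    then have "(\<integral>\<^sup>+s. indicator (nonneg_upto i) t *
       (indicator (Sset i) (zip_coords i t s) * ennreal ((Usum A F i (zip_coords i t s))\<^sup>2)) \<partial>?V) =
       (\<integral>\<^sup>+s. indicator (decset i) t * ennreal ((\<Sum>ls\<in>A. F (tot ls) (phi ls t) *
           ppr ls s)\<^sup>2) \<partial>?V)"
      by (simp add: Uz)
    also have "\<dots> = indicator (decset i) t *
        (\<integral>\<^sup>+s. ennreal ((\<Sum>ls\<in>A. F (tot ls) (phi ls t) * ppr ls s)\<^sup>2) \<partial>?V)"
      by (auto simp: indicator_def)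
    also have "(\<integral>\<^sup>+s. ennreal ((\<Sum>ls\<in>A. F (tot ls) (phi ls t) * ppr ls s)\<^sup>2) \<partial>?V)
        = (\<Sum>ls\<in>A. ennreal (cprod ls) * ennreal ((F (tot ls) (phi ls t))\<^sup>2))"
      by (rule ppr_sum_sq[OF A])
    finally show "(\<integral>\<^sup>+s. indicator (nonneg_upto i) t *
       (indicator (Sset i) (zip_coords i t s) * ennreal ((Usum A F i (zip_coords i t s))\<^sup>2)) \<partial>?V) =
           indicator (decset i) t * (\<Sum>ls\<in>A. ennreal (cprod ls) * ennreal ((F (tot ls) (phi ls t))\<^sup>2))" .
  qed
  also have "\<dots> = (\<integral>\<^sup>+t. (\<Sum>ls\<in>A. ennreal (cprod ls) * (indicator (decset i) t *
      ennreal ((F (tot ls) (phi ls t))\<^sup>2))) \<partial>?L)"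
    by (simp add: sum_distrib_left mult.left_commute)
  also have "\<dots> = (\<Sum>ls\<in>A. \<integral>\<^sup>+t. ennreal (cprod ls) * (indicator (decset i) t *
      ennreal ((F (tot ls) (phi ls t))\<^sup>2)) \<partial>?L)"
  proof (rule nn_integral_sum)
    fix ls assume "ls \<in> A"
    from Fm[OF this] show "(\<lambda>t. ennreal (cprod ls) * (indicator (decset i) t *
        ennreal ((F (tot ls) (phi ls t))\<^sup>2))) \<in> borel_measurable ?L"
      using indicator_decset[of i] unfolding measurable_PiM_lborel by measurable
  qed
  also have "\<dots> = (\<Sum>ls\<in>A. wt ls (F (tot ls)))"
  proof (rule sum.cong[OF refl])
    fix ls assume ls: "ls \<in> A"
    have m: "(\<lambda>t. indicator (decset i) t * ennreal ((F (tot ls) (phi ls t))\<^sup>2)) \<in> borel_measurable ?L"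
      using Fm[OF ls] indicator_decset[of i] unfolding measurable_PiM_lborel by measurable
    show "(\<integral>\<^sup>+t. ennreal (cprod ls) * (indicator (decset i) t *
        ennreal ((F (tot ls) (phi ls t))\<^sup>2)) \<partial>?L) = wt ls (F (tot ls))"
      unfolding wt_def using A(2)[OF ls] by (subst nn_integral_cmult[OF m]) simp
  qed
  finally show ?thesis .
qed

lemma lev_Uop: "emeas F \<Longrightarrow> lev i (Uop N F i) = (\<Sum>ls\<in>ulists N i. wt ls (F (tot ls)))"
  unfolding Uop_def by (rule lev_Usum[OF _ finite_ulists]) (simp_all add: ulists_def)

lemma wt_zero [simp]: "wt ls (\<lambda>_. 0) = 0"
  by (simp add: wt_def)

lemma set_ulists: "tot ls \<le> N \<Longrightarrow> ls \<in> ulists N (length ls)"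
  using member_le_sum_list[of _ ls] by (fastforce simp: ulists_def)

text \<open>One finite family of strata is summed in two ways: by the length of the list, which is
  the Fock degree, and by its total, which is the degree in the extended space.\<close>

theorem Uop_isometry:
  assumes F: "emeas F" "esupp N F"
  shows "norm2 (Uop N F) = enorm2 F"
proof -
  let ?A = "{ls. tot ls \<le> N}" and ?w = "\<lambda>ls. wt ls (F (tot ls))"
  have zero: "?w ls = 0" if "tot ls > N" for ls using F(2) that by (simp add: esupp_def)
  have "lev i (Uop N F i) = sum ?w {ls\<in>?A. length ls = i}" for i unfolding lev_Uop[OF F(1)]
  proof (rule sum.mono_neutral_right[OF finite_ulists])
    show "{ls \<in> ?A. length ls = i} \<subseteq> ulists N i" using set_ulists by auto
    show "\<forall>ls\<in>ulists N i - {ls \<in> ?A. length ls = i}. ?w ls = 0"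
      by (intro ballI zero) (auto simp: ulists_def)
  qed
  then have "norm2 (Uop N F) = (\<Sum>i. sum ?w {ls\<in>?A. length ls = i})"
    by (simp add: fock_norm2_lev)
  also have "\<dots> = (\<Sum>i\<le>N. sum ?w {ls\<in>?A. length ls = i})"
    by (rule suminf_finite) (auto intro!: sum.neutral)
  also have "\<dots> = sum ?w ?A" by (rule sum.group) (auto simp: finite_tot_le)
  also have "\<dots> = (\<Sum>n\<le>N. sum ?w {ls\<in>?A. tot ls = n})"
    by (rule sum.group[symmetric]) (auto simp: finite_tot_le)
  also have "\<dots> = (\<Sum>n\<le>N. elev n (F n))"
    unfolding elev_def by (intro sum.cong refl) (auto simp: ecomps_def)
  also have "\<dots> = (\<Sum>n. elev n (F n))"
    using F(2) by (intro suminf_finite[symmetric]) (auto simp: elev_def esupp_def)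
  finally show ?thesis by (simp add: efock_norm2_elev)
qed

end

subsection \<open>Intertwining of the operators\<close>

lemma ulists_0 [simp]: "ulists N 0 = {[]}"
  by (auto simp: ulists_def)

lemma sum_ulists_Suc: "(\<Sum>ls\<in>ulists N (Suc i). f ls) = (\<Sum>ls\<in>ulists N i. \<Sum>l\<le>N. f (l # ls))"
proof -
  have "ulists N (Suc i) = (\<lambda>(ls, l). l # ls) ` (ulists N i \<times> {..N})"
    by (auto simp: ulists_def length_Suc_conv image_iff)
  moreover have "inj_on (\<lambda>(ls, l). l # ls) (ulists N i \<times> {..N})"
    by (auto simp: inj_on_def)
  ultimately show ?thesis by (simp add: sum.reindex sum.cartesian_product split_beta' o_def)
qed

lemma ulists_mono: "N \<le> M \<Longrightarrow> ulists N i \<subseteq> ulists M i"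
  by (auto simp: ulists_def)

text \<open>The two boundary terms disappear in the application, where \<open>E l = 0\<close> for \<open>l \<ge> M\<close>.\<close>

lemma three_term_sum:
  fixes E p a b A :: "nat \<Rightarrow> real"
  assumes rec: "\<And>l. s * p l = p (Suc l) + b l * p l + (if l = 0 then 0 else a l * p (l - 1))"
    and "p 0 = 1" "A 0 = D" "\<And>l. A (Suc l) = E l"
  shows "(\<Sum>l\<le>M. (A l + b l * E l + a (Suc l) * E (Suc l)) * p l) =
    D + (\<Sum>l\<le>M. s * E l * p l) - E M * p (Suc M) + a (Suc M) * E (Suc M) * p M"
proof (induction M)
  case 0
  then show ?case using rec[of 0] assms(2,3) by (simp add: algebra_simps)
next
  case (Suc M)
  have "s * E (Suc M) * p (Suc M) = E (Suc M) * (p (Suc (Suc M)) + b (Suc M) * p (Suc M) + a (Suc M) * p M)"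
    using rec[of "Suc M"] by (simp add: mult.commute mult.left_commute)
  then show ?case using Suc assms(4)[of M] by (simp add: algebra_simps)
qed

lemma esuppD: "esupp N F \<Longrightarrow> N < n \<Longrightarrow> F n t = 0"
  by (simp add: esupp_def)

lemma ABop_esupp: "esupp N F \<Longrightarrow> esupp (Suc N) (ABop \<nu> h F)"
  unfolding esupp_def by (auto simp: ABop_def fun_eq_iff)

lemma measurable_lfirst:
  assumes "n > 0"
  shows "lfirst n \<in> measurable (bprod n) (count_space UNIV)"
proof -
  have "(\<lambda>t :: nat \<Rightarrow> real. card {j. j < n \<and> t j = t 0}) \<in> measurable (bprod n) (count_space UNIV)"
  proof (rule measurable_card)
    fix j
    show "{t \<in> space (PiM {..<n} (\<lambda>_. borel :: real measure)). j \<in> {j. j < n \<and> t j =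
        t 0}} \<in> sets (bprod n)"
    proof (cases "j < n")
      case True
      have "(\<lambda>t. t j) \<in> borel_measurable (PiM {..<n} (\<lambda>_. borel :: real measure))"
        "(\<lambda>t. t 0) \<in> borel_measurable (PiM {..<n} (\<lambda>_. borel :: real measure))"
        using True assms by (auto intro!: measurable_component_singleton)
      then show ?thesis using True by (simp add: borel_measurable_eq)
    qed simp
  qed
  then show ?thesis unfolding lfirst_def
    by (rule measurable_compose[where g = "\<lambda>k. k - 1"]) simp
qed

lemma ABop_emeas:
  assumes F: "emeas F" and h: "h \<in> borel_measurable borel"
  shows "emeas (ABop \<nu> h F)" unfolding emeas_def
proof
  fix n
  show "ABop \<nu> h F n \<in> borel_measurable (bprod n)"
  proof (cases n)
    case 0
    then show ?thesis using measurable_PiM_empty by simp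
  next
    case (Suc m)
    let ?M = "PiM {..<n} (\<lambda>_. borel :: real measure)"
    have t0: "(\<lambda>t. t 0) \<in> borel_measurable ?M"
      by (rule measurable_component_singleton) (simp add: Suc)
    have ht: "(\<lambda>t. h (t 0)) \<in> borel_measurable ?M" by (rule measurable_compose[OF t0 h])
    have Fk: "F k \<in> borel_measurable (bprod k)" for k using F by (simp add: emeas_def)
    have 1: "(\<lambda>t. F m (ptail m t)) \<in> borel_measurable ?M"
      unfolding Suc by (rule measurable_compose[OF measurable_ptail Fk]) simp
    have b: "(\<lambda>t. bcoef \<nu> (lfirst n t)) \<in> borel_measurable ?M"
      by (rule measurable_compose[OF measurable_lfirst]) (simp_all add: Suc)
    have a: "(\<lambda>t. acoef \<nu> (Suc (lfirst n t))) \<in> borel_measurable ?M"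
      by (rule measurable_compose[OF measurable_lfirst]) (simp_all add: Suc)
    have 2: "(\<lambda>t. F (Suc n) (pcons n (t 0) t)) \<in> borel_measurable ?M"
      by (rule measurable_compose[OF measurable_pcons[OF t0] Fk]) simp
    have 3: "(\<lambda>t. \<integral>u. indicator {t 0..} u * h u * F (Suc n) (pcons n u t) \<partial>lborel) \<in>
        borel_measurable ?M"
    proof (rule lborel.borel_measurable_lebesgue_integral)
      have t0': "(\<lambda>z. fst z 0) \<in> borel_measurable (?M \<Otimes>\<^sub>M lborel)"
        by (rule measurable_compose[OF measurable_fst t0])
      have sn: "(\<lambda>z. snd z) \<in> borel_measurable (?M \<Otimes>\<^sub>M lborel)" by simp
      have i: "(\<lambda>z. indicator {fst z 0..} (snd z) :: real) \<in> borel_measurable (?M \<Otimes>\<^sub>M lborel)"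
      proof -
        have "(\<lambda>z. if fst z 0 \<le> snd z then 1 else 0 :: real) \<in> borel_measurable (?M \<Otimes>\<^sub>M lborel)"
          by (rule measurable_If[OF _ _ borel_measurable_le[OF t0' sn]]) simp_all
        then show ?thesis unfolding indicator_def of_bool_def atLeast_iff .
      qed
      have f: "(\<lambda>z. F (Suc n) (pcons n (snd z) (fst z))) \<in> borel_measurable (?M \<Otimes>\<^sub>M lborel)"
        by (rule measurable_compose[OF measurable_pcons[OF sn measurable_fst] Fk])
      show "(\<lambda>(t, u). indicator {t 0..} u * h u * F (Suc n) (pcons n u t)) \<in>
          borel_measurable (?M \<Otimes>\<^sub>M lborel)"
        unfolding split_beta' by (intro borel_measurable_times i f measurable_compose[OF sn h])
    qed
    have "ABop \<nu> h F n = (\<lambda>t. h (t 0) * F m (ptail m t)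
        + bcoef \<nu> (lfirst n t) * h (t 0) * F n t
        + (\<integral>u. indicator {t 0..} u * h u * F (Suc n) (pcons n u t) \<partial>lborel)
        + acoef \<nu> (Suc (lfirst n t)) * h (t 0) * F (Suc n) (pcons n (t 0) t))"
      by (simp add: ABop_def Suc)
    then show ?thesis
      using ht 1 2 3 a b Fk[of n] by (simp only:) (intro borel_measurable_add borel_measurable_times)
  qed
qed

context compact_prob
begin

lemma wt_le_efock:
  "wt ls (F (tot ls)) \<le> enorm2 F"
proof -
  have "wt ls (F (tot ls)) \<le> elev (tot ls) (F (tot ls))"
    unfolding elev_def by (rule member_le_sum) (auto simp: ecomps_def finite_ecomps[unfolded ecomps_def])
  also have "\<dots> \<le> enorm2 F"
    unfolding efock_norm2_elev using sum_le_suminf[of "\<lambda>n. elev n (F n)" "{tot ls}"] by simp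
  finally show ?thesis .
qed

text \<open>Independence of the degree bound, which lets vectors of different degrees be compared
  under one \<open>U\<close>.\<close>

lemma Uop_mono:
  assumes "esupp N F" "N \<le> M" shows "Uop N F = Uop M F"
proof (intro ext)
  fix i x
  show "Uop N F i x = Uop M F i x" unfolding Uop_def Usum_def
  proof (rule sum.mono_neutral_left[OF finite_ulists ulists_mono[OF assms(2)]], intro ballI)
    fix ls assume ls: "ls \<in> ulists M i - ulists N i"
    then obtain l where "l \<in> set ls" "l \<notin> {..N}" by (auto simp: ulists_def)
    then have "tot ls > N" using member_le_sum_list[of l ls] by simp
    then show "F (tot ls) (phi ls (\<lambda>k. fst (x k))) * (\<Prod>k<i. poly (opl (ls ! k)) (snd (x k))) = 0"
      using esuppD[OF assms(1)] by simp
  qed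
qed

lemma integral_M1_prod:
  assumes i: "integrable (M1 \<nu>) (\<lambda>p. f (fst p) * g (snd p))"
  shows "(\<integral>p. f (fst p) * g (snd p) \<partial>M1 \<nu>) =
      (\<integral>u. indicator {0..} u * f u \<partial>lborel) * (\<integral>v. g v \<partial>\<nu> :: real)"
proof -
  interpret A: sigma_finite_measure "restrict_space lborel {0::real..}"
    by (rule sigma_finite_measure_restrict_space[OF lborel.sigma_finite_measure_axioms]) auto
  interpret Q: pair_sigma_finite "restrict_space lborel {0::real..}" \<nu> ..
  have "(\<integral>p. f (fst p) * g (snd p) \<partial>M1 \<nu>) =
      (\<integral>u. (\<integral>v. f u * g v \<partial>\<nu>) \<partial>restrict_space lborel {0..})"
    using Q.integral_fst'[OF i[unfolded M1_def]] unfolding M1_def by simp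
  also have "\<dots> = (\<integral>u. f u \<partial>restrict_space lborel {0..}) * (\<integral>v. g v \<partial>\<nu>)"
    by simp
  also have "(\<integral>u. f u \<partial>restrict_space lborel {0..}) = (\<integral>u. indicator {0..} u * f u \<partial>lborel)"
    by (subst integral_restrict_space) auto
  finally show ?thesis .
qed

text \<open>The lower limit of the annihilation integral; it merges the degree 0 clause of
  \<open>ABop\<close> with the others.\<close>

definition lowt :: "nat \<Rightarrow> (nat \<Rightarrow> real \<times> real) \<Rightarrow> real" where
  "lowt i x = (if i = 0 then 0 else fst (x 0))"

text \<open>Integrating the sum term by term needs each summand to be integrable. It is for almost every \<open>x\<close>,
  because a single summand is itself a vector of the Fock space, of squared norm \<open>wt ls (F (tot ls))\<close>.\<close>

lemma aann_Uop:
  assumes h: "h \<in> B0" and F: "F \<in> EFock"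
  shows "AE x in Sm i. x \<in> Sset i \<longrightarrow> aann \<nu> h (Uop N F) i x =
    (\<Sum>ls\<in>ulists N i. (\<integral>u. indicator {lowt i x..} u * h u *
        F (Suc (tot ls)) (pcons (tot ls) u (phi ls (\<lambda>k. fst (x k)))) \<partial>lborel)
      * (\<Prod>k<i. poly (opl (ls ! k)) (snd (x k))))"
proof -
  have Fm: "emeas F" using F by (simp add: efock_emeas)
  define G where "G ls = (\<lambda>n. if n = Suc i then Usum {ls} F n else (\<lambda>_. 0))" for ls
  have G: "G ls \<in> Fock" if "ls \<in> ulists N (Suc i)" for ls
  proof -
    have len: "length ls = Suc i" using that by (simp add: ulists_def)
    have m: "G ls n \<in> borel_measurable (Sm n)" for n
      using measurable_Sn_borel[OF Usum_borel[OF Fm, of "{ls}" "Suc i"]] len by (simp add: G_def)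
    have "norm2 (G ls) = (\<Sum>n\<in>{Suc i}. lev n (G ls n))"
      unfolding fock_norm2_lev by (rule suminf_finite) (auto simp: G_def lev_def)
    also have "\<dots> = wt ls (F (tot ls))"
      using lev_Usum[OF Fm, of "{ls}" "Suc i"] len by (simp add: G_def)
    also have "\<dots> < \<infinity>" using wt_le_efock[of ls F] F by (auto simp: efock_emeas intro: le_less_trans)
    finally show ?thesis using m by (simp add: fock_space_def)
  qed
  have "AE x in Sm i. \<forall>ls\<in>ulists N (Suc i). x \<in> Sset i \<longrightarrow>
     integrable (M1 \<nu>) (\<lambda>p. ann_ind i x p * h (fst p) * G ls (Suc i) (pcons i p x))"
    by (rule AE_finite_allI[OF finite_ulists aann_integrable[OF h G]])
  then show ?thesis using AE_space[of "Sm i"]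
  proof eventually_elim
    case (elim x)
    show ?case
    proof
      assume x: "x \<in> Sset i"
      define ts where "ts = (\<lambda>k. fst (x k))"
      define Q where "Q ls = (\<Prod>k<i. poly (opl (ls ! k)) (snd (x k)))" for ls
      have ts0: "i = 0 \<or> ts 0 \<ge> 0"
        using elim(2) by (cases i) (auto simp: ts_def space_Sn PiE_def Pi_def)
      have Gl: "G (l # ls) (Suc i) (pcons i p x) =
          F (tot (l # ls)) (phi (l # ls) (pcons i (fst p) ts)) * poly (opl l) (snd p) * Q ls"
        if "ls \<in> ulists N i" for l ls p
      proof -
        have "length ls = i" using that by (simp add: ulists_def)
        then have "phi (l # ls) (\<lambda>k. fst (pcons i p x k)) = phi (l # ls) (pcons i (fst p) ts)"
          by (intro phi_cong) (auto simp: pcons_def ts_def)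
        then show ?thesis
          by (simp add: G_def Usum_def Q_def prod.lessThan_Suc_shift del: prod.lessThan_Suc)
      qed
      have int: "integrable (M1 \<nu>) (\<lambda>p. ann_ind i x p * h (fst p) * G (l # ls) (Suc i) (pcons i p x))"
        if "ls \<in> ulists N i" "l \<le> N" for l ls
        using elim(1) x that by (auto simp: ulists_def)
      \<comment> \<open>The integral of \<open>p_l\<close> against \<nu> is 1 for
        \<open>l = 0\<close> and 0 otherwise, so annihilation keeps only lists whose first block is
        a single time.\<close>
      have val: "(\<integral>p. ann_ind i x p * h (fst p) * G (l # ls) (Suc i) (pcons i p x) \<partial>M1 \<nu>) =
          (if l = 0 then (\<integral>u. indicator {lowt i x..} u * h u *
              F (Suc (tot ls)) (pcons (tot ls) u (phi ls ts)) \<partial>lborel) * Q ls else 0)"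
        if ls: "ls \<in> ulists N i" and l: "l \<le> N" for l ls
      proof -
        define f where "f u = indicator {u. i = 0 \<or> ts 0 \<le>
            u} u * h u * F (tot (l # ls)) (phi (l # ls) (pcons i u ts)) * Q ls" for u
        have eq: "ann_ind i x p * h (fst p) * G (l # ls) (Suc i) (pcons i p x) = f (fst p) * poly (opl l) (snd p)" for p
          unfolding Gl[OF ls] f_def ann_ind_def ts_def by (simp add: indicator_def)
        have "(\<integral>p. ann_ind i x p * h (fst p) * G (l # ls) (Suc i) (pcons i p x) \<partial>M1 \<nu>) =
           (\<integral>u. indicator {0..} u * f u \<partial>lborel) * (\<integral>v. poly (opl l) v \<partial>\<nu>)"
          using int[OF ls l] unfolding eq by (rule integral_M1_prod)
        moreover have "(\<integral>u. indicator {0..} u * f u \<partial>lborel) =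
            (\<integral>u. indicator {lowt i x..} u * h u *
                F (Suc (tot ls)) (pcons (tot ls) u (phi ls ts)) \<partial>lborel) * Q ls" if "l = 0"
        proof -
          have "length ls = i" using ls by (simp add: ulists_def)
          then have "phi (0 # ls) (pcons i u ts) = pcons (tot ls) u (phi ls ts)" for u
            using pcons_phi[of ls u ts] by simp
          moreover have "indicator {0..} u * indicator {u. i = 0 \<or> ts 0 \<le> u} u = (indicator {lowt i x..} u :: real)" for u
            using ts0 by (auto simp: indicator_def lowt_def ts_def)
          ultimately have "indicator {0..} u * f u =
              indicator {lowt i x..} u * h u * F (Suc (tot ls)) (pcons (tot ls) u (phi ls ts)) * Q ls" for u
            unfolding f_def that by (simp add: mult.assoc[symmetric])
          then show ?thesis by simp
        qed
        ultimately show ?thesis by (simp add: opoly_integral)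
      qed
      have "aann \<nu> h (Uop N F) i x =
          (\<integral>p. (\<Sum>ls\<in>ulists N i. \<Sum>l\<le>N. ann_ind i x p * h (fst p) *
              G (l # ls) (Suc i) (pcons i p x)) \<partial>M1 \<nu>)"
        unfolding aann_def ann_ind_def[symmetric] by (intro Bochner_Integration.integral_cong refl)
           (simp add: Uop_def Usum_def sum_ulists_Suc G_def sum_distrib_left)
      also have "\<dots> = (\<Sum>ls\<in>ulists N i. \<Sum>l\<le>N. \<integral>p. ann_ind i x p * h (fst p) *
          G (l # ls) (Suc i) (pcons i p x) \<partial>M1 \<nu>)"
      proof -
        have "(\<integral>p. (\<Sum>ls\<in>ulists N i. \<Sum>l\<le>N. ann_ind i x p * h (fst p) *
            G (l # ls) (Suc i) (pcons i p x)) \<partial>M1 \<nu>)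
          = (\<Sum>ls\<in>ulists N i. \<integral>p. (\<Sum>l\<le>N. ann_ind i x p * h (fst p) *
              G (l # ls) (Suc i) (pcons i p x)) \<partial>M1 \<nu>)"
          by (rule Bochner_Integration.integral_sum) (intro Bochner_Integration.integrable_sum int; simp)
        also have "\<dots> = (\<Sum>ls\<in>ulists N i. \<Sum>l\<le>N. \<integral>p. ann_ind i x p * h (fst p) *
            G (l # ls) (Suc i) (pcons i p x) \<partial>M1 \<nu>)"
          by (intro sum.cong refl Bochner_Integration.integral_sum int; simp)
        finally show ?thesis .
      qed
      also have "\<dots> = (\<Sum>ls\<in>ulists N i. (\<integral>u. indicator {lowt i x..} u * h u *
          F (Suc (tot ls)) (pcons (tot ls) u (phi ls ts)) \<partial>lborel) * Q ls)"
        by (intro sum.cong refl) (simp add: val)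
      finally show "aann \<nu> h (Uop N F) i x =
          (\<Sum>ls\<in>ulists N i. (\<integral>u. indicator {lowt i x..} u * h u *
              F (Suc (tot ls)) (pcons (tot ls) u (phi ls (\<lambda>k. fst (x k)))) \<partial>lborel)
        * (\<Prod>k<i. poly (opl (ls ! k)) (snd (x k))))" unfolding ts_def Q_def .
    qed
  qed
qed

text \<open>At almost every point the first mark multiplies \<open>p_l\<close> according to the
  recurrence; its three terms become creation inside the first block, \<open>B^0\<close> and the
  diagonal part of \<open>B^-\<close>. Fock creation contributes creation of a new block, Fock
  annihilation the integral part of \<open>B^-\<close>.\<close>

theorem omega_Uop:
  assumes h: "h \<in> B0" and F: "F \<in> EFock" and supp: "esupp N F"
  shows "feq (omega \<nu> h (Uop N F)) (Uop (Suc N) (ABop \<nu> h F))" unfolding feq_def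
proof
  fix i
  \<comment> \<open>One more than \<open>N\<close> because \<open>A^+\<close> raises the degree;
    moreover the boundary terms of \<open>three_term_sum\<close> then involve \<open>F\<close> only
    in degrees above \<open>N\<close>.\<close>
  let ?M = "Suc N"
  have UM: "Uop N F = Uop ?M F" by (rule Uop_mono[OF supp]) simp
  have "AE s in \<nu>. \<forall>l. s * poly (opl l) s = poly (opl (Suc l)) s + bcoef \<nu> l * poly (opl l) s
     + (if l = 0 then 0 else acoef \<nu> l * poly (opl (l - 1)) s)"
    unfolding AE_all_countable using opoly_recurrence by blast
  note rec = AE_Sn_snd[OF this, of i]
  show "AE x in Sm i. x \<in> Sset i \<longrightarrow> omega \<nu> h (Uop N F) i x = Uop ?M (ABop \<nu> h F) i x"
    using rec AE_Sn_time_coords[OF AE_lborel_distinct[of i]] aann_Uop[OF h F, of i ?M]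
  proof eventually_elim
    case (elim x)
    show ?case
    proof
      assume x: "x \<in> Sset i"
      define ts where "ts = (\<lambda>k. fst (x k))"
      define Q where "Q ls = (\<Prod>k<i. poly (opl (ls ! k)) (snd (x k)))" for ls
      note ann = elim(3)[rule_format, OF x, folded ts_def, folded Q_def]
      show "omega \<nu> h (Uop N F) i x = Uop ?M (ABop \<nu> h F) i x"
      proof (cases i)
        \<comment> \<open>Without marks there is nothing to create onto or to multiply: both sides
          reduce to the annihilation integral.\<close>
        case 0
        then show ?thesis using ann unfolding UM
          by (simp add: omega_def acre_def aneu_def Uop_def Usum_def ABop_def lowt_def Q_def pt0_def)
      next
        case (Suc j)
        define p where "p l = poly (opl l) (snd (x 0))" for l
        define R where "R ls = (\<Prod>k<j. poly (opl (ls ! k)) (snd (x (Suc k))))" for ls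
        \<comment> \<open>For fixed later blocks \<open>ls\<close>, \<open>E ls l\<close> is the
          coefficient of \<open>p l\<close>. \<open>D ls\<close> plays the part of index -1: the
          first block is missing, and creation opens it.\<close>
        define E where "E ls l = F (tot (l # ls)) (phi (l # ls) ts)" for ls l
        define D where "D ls = F (tot ls) (phi ls (\<lambda>k. ts (Suc k)))" for ls
        define I where "I ls = (\<integral>u. indicator {ts 0..} u * h u *
            F (Suc (tot ls)) (pcons (tot ls) u (phi ls ts)) \<partial>lborel)" for ls
        have QR: "Q (l # ls) = p l * R ls" for l ls
          by (simp add: Q_def p_def R_def Suc prod.lessThan_Suc_shift del: prod.lessThan_Suc)
        have dist: "ts k \<noteq> ts 0" if "0 < k" "k < i" for k
          using elim(2)[rule_format, of k 0] that by (auto simp: time_coords_def ts_def)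
        have AB: "ABop \<nu> h F (tot (l # ls)) (phi (l # ls) ts) =
            h (ts 0) * ((if l = 0 then D ls else E ls (l - 1)) + bcoef \<nu> l * E ls l +
                acoef \<nu> (Suc l) * E ls (Suc l)) + I (l # ls)"
          if ls: "ls \<in> ulists ?M j" for l ls
        proof -
          have lf: "lfirst (tot (l # ls)) (phi (l # ls) ts) = l"
            by (rule lfirst_phi) (use dist ls Suc in \<open>auto simp: ulists_def\<close>)
          have A: "F (tot (l # ls) - 1) (ptail (tot (l # ls) - 1) (phi (l # ls) ts)) = (if l = 0 then D ls else E ls (l - 1))"
          proof (cases l)
            case 0
            then show ?thesis using ptail_phi_0[of ls ts] by (simp add: D_def)
          next
            case (Suc l')
            then show ?thesis using ptail_phi_Suc[of l' ls ts] by (simp add: E_def)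
          qed
          have C: "F (Suc (tot (l # ls))) (pcons (tot (l # ls)) (ts 0) (phi (l # ls) ts)) = E ls (Suc l)"
            using pcons_phi_Suc[of l ls ts] by (simp add: E_def)
          have nz: "tot (l # ls) \<noteq> 0" by simp
          have "ABop \<nu> h F (tot (l # ls)) (phi (l # ls) ts) =
             h (ts 0) * F (tot (l # ls) - 1) (ptail (tot (l # ls) - 1) (phi (l # ls) ts))
              + bcoef \<nu> l * h (ts 0) * E ls l + I (l # ls) + acoef \<nu> (Suc l) * h (ts 0) * E ls (Suc l)"
            unfolding ABop_def if_not_P[OF nz] lf C phi_Cons_0 I_def E_def[symmetric] by (rule refl)
          then show ?thesis unfolding A by (simp add: algebra_simps)
        qed
        have sumE: "(\<Sum>l\<le>?M. ((if l =
            0 then D ls else E ls (l - 1)) + bcoef \<nu> l * E ls l + acoef \<nu> (Suc l) * E ls (Suc l)) * p l)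
            = D ls + (\<Sum>l\<le>?M. snd (x 0) * E ls l * p l)" for ls
        proof -
          have "snd (x 0) * p l = p (Suc l) + bcoef \<nu> l * p l + (if l = 0 then 0 else acoef \<nu> l * p (l - 1))" for l
            using elim(1) Suc by (simp add: p_def)
          from three_term_sum[OF this, of "\<lambda>l. if l = 0 then D ls else E ls (l - 1)" "D ls" "E ls" ?M]
          have "(\<Sum>l\<le>?M. ((if l = 0 then D ls else E ls (l - 1)) + bcoef \<nu> l * E ls l +
              acoef \<nu> (Suc l) * E ls (Suc l)) * p l)
            = D ls + (\<Sum>l\<le>?M. snd (x 0) * E ls l * p l) - E ls ?M * p (Suc ?M) +
                acoef \<nu> (Suc ?M) * E ls (Suc ?M) * p ?M"
            by (simp add: p_def)
          moreover have "E ls ?M = 0" "E ls (Suc ?M) = 0"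
            using esuppD[OF supp] by (simp_all add: E_def)
          ultimately show ?thesis by simp
        qed
        have acre: "acre h (Uop ?M F) i x = (\<Sum>ls\<in>ulists ?M j. h (ts 0) * D ls * R ls)"
        proof -
          have "F (tot ls) (phi ls (\<lambda>k. fst (ptail j x k))) *
              (\<Prod>k<j. poly (opl (ls ! k)) (snd (ptail j x k))) = D ls * R ls"
            if "ls \<in> ulists ?M j" for ls
          proof -
            have "phi ls (\<lambda>k. fst (ptail j x k)) = phi ls (\<lambda>k. ts (Suc k))"
              by (rule phi_cong) (use that in \<open>simp add: ulists_def ptail_def ts_def\<close>)
            then show ?thesis by (simp add: D_def R_def ptail_def)
          qed
          then show ?thesis
            by (simp add: acre_def Suc Uop_def Usum_def sum_distrib_left ts_def mult.assoc)
        qed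
        have aneu: "aneu h (Uop ?M F) i x =
            (\<Sum>ls\<in>ulists ?M j. h (ts 0) * (\<Sum>l\<le>?M. snd (x 0) * E ls l * p l) * R ls)"
        proof -
          have "Uop ?M F i x = (\<Sum>ls\<in>ulists ?M j. \<Sum>l\<le>?M. E ls l * (p l * R ls))"
            using QR unfolding Uop_def Usum_def Suc sum_ulists_Suc E_def ts_def Q_def Suc by simp
          then show ?thesis
            by (simp add: aneu_def Suc sum_distrib_left sum_distrib_right ts_def mult_ac del: sum.atMost_Suc)
        qed
        have "Uop ?M (ABop \<nu> h F) i x =
            (\<Sum>ls\<in>ulists ?M j. \<Sum>l\<le>?M. ABop \<nu> h F (tot (l # ls)) (phi (l # ls) ts) * Q (l # ls))"
          unfolding Uop_def Usum_def Suc sum_ulists_Suc ts_def Q_def Suc ..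
        also have "\<dots> = (\<Sum>ls\<in>ulists ?M j. h (ts 0) * (\<Sum>l\<le>?M. ((if l =
            0 then D ls else E ls (l - 1)) + bcoef \<nu> l * E ls l + acoef \<nu> (Suc l) * E ls (Suc l)) * p l) * R ls
             + (\<Sum>l\<le>?M. I (l # ls) * Q (l # ls)))"
        proof (rule sum.cong[OF refl])
          fix ls assume ls: "ls \<in> ulists ?M j"
          show "(\<Sum>l\<le>?M. ABop \<nu> h F (tot (l # ls)) (phi (l # ls) ts) * Q (l # ls)) =
             h (ts 0) * (\<Sum>l\<le>?M. ((if l =
                 0 then D ls else E ls (l - 1)) + bcoef \<nu> l * E ls l + acoef \<nu> (Suc l) * E ls (Suc l)) * p l) * R ls
             + (\<Sum>l\<le>?M. I (l # ls) * Q (l # ls))"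
            unfolding AB[OF ls] sum_distrib_left sum_distrib_right sum.distrib[symmetric]
            by (rule sum.cong[OF refl]) (simp add: QR algebra_simps)
        qed
        also have "\<dots> = (\<Sum>ls\<in>ulists ?M j. h (ts 0) * D ls * R ls) +
            (\<Sum>ls\<in>ulists ?M j. h (ts 0) * (\<Sum>l\<le>?M. snd (x 0) * E ls l * p l) * R ls)
            + (\<Sum>ls\<in>ulists ?M j. \<Sum>l\<le>?M. I (l # ls) * Q (l # ls))"
          unfolding sumE by (simp only: distrib_left distrib_right sum.distrib)
        also have "(\<Sum>ls\<in>ulists ?M j. \<Sum>l\<le>?M. I (l # ls) * Q (l # ls)) = aann \<nu> h (Uop ?M F) i x"
          unfolding ann unfolding Suc sum_ulists_Suc I_def by (simp add: lowt_def ts_def del: sum.atMost_Suc)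
        finally show ?thesis unfolding UM omega_def acre aneu by simp
      qed
    qed
  qed
qed

end

subsection \<open>Density of tensor products\<close>

text \<open>The \<open>+ 1\<close> in the denominator covers \<open>a = b = 0\<close> and supplies
  the strict inequality.\<close>

lemma vlin_small:
  assumes "x < ennreal (e / (2 * a\<^sup>2 + 2 * b\<^sup>2 + 1))" "y < ennreal (e / (2 * a\<^sup>2 + 2 * b\<^sup>2 + 1))" "0 < e"
  shows "ennreal (2 * a\<^sup>2) * x + ennreal (2 * b\<^sup>2) * y < ennreal e"
proof -
  define D where "D = 2 * a\<^sup>2 + 2 * b\<^sup>2 + 1"
  define d where "d = e / D"
  have D: "D > 0" by (simp add: D_def add_nonneg_pos)
  have d: "d > 0" using D assms(3) by (simp add: d_def)
  have "ennreal (2 * a\<^sup>2) * x + ennreal (2 * b\<^sup>2) * y \<le>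
      ennreal (2 * a\<^sup>2) * ennreal d + ennreal (2 * b\<^sup>2) * ennreal d"
    using assms(1,2) by (intro add_mono mult_left_mono) (auto simp: d_def D_def)
  also have "\<dots> = ennreal (2 * a\<^sup>2 * d + 2 * b\<^sup>2 * d)"
    using d by (simp add: ennreal_mult ennreal_plus)
  also have "\<dots> < ennreal e"
  proof (rule ennreal_lessI[OF assms(3)])
    have "e = D * d" using D by (simp add: d_def)
    also have "D * d = 2 * a\<^sup>2 * d + 2 * b\<^sup>2 * d + d" by (simp add: D_def algebra_simps)
    finally show "2 * a\<^sup>2 * d + 2 * b\<^sup>2 * d < e" using d by simp
  qed
  finally show ?thesis .
qed

text \<open>The span of pure tensors of degree \<open>n\<close>, generated one summand at a time to
  obtain an induction rule.\<close>

inductive_set tspan :: "nat \<Rightarrow> ((nat \<Rightarrow> real) \<Rightarrow> real) set" for n where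
  zero: "(\<lambda>_. 0) \<in> tspan n"
| step: "T \<in> tspan n \<Longrightarrow> length hs =
    n \<Longrightarrow> set hs \<subseteq> B0 \<Longrightarrow> (\<lambda>t. T t + c * tens hs n t) \<in> tspan n"

lemma tspan_lin:
  assumes "T \<in> tspan n" "S \<in> tspan n" shows "(\<lambda>t. a * T t + b * S t) \<in> tspan n"
  using assms(2)
proof induction
  case zero
  show ?case using assms(1)
  proof induction
    case (step T hs c)
    from tspan.step[OF step(4,2,3), of "a * c"] show ?case by (simp add: algebra_simps)
  qed (simp add: tspan.zero)
next
  case (step S hs c)
  from tspan.step[OF step(4,2,3), of "b * c"] show ?case by (simp add: algebra_simps)
qed

lemma tens_meas:
  assumes "set hs \<subseteq> B0" shows "emeas (tens hs)" unfolding emeas_def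
proof
  fix n
  show "tens hs n \<in> borel_measurable (bprod n)"
  proof (cases "n = length hs")
    case True
    have "(\<lambda>t. (hs ! j) (t j)) \<in> borel_measurable (bprod n)" if "j < n" for j
    proof -
      have "hs ! j \<in> B0" using assms nth_mem[of j hs] that True by blast
      then have "hs ! j \<in> borel_measurable borel" by (simp add: B0_def)
      from measurable_compose[OF _ this, of "\<lambda>t. t j"] show ?thesis using that by simp
    qed
    then show ?thesis unfolding tens_def using True by (simp add: borel_measurable_prod)
  qed (simp add: tens_def)
qed

lemma tspan_meas: "T \<in> tspan n \<Longrightarrow> T \<in> borel_measurable (bprod n)"
proof (induction rule: tspan.induct)
  case (step T hs c)
  then have "tens hs n \<in> borel_measurable (bprod n)"
    using tens_meas[of hs] by (simp add: emeas_def)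
  with step(4) show ?case by (intro borel_measurable_add borel_measurable_times borel_measurable_const)
qed simp

lemma phi_extensional: "phi ls t \<in> extensional {..<tot ls}"
  by (simp add: extensional_def phi_undefined)

lemma tens_Cons: "tens (h # hs) (Suc (length hs)) t = h (t 0) * tens hs (length hs) (ptail (length hs) t)"
  by (simp add: tens_def prod.lessThan_Suc_shift ptail_def del: prod.lessThan_Suc)

lemma emeas_eOmega: "emeas eOmega"
  by (simp add: emeas_def eOmega_def)

definition single :: "nat \<Rightarrow> ((nat \<Rightarrow> real) \<Rightarrow> real) \<Rightarrow> efockvec" where
  "single n f = (\<lambda>k. if k = n then f else (\<lambda>_. 0))"

lemma single_emeas: "f \<in> borel_measurable (bprod n) \<Longrightarrow> emeas (single n f)"
  by (simp add: emeas_def single_def)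

context compact_prob
begin

text \<open>Only extensional points are values of \<open>phi\<close>. Identities between tensor
  products and indicators of boxes hold just there.\<close>

lemma elev_cong:
  assumes "\<And>t. t \<in> extensional {..<n} \<Longrightarrow> f t = g t" shows "elev n f = elev n g"
  unfolding elev_def
proof (rule sum.cong[OF refl])
  fix ls assume "ls \<in> ecomps n"
  then have "f (phi ls t) = g (phi ls t)" for t
    using assms phi_extensional[of ls t] by (simp add: ecomps_def)
  then show "wt ls f = wt ls g" by (simp add: wt_def)
qed

lemma elev_zero [simp]: "elev n (\<lambda>_. 0) = 0"
  by (simp add: elev_def)

lemma elev_le_efock: "elev n (F n) \<le> enorm2 F"
  unfolding efock_norm2_elev using sum_le_suminf[of "\<lambda>n. elev n (F n)" "{n}"] by simp

lemma efock_single: "enorm2 (single n f) = elev n f"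
proof -
  have "enorm2 (single n f) = (\<Sum>k\<in>{n}. elev k (single n f k))"
    unfolding efock_norm2_elev by (rule suminf_finite) (auto simp: single_def)
  then show ?thesis by (simp add: single_def)
qed

text \<open>The boundedness of \<open>ABop\<close> is not estimated directly but inherited from that of \<open>omega\<close>.\<close>

lemma ABop_efock:
  assumes h: "h \<in> B0" and F: "F \<in> EFock" "esupp N F"
  shows "ABop \<nu> h F \<in> EFock"
proof -
  have Fm: "emeas F" using F by (simp add: efock_emeas)
  have m: "emeas (ABop \<nu> h F)" by (rule ABop_emeas[OF Fm B0_measurable[OF h]])
  have "Uop N F \<in> Fock" using Uop_isometry[OF Fm F(2)] F(1) Uop_measurable[OF Fm]
    by (simp add: fock_space_def efock_emeas)
  then have "norm2 (omega \<nu> h (Uop N F)) < \<infinity>"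
    using omega_space[OF h] by (simp add: fock_space_def)
  also have "norm2 (omega \<nu> h (Uop N F)) = enorm2 (ABop \<nu> h F)"
    using feq_norm2[OF omega_Uop[OF h F]] Uop_isometry[OF m ABop_esupp[OF F(2)]] by simp
  finally show ?thesis using m by (simp add: efock_emeas)
qed

text \<open>The counterpart of \<open>mono_vec\<close> in the extended space, built with the
  operator that \<open>J\<close> is to produce.\<close>

definition Evec :: "(real \<Rightarrow> real) list \<Rightarrow> efockvec" where
  "Evec hs = foldr (ABop \<nu>) hs eOmega"

lemma eOmega_efock: "eOmega \<in> EFock"
proof -
  have "enorm2 eOmega = (\<Sum>k\<in>{0}. elev k (eOmega k))"
    unfolding efock_norm2_elev by (rule suminf_finite) (auto simp: eOmega_def)
  then show ?thesis using emeas_eOmega by (simp add: efock_emeas elev_def ecomps_0 wt_Nil)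
qed

lemma esupp_eOmega: "esupp 0 eOmega"
  by (auto simp: esupp_def eOmega_def)

lemma Evec_efock: "set hs \<subseteq> B0 \<Longrightarrow> Evec hs \<in> EFock \<and> esupp (length hs) (Evec hs)"
proof (induction hs)
  case (Cons h hs)
  then have "h \<in> B0" "Evec hs \<in> EFock" "esupp (length hs) (Evec hs)" by auto
  from ABop_efock[OF this] ABop_esupp[OF this(3)] show ?case by (simp add: Evec_def)
qed (simp add: Evec_def eOmega_efock esupp_eOmega)

text \<open>Only \<open>A^+\<close> raises the degree, so the top component sees creation
  alone.\<close>

lemma Evec_top: "set hs \<subseteq> B0 \<Longrightarrow> Evec hs (length hs) = tens hs (length hs)"
proof (induction hs)
  case Nil
  show ?case by (simp add: Evec_def eOmega_def tens_def)
next
  case (Cons h hs)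
  then have s: "esupp (length hs) (Evec hs)" and IH: "Evec hs (length hs) = tens hs (length hs)"
    using Evec_efock by auto
  show ?case
  proof
    fix t
    have "Evec (h # hs) (length (h # hs)) t = h (t 0) * Evec hs (length hs) (ptail (length hs) t)"
      using esuppD[OF s] by (simp add: Evec_def ABop_def)
    then show "Evec (h # hs) (length (h # hs)) t = tens (h # hs) (length (h # hs)) t"
      using tens_Cons[of h hs t] by (simp add: IH)
  qed
qed

text \<open>No computation with \<open>m_n\<close>: the tensor is the top component of
  \<open>Evec hs\<close>, whose norm is already known to be finite.\<close>

lemma elev_tens_finite: "set hs \<subseteq> B0 \<Longrightarrow> length hs = n \<Longrightarrow> elev n (tens hs n) < \<infinity>"
  using elev_le_efock[of n "Evec hs"] Evec_top[of hs] Evec_efock[of hs]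
  by (auto simp: efock_emeas intro: le_less_trans)

text \<open>Dominated convergence on each of the finitely many strata of degree
  \<open>n\<close>.\<close>

lemma elev_DCT:
  assumes f: "\<And>k. f k \<in> borel_measurable (bprod n)" "g \<in> borel_measurable (bprod n)"
    and w: "w \<in> borel_measurable (bprod n)" "elev n w < \<infinity>"
    and bound: "\<And>k t. t \<in> extensional {..<n} \<Longrightarrow> (g t - f k t)\<^sup>2 \<le> (w t)\<^sup>2"
    and lim: "\<And>t. t \<in> extensional {..<n} \<Longrightarrow> (\<lambda>k. f k t) \<longlonglongrightarrow> g t"
  shows "(\<lambda>k. elev n (\<lambda>t. g t - f k t)) \<longlonglongrightarrow> 0"
proof -
  have "(\<lambda>k. wt ls (\<lambda>t. g t - f k t)) \<longlonglongrightarrow> 0" if ls: "ls \<in> ecomps n" for ls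
  proof (cases "cprod ls = 0")
    \<comment> \<open>With weight 0 a finite \<open>wt\<close> says nothing about the integral of
      the dominating function, but such a stratum contributes 0 anyway.\<close>
    case True
    then show ?thesis by (simp add: wt_def)
  next
    case False
    then have cp: "cprod ls > 0" using cprod_nonneg[of ls] by simp
    have n: "n = tot ls" using ls by (simp add: ecomps_def)
    let ?L = "lprod (length ls)"
    have ind: "(\<lambda>t. indicator (decset (length ls)) t :: real) \<in> borel_measurable ?L"
      unfolding indicator_def measurable_PiM_lborel using measurable_decset[of "length ls"] by measurable
    have comp: "(\<lambda>t. u (phi ls t)) \<in> borel_measurable ?L" if "u \<in>
        borel_measurable (bprod n)" for u :: "(nat \<Rightarrow> real) \<Rightarrow> real"
      unfolding measurable_PiM_lborel by (rule phi_compose) (use that n in simp)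
    have meas: "(\<lambda>t. indicator (decset (length ls)) t * (g (phi ls t) - f k (phi ls t))\<^sup>2) \<in>
        borel_measurable ?L" for k
      by (intro borel_measurable_times ind borel_measurable_power borel_measurable_diff comp f)
    have wm: "(\<lambda>t. indicator (decset (length ls)) t * (w (phi ls t))\<^sup>2) \<in> borel_measurable ?L"
      by (intro borel_measurable_times ind borel_measurable_power comp w)
    have fin: "(\<integral>\<^sup>+t. ennreal (indicator (decset (length ls)) t *
        (w (phi ls t))\<^sup>2) \<partial>?L) < \<infinity>"
    proof -
      have "wt ls w \<le> elev n w"
        unfolding elev_def by (rule member_le_sum[OF ls]) (auto simp: finite_ecomps)
      also note w(2)
      finally have "ennreal (cprod ls) * (\<integral>\<^sup>+t. indicator (decset (length ls)) t *
          ennreal ((w (phi ls t))\<^sup>2) \<partial>?L) < \<infinity>"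
        by (simp add: wt_def)
      then have "(\<integral>\<^sup>+t. indicator (decset (length ls)) t *
          ennreal ((w (phi ls t))\<^sup>2) \<partial>?L) < \<infinity>"
        using cp by (auto simp: ennreal_mult_less_top)
      moreover have "ennreal (indicator (decset (length ls)) t * (w (phi ls t))\<^sup>2) =
          indicator (decset (length ls)) t * ennreal ((w (phi ls t))\<^sup>2)" for t
        by (simp add: indicator_def)
      ultimately show ?thesis by simp
    qed
    have ext: "phi ls t \<in> extensional {..<n}" for t using phi_extensional[of ls t] n by simp
    have "(\<lambda>k. \<integral>\<^sup>+t. ennreal (norm (0 - indicator (decset (length ls)) t *
        (g (phi ls t) - f k (phi ls t))\<^sup>2)) \<partial>?L) \<longlonglongrightarrow> 0"
    proof (rule nn_integral_dominated_convergence_norm[OF meas _ wm _ fin])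
      show "AE t in ?L. norm (indicator (decset (length ls)) t * (g (phi ls t) - f k (phi ls t))\<^sup>2)
          \<le> indicator (decset (length ls)) t * (w (phi ls t))\<^sup>2" for k
        using bound[OF ext] by (intro AE_I2) (simp add: indicator_def)
      show "AE t in ?L. (\<lambda>k. indicator (decset (length ls)) t *
          (g (phi ls t) - f k (phi ls t))\<^sup>2) \<longlonglongrightarrow> 0"
      proof (rule AE_I2)
        fix t
        have "(\<lambda>k. indicator (decset (length ls)) t * (g (phi ls t) - f k (phi ls t))\<^sup>2) \<longlonglongrightarrow>
           indicator (decset (length ls)) t * (g (phi ls t) - g (phi ls t))\<^sup>2"
          by (intro tendsto_intros lim ext)
        then show "(\<lambda>k. indicator (decset (length ls)) t *
            (g (phi ls t) - f k (phi ls t))\<^sup>2) \<longlonglongrightarrow> 0" by simp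
      qed
    qed simp
    moreover have "ennreal (norm (0 - indicator (decset (length ls)) t * (g (phi ls t) - f k (phi ls t))\<^sup>2))
       = indicator (decset (length ls)) t * ennreal ((g (phi ls t) - f k (phi ls t))\<^sup>2)" for t k
      by (simp add: indicator_def)
    ultimately have "(\<lambda>k. \<integral>\<^sup>+t. indicator (decset (length ls)) t *
        ennreal ((g (phi ls t) - f k (phi ls t))\<^sup>2) \<partial>?L) \<longlonglongrightarrow> 0"
      by simp
    from ennreal_tendsto_cmult[OF _ this, of "ennreal (cprod ls)"] show ?thesis
      by (simp add: wt_def)
  qed
  then have "(\<lambda>k. \<Sum>ls\<in>ecomps n. wt ls (\<lambda>t. g t - f k t)) \<longlonglongrightarrow> (\<Sum>ls\<in>ecomps n. 0)"
    by (rule tendsto_sum)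
  then show ?thesis by (simp add: elev_def)
qed

section \<open>Functions approximable by tensor products\<close>

definition tapprox :: "nat \<Rightarrow> ((nat \<Rightarrow> real) \<Rightarrow> real) \<Rightarrow> bool" where
  "tapprox n f \<longleftrightarrow> f \<in> borel_measurable (bprod n) \<and>
     (\<forall>e>0::real. \<exists>T\<in>tspan n. elev n (\<lambda>t. f t - T t) < ennreal e)"

lemma elev_triangle:
  assumes "f \<in> borel_measurable (bprod n)" "g \<in> borel_measurable (bprod n)"
    "k \<in> borel_measurable (bprod n)"
  shows "elev n (\<lambda>t. f t - k t) \<le> 2 * elev n (\<lambda>t. f t - g t) + 2 * elev n (\<lambda>t. g t - k t)"
  using elev_vlin[of "\<lambda>t. f t - g t" n "\<lambda>t. g t - k t" 1 1] assms by (simp add: borel_measurable_diff)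

lemma ennreal_4: "0 < e \<Longrightarrow> 2 * ennreal (e / 4) + 2 * ennreal (e / 4) = ennreal e"
proof -
  assume "0 < e"
  have "2 * ennreal (e / 4) = ennreal (2 * (e / 4))" using \<open>0 < e\<close> by (subst ennreal_mult) auto
  then show ?thesis using \<open>0 < e\<close> by (simp add: ennreal_plus[symmetric] del: ennreal_plus)
qed

lemma two_small:
  assumes "x < ennreal (e / 4)" "y < ennreal (e / 4)" "0 < e" shows "2 * x + 2 * y < ennreal e"
proof -
  have "2 * x < 2 * ennreal (e / 4)" "2 * y < 2 * ennreal (e / 4)"
    using assms by (simp_all add: ennreal_mult_strict_left_mono)
  then show ?thesis using ennreal_4[OF assms(3)] by (metis add_strict_mono)
qed

lemma tapprox_closed:
  assumes f: "f \<in> borel_measurable (bprod n)"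
    and g: "\<And>e::real. e > 0 \<Longrightarrow> \<exists>g. tapprox n g \<and> elev n (\<lambda>t. f t - g t) < ennreal e"
  shows "tapprox n f" unfolding tapprox_def
proof (intro conjI f allI impI)
  fix e :: real assume e: "e > 0"
  then obtain g where g': "tapprox n g" "elev n (\<lambda>t. f t - g t) < ennreal (e / 4)"
    using g[of "e / 4"] by auto
  then obtain T where T: "T \<in> tspan n" "elev n (\<lambda>t. g t - T t) < ennreal (e / 4)"
    using e unfolding tapprox_def by (meson divide_pos_pos zero_less_numeral)
  have "elev n (\<lambda>t. f t - T t) \<le> 2 * elev n (\<lambda>t. f t - g t) + 2 * elev n (\<lambda>t. g t - T t)"
    by (rule elev_triangle) (use f g' T in \<open>auto simp: tapprox_def tspan_meas\<close>)
  also have "\<dots> < ennreal e" by (rule two_small) (use g' T e in auto)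
  finally show "\<exists>T\<in>tspan n. elev n (\<lambda>t. f t - T t) < ennreal e" using T by blast
qed

lemma tapprox_tspan: "T \<in> tspan n \<Longrightarrow> tapprox n T"
  unfolding tapprox_def by (auto intro!: tspan_meas bexI[of _ T])

lemma tapprox_lin:
  assumes f: "tapprox n f" and g: "tapprox n g" shows "tapprox n (\<lambda>t. a * f t + b * g t)"
  unfolding tapprox_def
proof (intro conjI allI impI)
  show "(\<lambda>t. a * f t + b * g t) \<in> borel_measurable (bprod n)"
    using f g by (auto simp: tapprox_def)
  fix e :: real assume e: "e > 0"
  define d where "d = e / (2 * a\<^sup>2 + 2 * b\<^sup>2 + 1)"
  have "d > 0" using e by (simp add: d_def add_nonneg_pos)
  with f g obtain T S where TS: "T \<in> tspan n" "elev n (\<lambda>t. f t - T t) < ennreal d"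
    "S \<in> tspan n" "elev n (\<lambda>t. g t - S t) < ennreal d" unfolding tapprox_def by meson
  have "elev n (\<lambda>t. a * (f t - T t) + b * (g t - S t)) \<le>
      ennreal (2 * a\<^sup>2) * elev n (\<lambda>t. f t - T t) + ennreal (2 * b\<^sup>2) * elev n (\<lambda>t. g t - S t)"
    using f g by (intro elev_vlin borel_measurable_diff tspan_meas[OF TS(1)] tspan_meas[OF TS(3)]) (simp_all add: tapprox_def)
  also have "\<dots> < ennreal e" by (rule vlin_small[OF TS(2)[unfolded d_def] TS(4)[unfolded d_def] e])
  finally have "elev n (\<lambda>t. (a * f t + b * g t) - (a * T t + b * S t)) < ennreal e" by (simp add: algebra_simps)
  then show "\<exists>T\<in>tspan n. elev n (\<lambda>t. a * f t + b * g t - T t) < ennreal e"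
    using tspan_lin[OF TS(1,3), of a b] by (intro bexI[of _ "\<lambda>t. a * T t + b * S t"])
qed

lemma tapprox_sum:
  assumes "finite A" "\<And>i. i \<in> A \<Longrightarrow>
      tapprox n (f i)" shows "tapprox n (\<lambda>t. \<Sum>i\<in>A. c i * f i t)"
  using assms
proof (induction A rule: finite_induct)
  case empty
  show ?case using tapprox_tspan[OF tspan.zero] by simp
next
  case (insert x A)
  have "tapprox n (\<lambda>t. c x * f x t + 1 * (\<Sum>i\<in>A. c i * f i t))"
    by (rule tapprox_lin) (use insert in auto)
  then show ?case using insert by simp
qed

lemma tapprox_cong:
  assumes f: "tapprox n f" and eq: "\<And>t. t \<in> extensional {..<n} \<Longrightarrow> f t = g t"
  shows "tapprox n g"
proof -
  have "f \<in> borel_measurable (bprod n) \<longleftrightarrow> g \<in> borel_measurable (bprod n)"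
    by (rule measurable_cong) (use eq in \<open>simp add: space_PiM PiE_def\<close>)
  moreover have "elev n (\<lambda>t. f t - T t) = elev n (\<lambda>t. g t - T t)" for T
    by (rule elev_cong) (simp add: eq)
  ultimately show ?thesis using f by (simp add: tapprox_def)
qed

lemma tapprox_lim:
  assumes "\<And>k. tapprox n (f k)" "g \<in> borel_measurable (bprod n)"
    and "(\<lambda>k. elev n (\<lambda>t. g t - f k t)) \<longlonglongrightarrow> 0"
  shows "tapprox n g"
proof (rule tapprox_closed[OF assms(2)])
  fix e :: real assume "e > 0"
  then have "eventually (\<lambda>k. elev n (\<lambda>t. g t - f k t) < ennreal e) sequentially"
    using order_tendstoD(2)[OF assms(3), of "ennreal e"] by simp
  then obtain k where "elev n (\<lambda>t. g t - f k t) < ennreal e"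
    by (auto simp: eventually_sequentially)
  then show "\<exists>g'. tapprox n g' \<and> elev n (\<lambda>t. g t - g' t) < ennreal e" using assms(1) by blast
qed

text \<open>No lower bound on \<open>t j\<close>: functions in \<open>B0\<close> need not vanish at large negative arguments.\<close>

definition ebox :: "nat \<Rightarrow> real \<Rightarrow> (nat \<Rightarrow> real) set" where
  "ebox n K = {t. \<forall>j<n. t j \<le> K}"

lemma indicator_box_tens:
  assumes "\<And>j. j < n \<Longrightarrow> X j \<in> sets borel" 
  obtains hs where "length hs = n" "set hs \<subseteq> B0"
    "\<And>t. t \<in> extensional {..<n} \<Longrightarrow> tens hs n t = indicator (Pi\<^sub>E {..<n} X \<inter> ebox n K) t"
proof
  define hs where "hs = map (\<lambda>j. indicator (X j \<inter> {..K}) :: real \<Rightarrow> real) [0..<n]"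
  show "length hs = n" by (simp add: hs_def)
  show "set hs \<subseteq> B0"
  proof
    fix h assume "h \<in> set hs"
    then obtain j where j: "j < n" "h = indicator (X j \<inter> {..K})" by (auto simp: hs_def)
    have "X j \<inter> {..K} \<in> sets borel" using assms[OF j(1)] by auto
    then have "h \<in> borel_measurable borel" unfolding j(2) by (rule borel_measurable_indicator)
    moreover have "\<forall>t. \<bar>h t\<bar> \<le> 1" "\<forall>t. t > K \<longrightarrow> h t = 0"
        by (auto simp: j(2) indicator_def)
    ultimately show "h \<in> B0" unfolding B0_def by blast
  qed
  fix t :: "nat \<Rightarrow> real" assume t: "t \<in> extensional {..<n}"
  have "tens hs n t = (\<Prod>j<n. indicator (X j \<inter> {..K}) (t j))"
    by (simp add: tens_def hs_def)
  also have "\<dots> = indicator (Pi\<^sub>E {..<n} X \<inter> ebox n K) t"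
  proof (cases "\<forall>j<n. t j \<in> X j \<inter> {..K}")
    case True
    then have "t \<in> Pi\<^sub>E {..<n} X \<inter> ebox n K" using t by (auto simp: PiE_iff ebox_def)
    then show ?thesis using True by simp
  next
    case False
    then obtain j where "j < n" "t j \<notin> X j \<inter> {..K}" by blast
    then have "(\<Prod>j<n. indicator (X j \<inter> {..K}) (t j) :: real) = 0"
      by (intro prod_zero bexI[of _ j]) (auto simp: indicator_def)
    moreover have "t \<notin> Pi\<^sub>E {..<n} X \<inter> ebox n K"
      using \<open>j < n\<close> \<open>t j \<notin> X j \<inter> {..K}\<close> by (auto simp: PiE_iff ebox_def)
    ultimately show ?thesis by simp
  qed
  finally show "tens hs n t = indicator (Pi\<^sub>E {..<n} X \<inter> ebox n K) t" .
qed

lemma tapprox_box: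
  assumes "\<And>j. j < n \<Longrightarrow> X j \<in> sets borel"
  shows "tapprox n (indicator (Pi\<^sub>E {..<n} X \<inter> ebox n K))" "elev n (indicator (Pi\<^sub>E {..<n} X \<inter> ebox n K)) < \<infinity>"
proof -
  obtain hs where hs: "length hs = n" "set hs \<subseteq> B0"
    "\<And>t. t \<in> extensional {..<n} \<Longrightarrow> tens hs n t = indicator (Pi\<^sub>E {..<n} X \<inter> ebox n K) t"
    by (rule indicator_box_tens[of n X K, OF assms]) (simp, rule that)
  have "tens hs n \<in> tspan n" using tspan.step[OF tspan.zero hs(1,2), of 1] by simp
  from tapprox_cong[OF tapprox_tspan[OF this] hs(3)]
  show "tapprox n (indicator (Pi\<^sub>E {..<n} X \<inter> ebox n K))" .
  have "elev n (indicator (Pi\<^sub>E {..<n} X \<inter> ebox n K)) = elev n (tens hs n)"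
    by (rule elev_cong) (simp add: hs(3))
  then show "elev n (indicator (Pi\<^sub>E {..<n} X \<inter> ebox n K)) < \<infinity>"
    using elev_tens_finite[OF hs(2,1)] by simp
qed

text \<open>Dynkin's argument from boxes to all measurable sets. The cut-off by
  \<open>ebox n K\<close> keeps every set of finite measure, which countable disjoint unions need as
  a dominating function.\<close>

lemma tapprox_indicator:
  assumes "X \<in> sets (bprod n)"
  shows "tapprox n (indicator (X \<inter> ebox n K))"
proof -
  let ?G = "prod_algebra {..<n} (\<lambda>_. borel :: real measure)"
  let ?\<Omega> = "\<Pi>\<^sub>E j\<in>{..<n}. space (borel :: real measure)"
  have G: "?G = {Pi\<^sub>E {..<n} E |E. \<forall>j\<in>{..<n}. E j \<in> sets (borel :: real measure)}"
    by (auto simp: prod_algebra_eq_finite Pi_def)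
  have setsX: "sets (PiM {..<n} (\<lambda>_. borel :: real measure)) = sigma_sets ?\<Omega> ?G" by (rule sets_PiM)
  have "Int_stable ?G" unfolding G by (rule Int_stable_PiE)
  moreover have "?G \<subseteq> Pow ?\<Omega>" by (rule prod_algebra_sets_into_space)
  moreover have "X \<in> sigma_sets ?\<Omega> ?G" using assms setsX by simp
  ultimately show ?thesis
  proof (induction rule: sigma_sets_induct_disjoint)
    case (basic A)
    then obtain E where "A = Pi\<^sub>E {..<n} E" "\<forall>j\<in>{..<n}. E j \<in>
        sets (borel :: real measure)" unfolding G by blast
    then show ?case using tapprox_box(1)[of n E K] by simp
  next
    case empty
    show ?case using tapprox_tspan[OF tspan.zero[of n]] by (simp add: indicator_def)
  next
    case (compl A)
    have "tapprox n (\<lambda>t. 1 * indicator (?\<Omega> \<inter> ebox n K) t + (-1) * indicator (A \<inter> ebox n K) t)"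
      by (rule tapprox_lin[OF _ compl(2)]) (use tapprox_box(1)[of n "\<lambda>_. UNIV" K] in simp)
    moreover have "A \<subseteq> ?\<Omega>" using compl(1) setsX sets.sets_into_space[of A "bprod n"] by (simp add: space_PiM)
    ultimately show ?case by (elim tapprox_cong) (auto simp: indicator_def)
  next
    case (union A)
    have Am: "A i \<in> sets (bprod n)" for i using union(2) setsX by auto
    \<comment> \<open>Disjointness makes this finite sum the indicator of the partial union, which
      increases to the full one below the indicator of the cut-off box.\<close>
    define f where "f k t = (\<Sum>i<k. 1 * indicator (A i \<inter> ebox n K) t :: real)" for k t
    have f: "f k t = indicator ((\<Union>i<k. A i) \<inter> ebox n K) t" for k t
    proof (induction k)
      case (Suc k)
      have "A k \<inter> A i = {}" if "i < k" for i
        using disjoint_family_onD[OF union(1), of k i] that by simp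
      then have d: "t \<in> A k \<Longrightarrow> t \<notin> (\<Union>i<k. A i)" by blast
      have "f (Suc k) t = f k t + indicator (A k \<inter> ebox n K) t" by (simp add: f_def)
      also have "\<dots> = indicator ((\<Union>i<k. A i) \<inter> ebox n K) t + indicator (A k \<inter> ebox n K) t"
        by (simp only: Suc)
      also have "\<dots> = indicator ((\<Union>i<Suc k. A i) \<inter> ebox n K) t"
        using d by (cases "t \<in> A k") (auto simp: indicator_def lessThan_Suc)
      finally show ?case .
    qed (simp add: f_def)
    have em: "ebox n K \<inter> ?\<Omega> \<in> sets (bprod n)"
    proof -
      have "ebox n K \<inter> ?\<Omega> = Pi\<^sub>E {..<n} (\<lambda>_. {..K})" by (auto simp: ebox_def PiE_iff)
      then show ?thesis by (simp add: sets_PiM_I_finite)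
    qed
    have bm: "(indicator (Y \<inter> ebox n K) :: (nat \<Rightarrow> real) \<Rightarrow> real) \<in> borel_measurable (bprod n)"
      if Y: "Y \<in> sets (bprod n)" for Y
    proof -
      have "Y \<subseteq> ?\<Omega>" using sets.sets_into_space[OF Y] by (simp add: space_PiM)
      then have "Y \<inter> ebox n K = Y \<inter> (ebox n K \<inter> ?\<Omega>)" by auto
      also have "\<dots> \<in> sets (bprod n)" using Y em by auto
      finally show ?thesis by (rule borel_measurable_indicator)
    qed
    have Um: "(\<Union>i. A i) \<in> sets (bprod n)" using Am by auto
    have fk: "tapprox n (f k)" for k unfolding f_def by (rule tapprox_sum) (use union(3) in auto)
    have "(\<lambda>k. elev n (\<lambda>t. indicator ((\<Union>i. A i) \<inter> ebox n K) t - f k t)) \<longlonglongrightarrow> 0"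
    proof (rule elev_DCT[where w = "indicator (?\<Omega> \<inter> ebox n K)"])
      show "f k \<in> borel_measurable (bprod n)" for k using fk by (simp add: tapprox_def)
      show "elev n (indicator (?\<Omega> \<inter> ebox n K)) < \<infinity>" 
        using tapprox_box(2)[of n "\<lambda>_. UNIV" K] by simp
      show "(indicator (?\<Omega> \<inter> ebox n K) :: (nat \<Rightarrow> real) \<Rightarrow> real) \<in>
          borel_measurable (bprod n)"
        using tapprox_box(1)[of n "\<lambda>_. UNIV" K] by (simp add: tapprox_def)
      fix t :: "nat \<Rightarrow> real" assume t: "t \<in> extensional {..<n}"
      show "(indicator ((\<Union>i. A i) \<inter> ebox n K) t - f k t)\<^sup>2 \<le>
          (indicator (?\<Omega> \<inter> ebox n K) t)\<^sup>2" for k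
        unfolding f using t by (auto simp: indicator_def PiE_def)
      show "(\<lambda>k. f k t) \<longlonglongrightarrow> indicator ((\<Union>i. A i) \<inter> ebox n K) t"
      proof (cases "t \<in> (\<Union>i. A i)")
        case True
        then obtain i where i: "t \<in> A i" by blast
        have "eventually (\<lambda>k. f k t = indicator ((\<Union>i. A i) \<inter> ebox n K) t) sequentially"
          using eventually_gt_at_top[of i]
          by eventually_elim (use i in \<open>auto simp: f indicator_def\<close>)
        then show ?thesis by (rule tendsto_eventually)
      qed (simp add: f)
    qed (rule bm[OF Um])
    then show ?case by (rule tapprox_lim[OF fk bm[OF Um]])
  qed
qed

text \<open>Simple functions approximating \<open>f\<close> are cut off at boxes that grow with the
  index, so that their level sets fall under \<open>tapprox_indicator\<close>.\<close>

lemma tapprox_L2: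
  assumes f: "f \<in> borel_measurable (bprod n)" "elev n f < \<infinity>"
  shows "tapprox n f"
proof -
  let ?M = "PiM {..<n} (\<lambda>_. borel :: real measure)"
  from borel_measurable_implies_sequence_metric[OF f(1), of 0] obtain s where
    s': "\<forall>k. simple_function ?M (s k)" "\<forall>t\<in>space ?M. (\<lambda>k. s k t) \<longlonglongrightarrow> f t"
      "\<forall>k. \<forall>t\<in>space ?M. \<bar>s k t\<bar> \<le> 2 * \<bar>f t\<bar>" by (auto simp: dist_real_def)
  then have s: "\<And>k. simple_function ?M (s k)" "\<And>t. t \<in> space ?M \<Longrightarrow>
      (\<lambda>k. s k t) \<longlonglongrightarrow> f t"
      "\<And>k t. t \<in> space ?M \<Longrightarrow> \<bar>s k t\<bar> \<le> 2 * \<bar>f t\<bar>" by blast+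
  define g where "g k t = (\<Sum>y\<in>s k ` space ?M. y *
      indicator ((s k -` {y} \<inter> space ?M) \<inter> ebox n (real k)) t)" for k t
  have sp: "t \<in> space ?M \<longleftrightarrow> t \<in> extensional {..<n}" for t by (simp add: space_PiM PiE_def)
  have ind: "indicator A t * y * indicator B t =
      y * (indicator (A \<inter> B) t :: real)" for A B :: "(nat \<Rightarrow> real) set" and y t
    by (simp add: indicator_def)
  have gt: "g k t = s k t * indicator (ebox n (real k)) t" if "t \<in> extensional {..<n}" for k t
  proof -
    have "t \<in> space ?M" using that sp by blast
    from simple_function_indicator_representation_banach[OF s(1) this, unfolded real_scaleR_def]
    have "s k t * indicator (ebox n (real k)) t =
        (\<Sum>y\<in>s k ` space ?M. indicator (s k -` {y} \<inter> space ?M) t * y) * indicator (ebox n (real k)) t"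
      by (rule arg_cong[where f = "\<lambda>z. z * indicator (ebox n (real k)) t"])
    also have "\<dots> = g k t" unfolding g_def sum_distrib_right
      by (rule sum.cong[OF refl]) (rule ind)
    finally show ?thesis by simp
  qed
  have ga: "tapprox n (g k)" for k unfolding g_def
  proof (rule tapprox_sum)
    show "finite (s k ` space ?M)" using s(1) by (simp add: simple_function_def)
    fix y assume "y \<in> s k ` space ?M"
    then show "tapprox n (indicator ((s k -` {y} \<inter> space ?M) \<inter> ebox n (real k)))"
      using s(1)[of k] by (intro tapprox_indicator simple_functionD)
  qed
  have "(\<lambda>k. elev n (\<lambda>t. f t - g k t)) \<longlonglongrightarrow> 0"
  proof (rule elev_DCT[where w = "\<lambda>t. 3 * f t"])
    \<comment> \<open>The dominating factor 3 arises as \<open>1 + 2\<close>: the simple functions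
      are bounded by \<open>2 * \<bar>f t\<bar>\<close>.\<close>
    show "g k \<in> borel_measurable ?M" for k using ga by (simp add: tapprox_def)
    show "(\<lambda>t. 3 * f t) \<in> borel_measurable ?M" using f(1) by simp
    have "elev n (\<lambda>t. 3 * f t + 0 * f t) \<le> ennreal (2 * 3\<^sup>2) * elev n f + ennreal (2 * 0\<^sup>2) * elev n f"
      by (rule elev_vlin) (use f in auto)
    also have "\<dots> < \<infinity>" using f(2) by (simp add: ennreal_mult_less_top)
    finally show "elev n (\<lambda>t. 3 * f t) < \<infinity>" by simp
    fix t :: "nat \<Rightarrow> real" assume t: "t \<in> extensional {..<n}"
    show "(f t - g k t)\<^sup>2 \<le> (3 * f t)\<^sup>2" for k
    proof -
      have "\<bar>f t - g k t\<bar> \<le> \<bar>f t\<bar> + \<bar>s k t\<bar>" using gt[OF t, of k] by (auto simp: indicator_def)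
      also have "\<dots> \<le> \<bar>3 * f t\<bar>" using s(3)[of t k] t sp by (simp add: abs_mult)
      finally show ?thesis by (metis abs_ge_zero power2_abs power_mono)
    qed
    show "(\<lambda>k. g k t) \<longlonglongrightarrow> f t"
    proof (rule Lim_transform_eventually)
      show "(\<lambda>k. s k t) \<longlonglongrightarrow> f t" using s(2) t sp by blast
      obtain k0 :: nat where k0: "Max (insert 0 (t ` {..<n})) \<le> real k0" using real_arch_simple by blast
      show "eventually (\<lambda>k. s k t = g k t) sequentially" using eventually_ge_at_top[of k0]
      proof eventually_elim
        fix k assume "k0 \<le> k"
        have "t j \<le> real k" if "j < n" for j
        proof -
          have "t j \<le> Max (insert 0 (t ` {..<n}))" using that by (intro Max_ge) auto
          then show ?thesis using k0 \<open>k0 \<le> k\<close> by linarith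
        qed
        then show "s k t = g k t" by (simp add: gt[OF t] ebox_def)
      qed
    qed
  qed (rule f)
  then show ?thesis by (rule tapprox_lim[OF ga f(1)])
qed

end

subsection \<open>Orthogonal polynomials of the noise\<close>

lemma lin_span_base: "g \<in> A \<Longrightarrow> g \<in> lin_span A"
  unfolding lin_span_def by (intro CollectI exI[of _ "1::nat"] exI[of _ "\<lambda>_. 1"] exI[of _ "\<lambda>_. g"]) simp

lemma lin_span_step:
  assumes "F \<in> lin_span A" "g \<in> A" shows "(\<lambda>n x. F n x + c * g n x) \<in> lin_span A"
proof -
  from assms(1) obtain k :: nat and c' g' where F: "\<forall>i<k. g' i \<in> A" "F = (\<lambda>n x. \<Sum>i<k. c' i * g' i n x)"
    unfolding lin_span_def by blast
  have "(\<lambda>n x. F n x + c * g n x) = (\<lambda>n x. \<Sum>i<Suc k. (c'(k := c)) i * (g'(k := g)) i n x)"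
    unfolding F(2) by simp
  moreover have "\<forall>i<Suc k. (g'(k := g)) i \<in> A" using F(1) assms(2) by (simp add: less_Suc_eq)
  ultimately show ?thesis unfolding lin_span_def by blast
qed

lemma lin_span_zero: "(\<lambda>n x. 0) \<in> lin_span A"
  unfolding lin_span_def by (intro CollectI exI[of _ "0::nat"]) simp

lemma lin_span_induct [consumes 1, case_names zero step]:
  assumes "F \<in> lin_span A" "P (\<lambda>n x. 0)"
    and "\<And>F g c. F \<in> lin_span A \<Longrightarrow> P F \<Longrightarrow> g \<in> A \<Longrightarrow>
        P (\<lambda>n x. F n x + c * g n x)"
  shows "P F"
proof -
  from assms(1) obtain k :: nat and c g where F: "\<forall>i<k. g i \<in> A" "F = (\<lambda>n x. \<Sum>i<k. c i * g i n x)"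
    unfolding lin_span_def by blast
  have "m \<le> k \<Longrightarrow> (\<lambda>n x. \<Sum>i<m. c i * g i n x) \<in>
      lin_span A \<and> P (\<lambda>n x. \<Sum>i<m. c i * g i n x)" for m
  proof (induction m)
    case 0
    then show ?case using assms(2) lin_span_zero by simp
  next
    case (Suc m)
    then have IH: "(\<lambda>n x. \<Sum>i<m. c i * g i n x) \<in> lin_span A" "P (\<lambda>n x. \<Sum>i<m. c i * g i n x)" by auto
    have g: "g m \<in> A" using F(1) Suc by simp
    show ?case using lin_span_step[OF IH(1) g, of "c m"] assms(3)[OF IH g, of "c m"] by simp
  qed
  from this[of k] show ?thesis using F(2) by simp
qed

lemma lin_span_vlin:
  assumes F: "F \<in> lin_span A" and G: "G \<in> lin_span A" shows "vlin a F b G \<in> lin_span A"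
  using G
proof (induction rule: lin_span_induct)
  case zero
  show ?case using F
  proof (induction rule: lin_span_induct)
    case (step F g c)
    from lin_span_step[OF step(3,2), of "a * c"] show ?case by (simp add: vlin_def algebra_simps)
  qed (simp add: vlin_def lin_span_zero)
next
  case (step G g c)
  from lin_span_step[OF step(3,2), of "b * c"] show ?case by (simp add: vlin_def algebra_simps)
qed

lemma lin_span_mono: "A \<subseteq> B \<Longrightarrow> lin_span A \<subseteq> lin_span B"
  unfolding lin_span_def by blast

lemma vdiff_vlin: "vdiff (vlin a F b G) (vlin a F' b G') = vlin a (vdiff F F') b (vdiff G G')"
  by (simp add: vdiff_def vlin_def algebra_simps)

lemma vdiff_split: "vdiff F H = vlin 1 (vdiff F G) 1 (vdiff G H)"
  by (simp add: vdiff_def vlin_def)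

lemma esupp_vlin: "esupp N F \<Longrightarrow> esupp N G \<Longrightarrow> esupp N (vlin a F b G)"
  by (simp add: esupp_def vlin_def)

lemma esupp_mono: "esupp N F \<Longrightarrow> N \<le> M \<Longrightarrow> esupp M F"
  by (simp add: esupp_def)

lemma esupp_single: "n \<le> N \<Longrightarrow> esupp N (single n f)"
  by (auto simp: esupp_def single_def)

lemma tens_single: "tens hs = single (length hs) (tens hs (length hs))"
  by (auto simp: single_def tens_def fun_eq_iff)

context compact_prob
begin

section \<open>Closures of polynomials and vectors of bounded degree\<close>

lemma fock_triangle:
  assumes "F \<in> Fock" "G \<in> Fock" "H \<in> Fock"
  shows "norm2 (vdiff F H) \<le> 2 * norm2 (vdiff F G) + 2 * norm2 (vdiff G H)"
proof -
  have "vdiff F G \<in> Fock" "vdiff G H \<in> Fock"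
    unfolding vdiff_eq_vlin by (intro fock_space_vlin assms)+
  then show ?thesis using fock_norm2_vlin[of "vdiff F G" "vdiff G H" 1 1] fock_measurable
    by (simp add: vdiff_split[of F H G])
qed

lemma efock_triangle:
  assumes "F \<in> EFock" "G \<in> EFock" "H \<in> EFock"
  shows "enorm2 (vdiff F H) \<le> 2 * enorm2 (vdiff F G) + 2 * enorm2 (vdiff G H)"
proof -
  have "vdiff F G \<in> EFock" "vdiff G H \<in> EFock"
    unfolding vdiff_eq_vlin by (intro efock_space_vlin assms)+
  then show ?thesis using efock_norm2_vlin[of "vdiff F G" "vdiff G H" 1 1]
    by (simp add: vdiff_split[of F H G] efock_emeas)
qed

lemma closure_fock: "G \<in> fock_closure \<nu> A \<Longrightarrow> G \<in> Fock"
  by (simp add: fock_closure_def)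

lemma closure_base: "A \<subseteq> Fock \<Longrightarrow> G \<in> A \<Longrightarrow> G \<in> fock_closure \<nu> A"
proof -
  assume "A \<subseteq> Fock" "G \<in> A"
  moreover have "norm2 (vdiff G G) = 0" by (rule feq_vdiff_0) simp
  ultimately show ?thesis unfolding fock_closure_def by (auto intro!: bexI[of _ G])
qed

lemma closure_mono: "A \<subseteq> B \<Longrightarrow> fock_closure \<nu> A \<subseteq> fock_closure \<nu> B"
  unfolding fock_closure_def by blast

lemma closure_closed:
  assumes A: "A \<subseteq> Fock" and G: "G \<in> Fock"
    and ap: "\<And>e::real. e > 0 \<Longrightarrow> \<exists>H\<in>fock_closure \<nu> A. norm2 (vdiff G H) < ennreal e"
  shows "G \<in> fock_closure \<nu> A" unfolding fock_closure_def
proof (intro CollectI conjI G allI impI)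
  fix e :: real assume e: "e > 0"
  then have e4: "e / 4 > 0" by simp
  from ap[OF this] obtain H where H: "H \<in> fock_closure \<nu> A" "norm2 (vdiff G H) < ennreal (e / 4)" by blast
  from H(1) e4 obtain P where P: "P \<in> A" "norm2 (vdiff H P) < ennreal (e / 4)"
    unfolding fock_closure_def by blast
  have "norm2 (vdiff G P) \<le> 2 * norm2 (vdiff G H) + 2 * norm2 (vdiff H P)"
    by (rule fock_triangle) (use G closure_fock[OF H(1)] A P in auto)
  also have "\<dots> < ennreal e" by (rule two_small[OF H(2) P(2) e])
  finally show "\<exists>P\<in>A. norm2 (vdiff G P) < ennreal e" using P(1) by blast
qed

text \<open>Monomial vectors agree with values of \<open>U\<close> only almost everywhere, so
  closures must absorb a change of representative.\<close>

lemma closure_feq: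
  assumes "A \<subseteq> Fock" "G \<in> Fock" "H \<in> fock_closure \<nu> A" "feq G H"
  shows "G \<in> fock_closure \<nu> A"
  by (rule closure_closed[OF assms(1,2)]) (use assms(3) feq_vdiff_0[OF assms(4)] in \<open>auto intro!: bexI[of _ H]\<close>)

lemma closure_vlin:
  assumes A: "A \<subseteq> Fock" "\<And>F G a b. F \<in> A \<Longrightarrow> G \<in> A \<Longrightarrow> vlin a F b G \<in> A"
    and GH: "G \<in> fock_closure \<nu> A" "H \<in> fock_closure \<nu> A"
  shows "vlin a G b H \<in> fock_closure \<nu> A" unfolding fock_closure_def
proof (intro CollectI conjI allI impI)
  show "vlin a G b H \<in> Fock" using GH by (intro fock_space_vlin closure_fock)
  fix e :: real assume e: "e > 0"
  define d where "d = e / (2 * a\<^sup>2 + 2 * b\<^sup>2 + 1)"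
  have d: "d > 0" using e by (simp add: d_def add_nonneg_pos)
  from GH d obtain P Q where P: "P \<in> A" "norm2 (vdiff G P) < ennreal d"
    and Q: "Q \<in> A" "norm2 (vdiff H Q) < ennreal d" unfolding fock_closure_def by blast
  have "vdiff G P \<in> Fock" "vdiff H Q \<in> Fock"
    unfolding vdiff_eq_vlin using closure_fock[OF GH(1)] closure_fock[OF GH(2)] P(1) Q(1) A(1)
    by (auto intro!: fock_space_vlin)
  then have "norm2 (vdiff (vlin a G b H) (vlin a P b Q)) \<le>
      ennreal (2 * a\<^sup>2) * norm2 (vdiff G P) + ennreal (2 * b\<^sup>2) * norm2 (vdiff H Q)"
    unfolding vdiff_vlin by (intro fock_norm2_vlin fock_measurable)
  also have "\<dots> < ennreal e"
    by (rule vlin_small[OF P(2)[unfolded d_def] Q(2)[unfolded d_def] e])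
  finally show "\<exists>P\<in>A. norm2 (vdiff (vlin a G b H) P) < ennreal e"
    using A(2)[OF P(1) Q(1)] by blast
qed

lemma norm_0_feq:
  assumes F: "F \<in> Fock" "G \<in> Fock" and z: "norm2 (vdiff F G) = 0"
  shows "feq F G" unfolding feq_def
proof
  fix n
  have "lev n (vdiff F G n) \<le> norm2 (vdiff F G)"
    unfolding fock_norm2_lev using sum_le_suminf[of "\<lambda>n. lev n (vdiff F G n)" "{n}"] by simp
  then have "lev n (vdiff F G n) = 0" using z by simp
  moreover have "(\<lambda>x. indicator (Sset n) x * ennreal ((vdiff F G n x)\<^sup>2)) \<in> borel_measurable (Sm n)"
    using fock_measurable[OF F(1), of n] fock_measurable[OF F(2), of n] unfolding vdiff_def by measurable
  ultimately have "AE x in Sm n. indicator (Sset n) x * ennreal ((vdiff F G n x)\<^sup>2) = 0"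
    unfolding lev_def by (simp add: nn_integral_0_iff_AE)
  then show "AE x in Sm n. x \<in> Sset n \<longrightarrow> F n x = G n x"
    by eventually_elim (auto simp: vdiff_def)
qed

lemma omega_diff_norm:
  assumes h: "h \<in> B0" and F: "F \<in> Fock" and G: "G \<in> Fock"
  shows "norm2 (vdiff (omega \<nu> h F) (omega \<nu> h G)) = norm2 (omega \<nu> h (vdiff F G))"
  using feq_norm2[OF omega_vlin[OF h F G, of 1 "-1"]] by (simp add: vdiff_eq_vlin)

text \<open>Boundedness applied to a vector of norm 0; this avoids following null sets through the
  sections in \<open>aann\<close>.\<close>

lemma omega_feq:
  assumes h: "h \<in> B0" and F: "F \<in> Fock" and G: "G \<in> Fock" and eq: "feq F G"
  shows "feq (omega \<nu> h F) (omega \<nu> h G)"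
proof (rule norm_0_feq[OF omega_space[OF h F] omega_space[OF h G]])
  obtain C where C: "C < \<infinity>"
    "\<And>F. (\<And>n. F n \<in> borel_measurable (Sm n)) \<Longrightarrow> norm2 (omega \<nu> h F) \<le> C * norm2 F"
    by (rule omega_bounded[OF h]) blast
  have "vdiff F G \<in> Fock" unfolding vdiff_eq_vlin by (rule fock_space_vlin[OF F G])
  then have "norm2 (omega \<nu> h (vdiff F G)) \<le> C * norm2 (vdiff F G)"
    by (intro C(2) fock_measurable)
  then show "norm2 (vdiff (omega \<nu> h F) (omega \<nu> h G)) = 0"
    using feq_vdiff_0[OF eq] omega_diff_norm[OF h F G] by simp
qed

lemma Uop_fock: "F \<in> EFock \<Longrightarrow> esupp N F \<Longrightarrow> Uop N F \<in> Fock"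
  using Uop_isometry[of F N] Uop_measurable[of F N] by (simp add: fock_space_def efock_emeas)

lemma Uop_vlin: "Uop N (vlin a F b G) = vlin a (Uop N F) b (Uop N G)"
  by (simp add: Uop_def Usum_def vlin_def fun_eq_iff sum.distrib sum_distrib_left algebra_simps)

lemma Uop_vdiff: "Uop N (vdiff F G) = vdiff (Uop N F) (Uop N G)"
  by (simp add: vdiff_eq_vlin Uop_vlin)

lemma Uop_eOmega: "Uop N eOmega = Omega"
proof (intro ext)
  fix i x
  show "Uop N eOmega i x = Omega i x"
  proof (cases i)
    case 0
    then show ?thesis by (simp add: Uop_def Usum_def eOmega_def Omega_def)
  next
    case (Suc j)
    have "eOmega (tot ls) t = 0" if "ls \<in> ulists N i" for ls t
      using that Suc by (auto simp: eOmega_def ulists_def)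
    then show ?thesis by (simp add: Uop_def Usum_def Omega_def Suc)
  qed
qed

text \<open>Both claims are proved together because carrying \<open>feq\<close> through
  \<open>omega\<close> asks for membership in the Fock space.\<close>

lemma mono_vec_feq:
  "set hs \<subseteq> B0 \<Longrightarrow> mono_vec \<nu> hs \<in>
      Fock \<and> feq (mono_vec \<nu> hs) (Uop (length hs) (Evec hs))"
proof (induction hs)
  case Nil
  have "Omega \<in> Fock" using Uop_fock[OF eOmega_efock esupp_eOmega] by (simp add: Uop_eOmega)
  then show ?case by (simp add: mono_vec_def Evec_def Uop_eOmega)
next
  case (Cons h hs)
  then have h: "h \<in> B0" and IH: "mono_vec \<nu> hs \<in> Fock" "feq (mono_vec \<nu> hs) (Uop (length hs) (Evec hs))"
    and E: "Evec hs \<in> EFock" "esupp (length hs) (Evec hs)" using Evec_efock by auto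
  have m: "mono_vec \<nu> (h # hs) = omega \<nu> h (mono_vec \<nu> hs)" by (simp add: mono_vec_def)
  have "feq (omega \<nu> h (mono_vec \<nu> hs)) (omega \<nu> h (Uop (length hs) (Evec hs)))"
    by (rule omega_feq[OF h IH(1) Uop_fock[OF E] IH(2)])
  also have "feq (omega \<nu> h (Uop (length hs) (Evec hs))) (Uop (length (h # hs)) (Evec (h # hs)))"
    using omega_Uop[OF h E] by (simp add: Evec_def)
  finally show ?case using omega_space[OF h IH(1)] unfolding m by simp
qed

lemma zero_fock: "(\<lambda>n x. 0) \<in> Fock"
  by (simp add: fock_space_def)

lemma lin_span_fock:
  assumes "A \<subseteq> Fock" shows "lin_span A \<subseteq> Fock"
proof
  fix F assume "F \<in> lin_span A"
  then show "F \<in> Fock"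
  proof (induction rule: lin_span_induct)
    case zero show ?case by (rule zero_fock)
  next
    case (step F g c)
    then have "vlin 1 F c g \<in> Fock" using assms by (intro fock_space_vlin) auto
    then show ?case by (simp add: vlin_def)
  qed
qed

lemma Pn_vec_fock: "Pn_vec \<nu> n \<subseteq> Fock"
  unfolding Pn_vec_def by (rule lin_span_fock) (use mono_vec_feq in auto)

lemma P_vec_fock: "P_vec \<nu> \<subseteq> Fock"
  unfolding P_vec_def by (rule lin_span_fock) (use mono_vec_feq in auto)

lemma Pn_vec_mono: "n \<le> m \<Longrightarrow> Pn_vec \<nu> n \<subseteq> Pn_vec \<nu> m"
  unfolding Pn_vec_def by (rule lin_span_mono) auto

lemma Pn_vec_P: "Pn_vec \<nu> n \<subseteq> P_vec \<nu>"
  unfolding Pn_vec_def P_vec_def by (rule lin_span_mono) auto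

lemma Pn_closure_vlin:
  "G \<in> Pcl n \<Longrightarrow> H \<in> Pcl n \<Longrightarrow> vlin a G b H \<in> Pcl n"
  by (rule closure_vlin[OF Pn_vec_fock]) (auto simp: Pn_vec_def intro: lin_span_vlin)

lemma L2tau_vlin: "G \<in> L2tau \<nu> \<Longrightarrow> H \<in> L2tau \<nu> \<Longrightarrow> vlin a G b H \<in> L2tau \<nu>"
  unfolding L2tau_def by (rule closure_vlin[OF P_vec_fock]) (auto simp: P_vec_def intro: lin_span_vlin)

lemma L2tau_fock: "G \<in> L2tau \<nu> \<Longrightarrow> G \<in> Fock"
  by (simp add: L2tau_def closure_fock)

lemma mono_vec_Pn: "set hs \<subseteq> B0 \<Longrightarrow> length hs \<le> n \<Longrightarrow> mono_vec \<nu> hs \<in> Pcl n"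
  by (rule closure_base[OF Pn_vec_fock]) (auto simp: Pn_vec_def intro!: lin_span_base)

lemma single_efock:
  "f \<in> borel_measurable (bprod n) \<Longrightarrow> elev n f < \<infinity> \<Longrightarrow> single n f \<in> EFock"
  by (simp add: efock_emeas single_emeas efock_single)

lemma tens_efock: "set hs \<subseteq> B0 \<Longrightarrow> tens hs \<in> EFock"
  by (subst tens_single) (intro single_efock elev_tens_finite, use tens_meas[of hs] in \<open>auto simp: emeas_def\<close>)

definition trunc :: "nat \<Rightarrow> efockvec \<Rightarrow> efockvec" where
  "trunc N F = (\<lambda>k. if k \<le> N then F k else (\<lambda>_. 0))"

lemma trunc_esupp: "esupp N (trunc N F)"
  by (simp add: esupp_def trunc_def)

lemma trunc_efock: "F \<in> EFock \<Longrightarrow> trunc N F \<in> EFock"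
proof -
  assume F: "F \<in> EFock"
  have "enorm2 (trunc N F) \<le> enorm2 F"
    unfolding efock_norm2_elev by (intro suminf_le) (auto simp: trunc_def)
  moreover have "emeas (trunc N F)" using F by (auto simp: efock_emeas emeas_def trunc_def)
  ultimately show ?thesis using F by (auto simp: efock_emeas intro: le_less_trans)
qed

text \<open>Density turned into an induction rule for degree at most \<open>N\<close>: tensors give
  their span, limits give single components, and finitely many components give the vector. It serves
  both to place values of \<open>U\<close> in closures and to identify \<open>J\<close>.\<close>

lemma efock_induct:
  assumes F: "F \<in> EFock" "esupp N F"
    and lin: "\<And>F G a b. F \<in> EFock \<Longrightarrow> esupp N F \<Longrightarrow> P F \<Longrightarrow>
        G \<in> EFock \<Longrightarrow> esupp N G \<Longrightarrow> P G \<Longrightarrow> P (vlin a F b G)"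
    and closed: "\<And>F. F \<in> EFock \<Longrightarrow> esupp N F \<Longrightarrow>
      (\<And>e::real. e > 0 \<Longrightarrow> \<exists>G. G \<in>
          EFock \<and> esupp N G \<and> P G \<and> enorm2 (vdiff F G) < ennreal e) \<Longrightarrow> P F"
    and om: "P eOmega"
    and tens: "\<And>hs. set hs \<subseteq> B0 \<Longrightarrow> hs \<noteq> [] \<Longrightarrow> length hs \<le>
        N \<Longrightarrow> P (tens hs)"
  shows "P F"
proof -
  let ?Q = "\<lambda>F. F \<in> EFock \<and> esupp N F \<and> P F"
  \<comment> \<open>Membership and degree bound travel with \<open>P\<close>, since the hypotheses
    \<open>lin\<close> and \<open>closed\<close> ask for them.\<close>
  have Qlin: "?Q (vlin a F b G)" if "?Q F" "?Q G" for F G a b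
    using that by (auto intro: lin efock_space_vlin esupp_vlin)
  have Qom: "?Q eOmega" using om eOmega_efock esupp_mono[OF esupp_eOmega] by auto
  have Q0: "?Q (single n (\<lambda>_. 0))" for n
  proof -
    have "single n (\<lambda>_. 0) = vlin 0 eOmega 0 eOmega" by (simp add: single_def vlin_def fun_eq_iff)
    then show ?thesis using Qlin[OF Qom Qom, of 0 0] by simp
  qed
  have tens0: "tens [] = eOmega" by (auto simp: tens_def eOmega_def fun_eq_iff)
  have Qtens: "?Q (tens hs)" if "set hs \<subseteq> B0" "length hs \<le> N" for hs
  proof (cases "hs = []")
    case True
    then show ?thesis using Qom tens0 by simp
  next
    case False
    have "esupp N (tens hs)" by (subst tens_single) (rule esupp_single[OF that(2)])
    then show ?thesis using tens[OF that(1) False that(2)] tens_efock[OF that(1)] by simp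
  qed
  have Qspan: "?Q (single n T)" if "T \<in> tspan n" "n \<le> N" for n T using that(1)
  proof induction
    case zero show ?case by (rule Q0)
  next
    case (step T hs c)
    have "single n (\<lambda>t. T t + c * tens hs n t) = vlin 1 (single n T) c (tens hs)"
      using step(2) by (auto simp: single_def vlin_def tens_def fun_eq_iff)
    then show ?case using Qlin[OF step(4) Qtens[of hs], of 1 c] step that(2) by simp
  qed
  have Qsingle: "?Q (single n f)"
    if f: "f \<in> borel_measurable (bprod n)" "elev n f < \<infinity>" and n: "n \<le> N" for n f
  proof (intro conjI)
    show 1: "single n f \<in> EFock" by (rule single_efock[OF f])
    show 2: "esupp N (single n f)" by (rule esupp_single[OF n])
    show "P (single n f)"
    proof (rule closed[OF 1 2])
      fix e :: real assume "e > 0"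
      then obtain T where T: "T \<in> tspan n" "elev n (\<lambda>t. f t - T t) < ennreal e"
        using tapprox_L2[OF f] unfolding tapprox_def by blast
      have "vdiff (single n f) (single n T) = single n (\<lambda>t. f t - T t)"
        by (auto simp: vdiff_def single_def fun_eq_iff)
      then show "\<exists>G. G \<in> EFock \<and> esupp N G \<and> P G \<and> enorm2 (vdiff (single n f) G) < ennreal e"
        using Qspan[OF T(1) n] T(2) by (auto simp: efock_single)
    qed
  qed
  have f: "F n \<in> borel_measurable (bprod n)" "elev n (F n) < \<infinity>" for n
    using F(1) elev_le_efock[of n F] by (auto simp: efock_emeas emeas_def intro: le_less_trans)
  have "m \<le> N \<Longrightarrow> ?Q (trunc m F)" for m
  proof (induction m)
    case 0
    have "trunc 0 F = single 0 (F 0)" by (auto simp: trunc_def single_def fun_eq_iff)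
    then show ?case using Qsingle[OF f, of 0] by simp
  next
    case (Suc m)
    have "trunc (Suc m) F = vlin 1 (trunc m F) 1 (single (Suc m) (F (Suc m)))"
      by (auto simp: trunc_def single_def vlin_def fun_eq_iff)
    then show ?case using Qlin[OF Suc.IH Qsingle[OF f, of "Suc m"], of 1 1] Suc.prems by simp
  qed
  from this[of N] have "P (trunc N F)" by simp
  moreover have "trunc N F = F" using F(2) by (auto simp: trunc_def esupp_def fun_eq_iff)
  ultimately show ?thesis by simp
qed

lemma Uop_diff_norm:
  assumes "F \<in> EFock" "esupp N F" "G \<in> EFock" "esupp N G"
  shows "norm2 (vdiff (Uop N F) (Uop N G)) = enorm2 (vdiff F G)"
proof -
  have "vdiff F G \<in> EFock" "esupp N (vdiff F G)"
    unfolding vdiff_eq_vlin using assms by (auto intro: efock_space_vlin esupp_vlin)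
  then show ?thesis using Uop_isometry[of "vdiff F G" N] by (simp add: efock_emeas Uop_vdiff)
qed

text \<open>In degree \<open>length hs\<close> the two vectors cancel by \<open>Evec_top\<close>,
  and above it both vanish.\<close>

lemma tens_low:
  assumes hs: "set hs \<subseteq> B0" "hs \<noteq> []"
  defines "low \<equiv> vdiff (Evec hs) (tens hs)"
  shows "low \<in> EFock" "esupp (length hs - 1) low"
proof -
  show "low \<in> EFock"
    unfolding low_def vdiff_eq_vlin using Evec_efock[OF hs(1)] tens_efock[OF hs(1)] by (auto intro: efock_space_vlin)
  show "esupp (length hs - 1) low" unfolding esupp_def
  proof (intro allI impI)
    fix n assume n: "n > length hs - 1"
    show "low n = (\<lambda>_. 0)"
    proof (cases "n = length hs")
      case True
      then show ?thesis using Evec_top[OF hs(1)] by (simp add: low_def vdiff_def)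
    next
      case False
      then have "n > length hs" using n by simp
      then show ?thesis using Evec_efock[OF hs(1)] False by (simp add: low_def vdiff_def esupp_def tens_def)
    qed
  qed
qed

lemma esupp_tens: "esupp (length hs) (tens hs)"
  by (subst tens_single) (rule esupp_single, simp)

theorem Uop_closure:
  "F \<in> EFock \<Longrightarrow> esupp n F \<Longrightarrow> Uop n F \<in> Pcl n"
proof (induction n arbitrary: F rule: less_induct)
  case (less n)
  show ?case
  proof (rule efock_induct[OF less.prems, of "\<lambda>F. Uop n F \<in> Pcl n"])
    show "Uop n (vlin a F b G) \<in> Pcl n"
      if "Uop n F \<in> Pcl n" "Uop n G \<in> Pcl n" for F G a b
      unfolding Uop_vlin using that by (rule Pn_closure_vlin)
    have "mono_vec \<nu> [] \<in> Pcl n" by (rule mono_vec_Pn) auto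
    then show "Uop n eOmega \<in> Pcl n" by (simp add: Uop_eOmega mono_vec_def)
    show "Uop n F \<in> Pcl n" if F: "F \<in> EFock" "esupp n F"
      and ap: "\<And>e::real. e > 0 \<Longrightarrow> \<exists>G. G \<in> EFock \<and> esupp n G \<and> Uop n G \<in>
          Pcl n \<and> enorm2 (vdiff F G) < ennreal e" for F
    proof (rule closure_closed[OF Pn_vec_fock Uop_fock[OF F]])
      fix e :: real assume "e > 0"
      from ap[OF this] obtain G where "G \<in> EFock" "esupp n G" "Uop n G \<in> Pcl n"
        "enorm2 (vdiff F G) < ennreal e" by blast
      then show "\<exists>H\<in>Pcl n. norm2 (vdiff (Uop n F) H) < ennreal e"
        using Uop_diff_norm[OF F] by (intro bexI[of _ "Uop n G"]) auto
    qed
    fix hs :: "(real \<Rightarrow> real) list" assume hs: "set hs \<subseteq> B0" "hs \<noteq> []" "length hs \<le> n"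
    \<comment> \<open>\<open>U\<close> of \<open>Evec hs\<close> is the monomial up to
      \<open>feq\<close>, and \<open>low\<close> has degree below \<open>length hs\<close>; the
      induction hypothesis thus handles the gap between the monomial and \<open>U\<close> of the
      tensor.\<close>
    define low where "low = vdiff (Evec hs) (tens hs)"
    have low: "low \<in> EFock" "esupp (length hs - 1) low"
      unfolding low_def by (rule tens_low[OF hs(1,2)])+
    have lt: "length hs - 1 < n" using hs by (cases hs) auto
    have E: "Evec hs \<in> EFock" "esupp (length hs) (Evec hs)" using Evec_efock[OF hs(1)] by auto
    have "Uop n low = Uop (length hs - 1) low" using Uop_mono[OF low(2), of n] lt by simp
    moreover have "Uop (length hs - 1) low \<in> Pcl n"
      using less.IH[OF lt low] closure_mono[OF Pn_vec_mono[of "length hs - 1" n]] lt by auto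
    moreover have "Uop n (Evec hs) \<in> Pcl n"
    proof (rule closure_feq[OF Pn_vec_fock _ mono_vec_Pn[OF hs(1,3)]])
      show "Uop n (Evec hs) \<in> Fock" by (rule Uop_fock[OF E(1) esupp_mono[OF E(2) hs(3)]])
      show "feq (Uop n (Evec hs)) (mono_vec \<nu> hs)"
        using feq_sym[OF conjunct2[OF mono_vec_feq[OF hs(1)]]] Uop_mono[OF E(2) hs(3)] by simp
    qed
    ultimately have "vlin 1 (Uop n (Evec hs)) (-1) (Uop n low) \<in> Pcl n"
      by (intro Pn_closure_vlin) auto
    moreover have "vlin 1 (Uop n (Evec hs)) (-1) (Uop n low) = Uop n (tens hs)"
    proof -
      have "vlin 1 (Evec hs) (-1) low = tens hs" by (simp add: low_def vlin_def vdiff_def)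
      then show ?thesis by (simp add: Uop_vlin[symmetric])
    qed
    ultimately show "Uop n (tens hs) \<in> Pcl n" by simp
  qed
qed

lemma Uop_L2tau: "F \<in> EFock \<Longrightarrow> esupp n F \<Longrightarrow> Uop n F \<in> L2tau \<nu>"
  using Uop_closure closure_mono[OF Pn_vec_P] unfolding L2tau_def by blast

section \<open>Orthogonality of different degrees and the orthogonal polynomials\<close>

lemma lev_indicator: "lev i f = (\<integral>\<^sup>+x. ennreal ((indicator (Sset i) x * f x)\<^sup>2) \<partial>Sm i)"
  unfolding lev_def by (intro nn_integral_cong) (simp add: indicator_def)

lemma level_integrable:
  assumes f: "f \<in> borel_measurable (Sm i)" "lev i f < \<infinity>"
    and g: "g \<in> borel_measurable (Sm i)" "lev i g < \<infinity>"
  shows "integrable (Sm i) (\<lambda>x. indicator (Sset i) x * f x * g x)"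
    and "ennreal ((\<integral>x. indicator (Sset i) x * f x * g x \<partial>Sm i)\<^sup>2) \<le> lev i f * lev i g"
proof -
  have m: "(\<lambda>x. indicator (Sset i) x * f x) \<in> borel_measurable (Sm i)"
    "(\<lambda>x. indicator (Sset i) x * g x) \<in> borel_measurable (Sm i)" using f g by measurable
  have eq: "(indicator (Sset i) x * f x) * (indicator (Sset i) x * g x) = indicator (Sset i) x * f x * g x" for x
    by (simp add: indicator_def)
  show "integrable (Sm i) (\<lambda>x. indicator (Sset i) x * f x * g x)"
    using integral_Cauchy_Schwarz(2)[OF m] f(2) g(2) unfolding eq lev_indicator by simp
  show "ennreal ((\<integral>x. indicator (Sset i) x * f x * g x \<partial>Sm i)\<^sup>2) \<le> lev i f * lev i g"
    using integral_Cauchy_Schwarz(1)[OF m] unfolding eq lev_indicator .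
qed

text \<open>Over the reals additivity of squared norms is equivalent to orthogonality, so inner
  products can be read off the isometry instead of being computed.\<close>

lemma level_polarization:
  assumes f: "f \<in> borel_measurable (Sm i)" "lev i f < \<infinity>"
    and g: "g \<in> borel_measurable (Sm i)" "lev i g < \<infinity>"
    and eq: "lev i (\<lambda>x. f x + g x) = lev i f + lev i g"
  shows "(\<integral>x. indicator (Sset i) x * f x * g x \<partial>Sm i) = 0"
proof -
  let ?I = "\<lambda>f g. \<integral>x. indicator (Sset i) x * f x * g x \<partial>Sm i"
  have L: "lev i u = ennreal (?I u u)" if "u \<in> borel_measurable (Sm i)" "lev i u < \<infinity>" for u
  proof -
    have "(\<integral>\<^sup>+x. ennreal (indicator (Sset i) x * u x * u x) \<partial>Sm i) = ennreal (?I u u)"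
      by (rule nn_integral_eq_integral[OF level_integrable(1)[OF that that]]) (simp add: indicator_def)
    moreover have "lev i u = (\<integral>\<^sup>+x. ennreal (indicator (Sset i) x * u x * u x) \<partial>Sm i)"
      unfolding lev_def by (intro nn_integral_cong) (simp add: indicator_def power2_eq_square)
    ultimately show ?thesis by simp
  qed
  have nn: "?I u u \<ge> 0" for u :: "(nat \<Rightarrow> real \<times> real) \<Rightarrow> real"
      by (rule Bochner_Integration.integral_nonneg) (simp add: indicator_def)
  have "lev i (\<lambda>x. f x + g x) < \<infinity>" using eq f(2) g(2) by simp
  moreover have "(\<lambda>x. f x + g x) \<in> borel_measurable (Sm i)" using f g by measurable
  ultimately have "ennreal (?I (\<lambda>x. f x + g x) (\<lambda>x. f x + g x)) = ennreal (?I f f) + ennreal (?I g g)"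
    using L[of "\<lambda>x. f x + g x"] L[OF f] L[OF g] eq by simp
  then have 1: "?I (\<lambda>x. f x + g x) (\<lambda>x. f x + g x) = ?I f f + ?I g g"
    using nn by (simp add: ennreal_plus[symmetric] del: ennreal_plus)
  have "?I (\<lambda>x. f x + g x) (\<lambda>x. f x + g x) =
     (\<integral>x. indicator (Sset i) x * f x * f x + indicator (Sset i) x * g x * g x +
         2 * (indicator (Sset i) x * f x * g x) \<partial>Sm i)"
    by (intro Bochner_Integration.integral_cong refl) (simp add: algebra_simps)
  also have "\<dots> = ?I f f + ?I g g + 2 * ?I f g"
    using level_integrable(1)[OF f f] level_integrable(1)[OF g g] level_integrable(1)[OF f g] by simp
  finally show ?thesis using 1 by simp
qed

lemma lev_le_fock: "lev i (F i) \<le> norm2 F"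
  unfolding fock_norm2_lev using sum_le_suminf[of "\<lambda>n. lev n (F n)" "{i}"] by simp

lemma lev_finite: "F \<in> Fock \<Longrightarrow> lev i (F i) < \<infinity>"
  using lev_le_fock[of i F] by (auto simp: fock_space_def intro: le_less_trans)

text \<open>In each degree one of the two vectors vanishes, so every \<open>wt\<close> of the sum is
  the sum of the \<open>wt\<close>. Orthogonality holds at each level \<open>i\<close> separately,
  which makes every term of the series \<open>fock_inner\<close> zero.\<close>

lemma Uop_orth:
  assumes F: "F \<in> EFock" "esupp N F" and G: "G \<in> EFock" "esupp N G"
    and disj: "\<And>n. F n = (\<lambda>_. 0) \<or> G n = (\<lambda>_. 0)"
  shows "(\<integral>x. indicator (Sset i) x * Uop N F i x * Uop N G i x \<partial>Sm i) = 0"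
proof (rule level_polarization)
  note UF = Uop_fock[OF F] and UG = Uop_fock[OF G]
  show "Uop N F i \<in> borel_measurable (Sm i)" "Uop N G i \<in> borel_measurable (Sm i)"
    using UF UG fock_measurable by auto
  show "lev i (Uop N F i) < \<infinity>" "lev i (Uop N G i) < \<infinity>" using lev_finite UF UG by auto
  have m: "emeas F" "emeas G" using F(1) G(1) by (auto simp: efock_emeas)
  have "(\<lambda>x. Uop N F i x + Uop N G i x) = Uop N (vlin 1 F 1 G) i" unfolding Uop_vlin by (simp add: vlin_def)
  then have "lev i (\<lambda>x. Uop N F i x + Uop N G i x) = (\<Sum>ls\<in>ulists N i. wt ls (vlin 1 F 1 G (tot ls)))"
    using lev_Uop[OF emeas_vlin[OF m, of 1 1]] by simp
  also have "\<dots> = (\<Sum>ls\<in>ulists N i. wt ls (F (tot ls)) + wt ls (G (tot ls)))"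
  proof (rule sum.cong[OF refl])
    fix ls
    show "wt ls (vlin 1 F 1 G (tot ls)) = wt ls (F (tot ls)) + wt ls (G (tot ls))"
      using disj[of "tot ls"] by (auto simp: vlin_def)
  qed
  also have "\<dots> = lev i (Uop N F i) + lev i (Uop N G i)"
    by (simp add: lev_Uop[OF m(1)] lev_Uop[OF m(2)] sum.distrib)
  finally show "lev i (\<lambda>x. Uop N F i x + Uop N G i x) = lev i (Uop N F i) + lev i (Uop N G i)" .
qed

text \<open>An element of the closure is approximated by polynomials only; this puts the
  approximants within reach of \<open>Uop_orth\<close>.\<close>

lemma Pn_vec_repr:
  assumes "P \<in> Pn_vec \<nu> n"
  obtains F where "F \<in> EFock" "esupp n F" "feq P (Uop n F)"
proof -
  have "\<exists>F. F \<in> EFock \<and> esupp n F \<and> feq P (Uop n F)"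
    using assms unfolding Pn_vec_def
  proof (induction rule: lin_span_induct)
    case zero
    have "vlin 0 eOmega 0 eOmega \<in> EFock" "esupp n (vlin 0 eOmega 0 eOmega)"
      by (intro efock_space_vlin eOmega_efock esupp_vlin esupp_mono[OF esupp_eOmega]; simp)+
    moreover have "Uop n (vlin 0 eOmega 0 eOmega) = (\<lambda>n x. 0)" unfolding Uop_vlin by (simp add: vlin_def)
    ultimately show ?case using feq_refl by metis
  next
    case (step P g c)
    then obtain F hs where F: "F \<in> EFock" "esupp n F" "feq P (Uop n F)"
      and g: "g = mono_vec \<nu> hs" "length hs \<le> n" "set hs \<subseteq> B0" by auto
    have E: "Evec hs \<in> EFock" "esupp n (Evec hs)"
      using Evec_efock[OF g(3)] esupp_mono g(2) by auto
    have gE: "feq g (Uop n (Evec hs))"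
      using mono_vec_feq[OF g(3)] Uop_mono[OF conjunct2[OF Evec_efock[OF g(3)]] g(2)] g(1) by simp
    have "feq (\<lambda>n x. P n x + c * g n x) (Uop n (vlin 1 F c (Evec hs)))" unfolding feq_def
    proof
      fix m
      show "AE x in Sm m. x \<in> Sset m \<longrightarrow> P m x + c * g m x = Uop n (vlin 1 F c (Evec hs)) m x"
        using F(3)[unfolded feq_def, rule_format, of m] gE[unfolded feq_def, rule_format, of m]
        unfolding Uop_vlin by eventually_elim (auto simp: vlin_def)
    qed
    moreover have "vlin 1 F c (Evec hs) \<in> EFock" "esupp n (vlin 1 F c (Evec hs))"
      using F E by (auto intro: efock_space_vlin esupp_vlin)
    ultimately show ?case by blast
  qed
  then show ?thesis using that by blast
qed

theorem Uop_tens_orth_poly: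
  assumes hs: "set hs \<subseteq> B0" "hs \<noteq> []"
  shows "is_orth_poly \<nu> hs (Uop (length hs) (tens hs))"
proof -
  let ?n = "length hs"
  let ?Q = "Uop ?n (tens hs)"
  note T = tens_efock[OF hs(1)] esupp_tens[of hs]
  have Qf: "?Q \<in> Fock" by (rule Uop_fock[OF T])
  have lt: "?n - 1 < ?n" using hs by (cases hs) auto
  have 1: "?Q \<in> Pcl ?n" by (rule Uop_closure[OF T])
  define low where "low = vdiff (Evec hs) (tens hs)"
  have low: "low \<in> EFock" "esupp (?n - 1) low" unfolding low_def by (rule tens_low[OF hs])+
  have 3: "vdiff (mono_vec \<nu> hs) ?Q \<in> Pcl (?n - 1)"
  proof (rule closure_feq[OF Pn_vec_fock _ Uop_closure[OF low]])
    show "vdiff (mono_vec \<nu> hs) ?Q \<in> Fock"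
      unfolding vdiff_eq_vlin using mono_vec_feq[OF hs(1)] Qf by (intro fock_space_vlin) auto
    have "Uop (?n - 1) low = vdiff (Uop ?n (Evec hs)) ?Q"
      using Uop_mono[OF low(2), of ?n] by (simp add: low_def Uop_vdiff)
    then show "feq (vdiff (mono_vec \<nu> hs) ?Q) (Uop (?n - 1) low)"
      using feq_vdiff[OF conjunct2[OF mono_vec_feq[OF hs(1)]] feq_refl[of ?Q]] by simp
  qed
  have 2: "fock_inner \<nu> ?Q R = 0" if R: "R \<in> Pcl (?n - 1)" for R
  proof -
    have Rf: "R \<in> Fock" by (rule closure_fock[OF R])
    have "(\<integral>x. indicator (Sset i) x * ?Q i x * R i x \<partial>Sm i) = 0" for i
    proof (rule ccontr)
      let ?X = "\<integral>x. indicator (Sset i) x * ?Q i x * R i x \<partial>Sm i"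
      assume "?X \<noteq> 0"
      then have X: "?X\<^sup>2 > 0" by simp
      obtain c where c: "lev i (?Q i) = ennreal c" "c \<ge> 0"
        using lev_finite[OF Qf, of i] by (cases "lev i (?Q i)") auto
      \<comment> \<open>With \<open>c\<close> the squared norm of \<open>?Q\<close> at level
        \<open>i\<close>, Cauchy-Schwarz against an approximation error below \<open>e\<close> gives
        \<open>?X\<^sup>2 \<le> c * e\<close>, less than \<open>(c + 1) * e\<close>, which equals
        \<open>?X\<^sup>2\<close>.\<close>
      define e where "e = ?X\<^sup>2 / (c + 1)"
      have e: "e > 0" using X c(2) by (simp add: e_def)
      from R e obtain P where P: "P \<in> Pn_vec \<nu> (?n - 1)" "norm2 (vdiff R P) < ennreal e"
        unfolding fock_closure_def by blast
      have Pf: "P \<in> Fock" using P(1) Pn_vec_fock by blast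
      obtain F where F: "F \<in> EFock" "esupp (?n - 1) F" "feq P (Uop (?n - 1) F)"
        by (rule Pn_vec_repr[OF P(1)])
      have F': "esupp ?n F" by (rule esupp_mono[OF F(2)]) simp
      have UF: "Uop (?n - 1) F = Uop ?n F" by (rule Uop_mono[OF F(2)]) simp
      have "(\<integral>x. indicator (Sset i) x * ?Q i x * Uop ?n F i x \<partial>Sm i) = 0"
      proof (rule Uop_orth[OF T F(1) F'])
        fix n
        show "tens hs n = (\<lambda>_. 0) \<or> F n = (\<lambda>_. 0)"
          using F(2) lt by (cases "n = ?n") (auto simp: esupp_def tens_def)
      qed
      moreover have "(\<integral>x. indicator (Sset i) x * ?Q i x * P i x \<partial>Sm i)
          = (\<integral>x. indicator (Sset i) x * ?Q i x * Uop ?n F i x \<partial>Sm i)"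
      proof (rule integral_cong_AE)
        show "AE x in Sm i. indicator (Sset i) x * ?Q i x * P i x = indicator (Sset i) x * ?Q i x * Uop ?n F i x"
          using F(3)[unfolded feq_def UF, rule_format, of i] by eventually_elim (auto simp: indicator_def)
      qed (use fock_measurable[OF Qf, of i] fock_measurable[OF Pf, of i] fock_measurable[OF Uop_fock[OF F(1) F'], of i] in measurable)
      ultimately have QP: "(\<integral>x. indicator (Sset i) x * ?Q i x * P i x \<partial>Sm i) = 0" by simp
      have D: "vdiff R P \<in> Fock" unfolding vdiff_eq_vlin by (rule fock_space_vlin[OF Rf Pf])
      note fm = fock_measurable[OF Qf, of i] lev_finite[OF Qf, of i]
      note iR = level_integrable(1)[OF fm fock_measurable[OF Rf] lev_finite[OF Rf]]
      note iP = level_integrable(1)[OF fm fock_measurable[OF Pf] lev_finite[OF Pf]]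
      have "(\<integral>x. indicator (Sset i) x * ?Q i x * vdiff R P i x \<partial>Sm i) = ?X"
        using iR iP QP by (simp add: vdiff_def right_diff_distrib)
      then have "ennreal (?X\<^sup>2) \<le> lev i (?Q i) * lev i (vdiff R P i)"
        using level_integrable(2)[OF fm fock_measurable[OF D] lev_finite[OF D]] by simp
      also have "\<dots> \<le> ennreal c * ennreal e"
        unfolding c(1) using lev_le_fock[of i "vdiff R P"] P(2)
        by (intro mult_left_mono) (auto intro: order.trans less_imp_le)
      also have "\<dots> = ennreal (c * e)" using c e by (simp add: ennreal_mult)
      finally have "?X\<^sup>2 \<le> c * e" using c(2) e by (simp add: ennreal_le_iff)
      moreover have "?X\<^sup>2 = (c + 1) * e" using c(2) by (simp add: e_def)
      ultimately show False using e by (simp add: distrib_right)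
    qed
    then show ?thesis by (simp add: fock_inner_def)
  qed
  show ?thesis unfolding is_orth_poly_def using 1 2 3 by blast
qed

end

subsection \<open>Identification of the unitary operator\<close>

lemma ennreal_suminf_tail:
  fixes f :: "nat \<Rightarrow> ennreal"
  assumes "(\<Sum>n. f n) < \<infinity>" "(e::real) > 0"
  obtains N where "(\<Sum>n. if n \<le> N then 0 else f n) < ennreal e"
proof -
  have fin: "f n < \<infinity>" for n
    using sum_le_suminf[of f "{n}"] assms(1) by (auto intro: le_less_trans)
  define r where "r n = enn2real (f n)" for n
  have r: "ennreal (r n) = f n" "r n \<ge> 0" for n using fin by (auto simp: r_def)
  have "summable r" by (rule summable_suminf_not_top) (use r assms(1) in auto)
  then obtain N where N: "norm (\<Sum>i. r (i + Suc N)) < e"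
    using suminf_exist_split[OF assms(2), of r] by (metis le_SucI order_refl)
  have "(\<Sum>n. if n \<le> N then 0 else f n) = (\<Sum>n. f (n + Suc N))"
    using suminf_offset[of "\<lambda>n. if n \<le> N then 0 else f n" "Suc N"] by simp
  also have "\<dots> = (\<Sum>n. ennreal (r (n + Suc N)))" by (simp only: r)
  also have "\<dots> = ennreal (\<Sum>n. r (n + Suc N))"
    by (rule suminf_ennreal2) (use r \<open>summable r\<close> summable_iff_shift[of r "Suc N"] in auto)
  also have "\<dots> < ennreal e" using N assms(2) by (intro ennreal_lessI) auto
  finally show ?thesis by (rule that)
qed

context compact_prob
begin

lemma efock_diff_trunc_small:
  assumes "F \<in> EFock" "(e::real) > 0"
  obtains N where "\<And>M. M \<ge> N \<Longrightarrow> enorm2 (vdiff F (trunc M F)) < ennreal e"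
proof -
  have "(\<Sum>n. elev n (F n)) < \<infinity>" using assms(1) by (simp add: efock_emeas efock_norm2_elev)
  then obtain N where N: "(\<Sum>n. if n \<le> N then 0 else elev n (F n)) < ennreal e"
    by (rule ennreal_suminf_tail[OF _ assms(2)])
  have "enorm2 (vdiff F (trunc M F)) < ennreal e" if "M \<ge> N" for M
  proof -
    have "enorm2 (vdiff F (trunc M F)) \<le> (\<Sum>n. if n \<le> N then 0 else elev n (F n))"
      unfolding efock_norm2_elev using that by (intro suminf_le) (auto simp: vdiff_def trunc_def)
    then show ?thesis using N by simp
  qed
  then show ?thesis by (rule that)
qed

lemma vdiff_efock: "F \<in> EFock \<Longrightarrow> G \<in> EFock \<Longrightarrow> vdiff F G \<in> EFock"
  unfolding vdiff_eq_vlin by (rule efock_space_vlin)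

lemma efock_norm2_sym: "enorm2 (vdiff F G) = enorm2 (vdiff G F)"
  unfolding efock_norm2_elev elev_def wt_def vdiff_def by (simp add: power2_commute)

lemma efock_zero: "(\<lambda>n t. 0) \<in> EFock"
  by (simp add: efock_emeas emeas_def efock_norm2_elev)

lemma vdiff_zero: "vdiff F (\<lambda>n t. 0) = F"
  by (simp add: vdiff_def)

lemma efock_norm2_le2:
  assumes "F \<in> EFock" "G \<in> EFock"
  shows "enorm2 F \<le> 2 * enorm2 (vdiff F G) + 2 * enorm2 G"
  using efock_triangle[OF assms efock_zero] by (simp add: vdiff_zero)

lemma double_small:
  assumes "x < ennreal (e / 2)" "0 < e" shows "2 * x < ennreal e"
proof -
  have "2 * x < 2 * ennreal (e / 2)" using assms by (simp add: ennreal_mult_strict_left_mono)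
  also have "\<dots> = ennreal (2 * (e / 2))" using assms(2) by (subst ennreal_mult) auto
  finally show ?thesis by simp
qed

section \<open>Consequences of the defining properties of \<open>J\<close>\<close>

context
  fixes J assumes J: "is_J \<nu> J"
begin

lemma J_efock: "G \<in> L2tau \<nu> \<Longrightarrow> J G \<in> EFock"
  using J by (simp add: is_J_def)

lemma J_lin: "G \<in> L2tau \<nu> \<Longrightarrow> H \<in> L2tau \<nu> \<Longrightarrow>
    enorm2 (vdiff (J (vlin a G b H)) (vlin a (J G) b (J H))) = 0"
  using J by (simp add: is_J_def)

lemma J_norm: "G \<in> L2tau \<nu> \<Longrightarrow> enorm2 (J G) = norm2 G"
  using J by (simp add: is_J_def)

lemma J_Omega: "enorm2 (vdiff (J Omega) eOmega) = 0"
  using J by (simp add: is_J_def)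

lemma J_orth: "hs \<noteq> [] \<Longrightarrow> set hs \<subseteq> B0 \<Longrightarrow>
    is_orth_poly \<nu> hs Q \<Longrightarrow> enorm2 (vdiff (J Q) (tens hs)) = 0"
  using J by (simp add: is_J_def)

text \<open>\<open>J\<close> of a difference and the difference of the images agree up to a null
  vector, which costs the factor 2 in both directions. In particular \<open>J\<close> respects
  almost-everywhere equality.\<close>

lemma J_diff_le:
  assumes G: "G \<in> L2tau \<nu>" and H: "H \<in> L2tau \<nu>"
  shows "enorm2 (vdiff (J G) (J H)) \<le> 2 * norm2 (vdiff G H)"
    and "norm2 (vdiff G H) \<le> 2 * enorm2 (vdiff (J G) (J H))"
proof -
  have D: "vdiff G H \<in> L2tau \<nu>" unfolding vdiff_eq_vlin by (rule L2tau_vlin[OF G H])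
  note X = vdiff_efock[OF J_efock[OF G] J_efock[OF H]] and Y = J_efock[OF D]
  have z: "enorm2 (vdiff (J (vdiff G H)) (vdiff (J G) (J H))) = 0"
    using J_lin[OF G H, of 1 "-1"] by (simp add: vdiff_eq_vlin)
  show "enorm2 (vdiff (J G) (J H)) \<le> 2 * norm2 (vdiff G H)"
    using efock_norm2_le2[OF X Y] z J_norm[OF D] by (simp add: efock_norm2_sym)
  show "norm2 (vdiff G H) \<le> 2 * enorm2 (vdiff (J G) (J H))"
    using efock_norm2_le2[OF Y X] z J_norm[OF D] by simp
qed

text \<open>For tensors this is the defining property of \<open>J\<close> combined with
  \<open>Uop_tens_orth_poly\<close>; \<open>efock_induct\<close> carries it to all vectors of
  bounded degree.\<close>

lemma J_Uop:
  assumes F: "F \<in> EFock" "esupp N F"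
  shows "enorm2 (vdiff (J (Uop N F)) F) = 0"
proof (rule efock_induct[OF F, of "\<lambda>F. enorm2 (vdiff (J (Uop N F)) F) = 0"])
  fix F G a b assume F: "F \<in> EFock" "esupp N F" "enorm2 (vdiff (J (Uop N F)) F) = 0"
    and G: "G \<in> EFock" "esupp N G" "enorm2 (vdiff (J (Uop N G)) G) = 0"
  note UF = Uop_L2tau[OF F(1,2)] and UG = Uop_L2tau[OF G(1,2)]
  let ?X = "vlin a (J (Uop N F)) b (J (Uop N G))"
  have L: "Uop N (vlin a F b G) \<in> L2tau \<nu>" unfolding Uop_vlin by (rule L2tau_vlin[OF UF UG])
  have X: "?X \<in> EFock" by (intro efock_space_vlin J_efock UF UG)
  have "enorm2 (vdiff ?X (vlin a F b G)) \<le>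
      ennreal (2 * a\<^sup>2) * enorm2 (vdiff (J (Uop N F)) F) + ennreal (2 * b\<^sup>2) * enorm2 (vdiff (J (Uop N G)) G)"
    unfolding vdiff_vlin
    using vdiff_efock[OF J_efock[OF UF] F(1)] vdiff_efock[OF J_efock[OF UG] G(1)]
    by (intro efock_norm2_vlin) (auto simp: efock_emeas)
  then have "enorm2 (vdiff ?X (vlin a F b G)) = 0" using F(3) G(3) by simp
  moreover have "enorm2 (vdiff (J (Uop N (vlin a F b G))) ?X) = 0"
    unfolding Uop_vlin by (rule J_lin[OF UF UG])
  ultimately show "enorm2 (vdiff (J (Uop N (vlin a F b G))) (vlin a F b G)) = 0"
    using efock_triangle[OF J_efock[OF L] X efock_space_vlin[OF F(1) G(1), of a b]] by simp
next
  fix F assume F: "F \<in> EFock" "esupp N F"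
    and ap: "\<And>e::real. e > 0 \<Longrightarrow> \<exists>G. G \<in>
        EFock \<and> esupp N G \<and> enorm2 (vdiff (J (Uop N G)) G) = 0 \<and> enorm2 (vdiff F G) < ennreal e"
  note UF = Uop_L2tau[OF F]
  have step: "enorm2 (vdiff (J (Uop N F)) F) \<le> 0 + ennreal e" if e: "e > 0" for e :: real
  proof -
    \<comment> \<open>Two nested uses of \<open>efock_triangle\<close> together with
      \<open>J_diff_le\<close> leave eight times the approximation error.\<close>
    have "e / 8 > 0" using e by simp
    from ap[OF this] obtain G where G: "G \<in> EFock" "esupp N G"
      "enorm2 (vdiff (J (Uop N G)) G) = 0" "enorm2 (vdiff F G) < ennreal (e / 8)" by blast
    note UG = Uop_L2tau[OF G(1,2)]
    have "enorm2 (vdiff (J (Uop N F)) F) \<le>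
        2 * enorm2 (vdiff (J (Uop N F)) (J (Uop N G))) + 2 * enorm2 (vdiff (J (Uop N G)) F)"
      by (rule efock_triangle[OF J_efock[OF UF] J_efock[OF UG] F(1)])
    also have "\<dots> \<le> 2 * (2 * enorm2 (vdiff F G)) + 2 * (2 * 0 + 2 * enorm2 (vdiff G F))"
      using J_diff_le(1)[OF UF UG] Uop_diff_norm[OF F G(1,2)] efock_triangle[OF J_efock[OF UG] G(1) F(1)] G(3)
      by (intro add_mono mult_left_mono) simp_all
    also have "\<dots> = 8 * enorm2 (vdiff F G)"
      by (simp add: efock_norm2_sym[of G F] mult.assoc[symmetric] distrib_right[symmetric])
    also have "\<dots> \<le> 8 * ennreal (e / 8)" using G(4) by (intro mult_left_mono) auto
    also have "\<dots> = ennreal e" using e by (simp add: ennreal_mult[symmetric] ennreal_numeral[symmetric] del: ennreal_numeral)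
    finally show ?thesis by simp
  qed
  have "enorm2 (vdiff (J (Uop N F)) F) \<le> 0" by (rule ennreal_le_epsilon, rule step)
  then show "enorm2 (vdiff (J (Uop N F)) F) = 0" by simp
next
  show "enorm2 (vdiff (J (Uop N eOmega)) eOmega) = 0" using J_Omega by (simp add: Uop_eOmega)
next
  fix hs :: "(real \<Rightarrow> real) list" assume hs: "set hs \<subseteq> B0" "hs \<noteq> []" "length hs \<le> N"
  show "enorm2 (vdiff (J (Uop N (tens hs))) (tens hs)) = 0"
    using J_orth[OF hs(2,1) Uop_tens_orth_poly[OF hs(1,2)]] Uop_mono[OF esupp_tens hs(3)] by simp
qed

text \<open>\<open>J\<close> sends \<open>Uop M (trunc M (J G))\<close> to the truncation itself, so
  the distance to \<open>G\<close> is controlled by the tail of \<open>J G\<close>. The bound holds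
  for all large \<open>M\<close> because \<open>M\<close> must later also exceed a given
  degree.\<close>

lemma L2tau_approx:
  assumes G: "G \<in> L2tau \<nu>" and e: "(e::real) > 0"
  obtains N where "\<And>M. M \<ge> N \<Longrightarrow> norm2 (vdiff G (Uop M (trunc M (J G)))) < ennreal e"
proof -
  note F = J_efock[OF G]
  have "e / 4 > 0" using e by simp
  then obtain N where N: "\<And>M. M \<ge> N \<Longrightarrow> enorm2 (vdiff (J G) (trunc M (J G))) < ennreal (e / 4)"
    by (rule efock_diff_trunc_small[OF F]) blast
  have "norm2 (vdiff G (Uop M (trunc M (J G)))) < ennreal e" if M: "M \<ge> N" for M
  proof -
    note T = trunc_efock[OF F, of M] trunc_esupp[of M "J G"]
    note U = Uop_L2tau[OF T]
    have "enorm2 (vdiff (J G) (J (Uop M (trunc M (J G))))) \<le>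
        2 * enorm2 (vdiff (J G) (trunc M (J G))) + 2 * enorm2 (vdiff (trunc M (J G)) (J (Uop M (trunc M (J G)))))"
      by (rule efock_triangle[OF F T(1) J_efock[OF U]])
    also have "\<dots> = 2 * enorm2 (vdiff (J G) (trunc M (J G)))"
      using J_Uop[OF T] by (simp add: efock_norm2_sym[of "trunc M (J G)"])
    also have "\<dots> < ennreal (e / 2)" by (rule double_small) (use N[OF M] e in auto)
    finally have "2 * enorm2 (vdiff (J G) (J (Uop M (trunc M (J G))))) < ennreal e"
      by (rule double_small[OF _ e])
    then show ?thesis using J_diff_le(2)[OF G U] by (rule le_less_trans[rotated])
  qed
  then show ?thesis by (rule that)
qed

lemma omega_Uop_L2tau:
  assumes h: "h \<in> B0" and F: "F \<in> EFock" "esupp N F"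
  shows "omega \<nu> h (Uop N F) \<in> L2tau \<nu>" "enorm2 (vdiff (J (omega \<nu> h (Uop N F))) (ABop \<nu> h F)) = 0"
proof -
  note A = ABop_efock[OF h F] ABop_esupp[OF F(2), of \<nu> h]
  note UA = Uop_L2tau[OF A]
  note eq = omega_Uop[OF h F]
  show L: "omega \<nu> h (Uop N F) \<in> L2tau \<nu>" unfolding L2tau_def
    by (rule closure_feq[OF P_vec_fock omega_space[OF h Uop_fock[OF F]] UA[unfolded L2tau_def] eq])
  have "enorm2 (vdiff (J (omega \<nu> h (Uop N F))) (J (Uop (Suc N) (ABop \<nu> h F)))) = 0"
    using J_diff_le(1)[OF L UA] feq_vdiff_0[OF eq] by simp
  then show "enorm2 (vdiff (J (omega \<nu> h (Uop N F))) (ABop \<nu> h F)) = 0"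
    using efock_triangle[OF J_efock[OF L] J_efock[OF UA] A(1)] J_Uop[OF A] by simp
qed

text \<open>Component \<open>n\<close> reads degrees \<open>n - 1\<close>, \<open>n\<close> and
  \<open>n + 1\<close> only, and \<open>n + 1 \<le> M\<close>.\<close>

lemma ABop_trunc:
  assumes "n < M" shows "ABop \<nu> h (trunc M F) n = ABop \<nu> h F n"
  using assms by (auto simp: ABop_def trunc_def fun_eq_iff)

theorem J_omega:
  assumes h: "h \<in> B0" and G: "G \<in> L2tau \<nu>"
  shows "enorm2 (vdiff (J (omega \<nu> h G)) (ABop \<nu> h (J G))) = 0"
proof -
  note F = J_efock[OF G] and Gf = L2tau_fock[OF G]
  obtain C0 where C0: "C0 < \<infinity>"
    "\<And>F. (\<And>n. F n \<in> borel_measurable (Sm n)) \<Longrightarrow> norm2 (omega \<nu> h F) \<le> C0 * norm2 F"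
    by (rule omega_bounded[OF h]) blast
  obtain C where C: "C0 = ennreal C" "C \<ge> 0" using C0(1) by (cases C0) auto
  define GM where "GM M = Uop M (trunc M (J G))" for M
  note T = trunc_efock[OF F] trunc_esupp[of _ "J G"]
  have GM: "GM M \<in> Fock" for M unfolding GM_def by (rule Uop_fock[OF T])
  have oGM: "omega \<nu> h (GM M) \<in> L2tau \<nu>" for M unfolding GM_def by (rule omega_Uop_L2tau(1)[OF h T])
  have small: "\<exists>N. \<forall>M\<ge>N. norm2 (vdiff (omega \<nu> h G) (omega \<nu> h (GM M))) < ennreal e" if e: "e > 0" for e :: real
  proof -
    \<comment> \<open>The \<open>+ 1\<close> guards against \<open>C = 0\<close> and makes the final
      bound strict.\<close>
    have "e / (C + 1) > 0" using e C(2) by simp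
    then obtain N where N: "\<And>M. M \<ge> N \<Longrightarrow> norm2 (vdiff G (GM M)) < ennreal (e / (C + 1))"
      unfolding GM_def by (rule L2tau_approx[OF G]) blast
    have "norm2 (vdiff (omega \<nu> h G) (omega \<nu> h (GM M))) < ennreal e" if M: "M \<ge> N" for M
    proof -
      have "vdiff G (GM M) \<in> Fock" unfolding vdiff_eq_vlin by (rule fock_space_vlin[OF Gf GM])
      then have "norm2 (vdiff (omega \<nu> h G) (omega \<nu> h (GM M))) \<le> C0 * norm2 (vdiff G (GM M))"
        unfolding omega_diff_norm[OF h Gf GM] by (intro C0(2) fock_measurable)
      also have "\<dots> \<le> ennreal C * ennreal (e / (C + 1))"
        unfolding C(1) using N[OF M] by (intro mult_left_mono) auto
      also have "\<dots> = ennreal (C * (e / (C + 1)))"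
        by (rule ennreal_mult[symmetric]) (use C(2) e in auto)
      also have "\<dots> < ennreal e"
        using C(2) e by (intro ennreal_lessI) (simp_all add: field_simps)
      finally show ?thesis .
    qed
    then show ?thesis by blast
  qed
  have oG: "omega \<nu> h G \<in> L2tau \<nu>" unfolding L2tau_def
  proof (rule closure_closed[OF P_vec_fock omega_space[OF h Gf]])
    fix e :: real assume "e > 0"
    from small[OF this] obtain N where "\<forall>M\<ge>N. norm2 (vdiff (omega \<nu> h G) (omega \<nu> h (GM M))) < ennreal e" by blast
    then show "\<exists>H\<in>fock_closure \<nu> (P_vec \<nu>). norm2 (vdiff (omega \<nu> h G) H) < ennreal e"
      using oGM[of N] unfolding L2tau_def by blast
  qed
  have "elev n (vdiff (J (omega \<nu> h G)) (ABop \<nu> h (J G)) n) = 0" for n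
  proof -
    have step: "elev n (vdiff (J (omega \<nu> h G)) (ABop \<nu> h (J G)) n) \<le> 0 + ennreal e" if e: "e > 0" for e :: real
    proof -
      have "e / 4 > 0" using e by simp
      from small[OF this] obtain N where N: "\<forall>M\<ge>N. norm2 (vdiff (omega \<nu> h G) (omega \<nu> h (GM M))) < ennreal (e / 4)" by blast
      \<comment> \<open>At least \<open>N\<close> for the approximation, and above \<open>n\<close>
        so that truncation leaves component \<open>n\<close> of \<open>ABop\<close>
        unchanged.\<close>
      define M where "M = max N (Suc n)"
      have M: "M \<ge> N" "n < M" by (auto simp: M_def)
      note A = ABop_efock[OF h T, of M]
      have "elev n (vdiff (J (omega \<nu> h G)) (ABop \<nu> h (J G)) n) =
          elev n (vdiff (J (omega \<nu> h G)) (ABop \<nu> h (trunc M (J G))) n)"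
        unfolding vdiff_def ABop_trunc[OF M(2)] ..
      also have "\<dots> \<le> enorm2 (vdiff (J (omega \<nu> h G)) (ABop \<nu> h (trunc M (J G))))"
        by (rule elev_le_efock)
      also have "\<dots> \<le> 2 * enorm2 (vdiff (J (omega \<nu> h G)) (J (omega \<nu> h (GM M))))
          + 2 * enorm2 (vdiff (J (omega \<nu> h (GM M))) (ABop \<nu> h (trunc M (J G))))"
        by (rule efock_triangle[OF J_efock[OF oG] J_efock[OF oGM] A])
      also have "\<dots> = 2 * enorm2 (vdiff (J (omega \<nu> h G)) (J (omega \<nu> h (GM M))))"
        using omega_Uop_L2tau(2)[OF h T, of M] by (simp add: GM_def)
      also have "\<dots> \<le> 2 * (2 * norm2 (vdiff (omega \<nu> h G) (omega \<nu> h (GM M))))"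
        by (intro mult_left_mono J_diff_le(1) oG oGM) auto
      also have "\<dots> \<le> ennreal e"
      proof (rule less_imp_le[OF double_small[OF double_small e]])
        show "norm2 (vdiff (omega \<nu> h G) (omega \<nu> h (GM M))) < ennreal (e / 2 / 2)"
          using N M(1) by simp
      qed (use e in simp)
      finally show ?thesis by simp
    qed
    have "elev n (vdiff (J (omega \<nu> h G)) (ABop \<nu> h (J G)) n) \<le> 0" by (rule ennreal_le_epsilon, rule step)
    then show ?thesis by simp
  qed
  then show ?thesis by (simp add: efock_norm2_elev)
qed

end

end

text \<open>Vanishing of \<open>efock_norm2\<close> of the difference is equality in the extended
  Fock space. Since \<open>J\<close> is isometric and onto up to null vectors, this intertwining
  relation is the asserted formula for the conjugated operator.\<close>

theorem theorem3p3:
  fixes \<nu> :: "real measure" and h :: "real \<Rightarrow> real" and J :: "fockvec \<Rightarrow> efockvec"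
  assumes "prob_space \<nu>" and "sets \<nu> = sets borel" and "compact_support \<nu>"
    and "h \<in> B0"
    and "is_J \<nu> J"
  shows "\<forall>G\<in>L2tau \<nu>. efock_norm2 \<nu> (vdiff (J (omega \<nu> h G)) (ABop \<nu> h (J G))) = 0"
proof -
  interpret compact_prob \<nu>
    using assms(1-3) by (simp add: compact_prob_def compact_prob_axioms_def)
  show ?thesis using J_omega[OF assms(5,4)] by blast
qed

end
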